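(* Let $\{X_n\}$ be the Bessel-like walk described in the context, with drift parameter $\delta\ge -1$, $\kappa=(1+\delta)/2$, and constant $K_0$ and function $L$ as defined there. (a) If $\delta>-1$, then \[ P_0(\tau_0\ge n)\sim \frac{2^{1-\kappa}}{K_0\Gamma(\kappa)}\,n^{-\kappa}L(\sqrt n)\quad\text{as } n\to\infty, \] and, as $n\to\infty$ through even integers, \[ P_0(\tau_0=n)\sim \frac{2^{2-\kappa}\kappa}{K_0\Gamma(\kappa)}\,n^{-(\kappa+1)}L(\sqrt n). \] (b) If $\delta=-1$ and the walk is recurrent (i.e. $M_x\to\infty$ as $x\to\infty$), then \[ P_0(\tau_0\ge n)\sim \frac{1}{K_0\,\nu(n)}\quad\text{as } n\to\infty, \] where $\nu(n)=\sum_{l\le n,\ l\text{ even},\, l\ge 2}\frac{1}{l\,L(\sqrt l)}$.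
   Context: Let $\{X_n\}_{n\ge0}$ be a Markov chain on $\mathbb{Z}_+=\{0,1,2,\dots\}$ with steps $\pm1$, reflecting at $0$ (i.e. $p(0,1)=1$), and for $x\ge1$ transition probabilities $p_x=p(x,x+1)$, $q_x=p(x,x-1)=1-p_x$. A drift parameter $\delta\ge-1$ is fixed and $R_x$ is defined by $p_x=\frac12\left(1-\frac{\delta}{2x}+\frac{R_x}{2}\right)$, where it is assumed that $R_x=o(1/x)$ as $x\to\infty$. Uniform ellipticity is assumed: there is $\epsilon>0$ with $p_x,q_x\in[\epsilon,1-\epsilon]$ for all $x\ge1$. Set $\kappa=(1+\delta)/2$. Define $\lambda_0=1$, $\lambda_x=\prod_{k=1}^x q_k/p_k$ for $x\ge1$, $M_0=0$, $M_x=\sum_{k=0}^{x-1}\lambda_k$ for $x\ge1$ (the scale function), and $L(x)=\exp(R_1+\dots+R_x)$ for integers $x\ge1$, extended to $[1,\infty)$ by linear interpolation ($L$ is slowly varying). There is a constant $K_0>0$ such that $\lambda_x\sim K_0x^{2\kappa-1}L(x)^{-1}$ as $x\to\infty$; $K_0$ denotes this constant. $P_j$ denotes the law of the chain started at $j$, and $\tau_j=\min\{n\ge1:X_n=j\}$ (so under $P_0$, $\tau_0$ is the first return time to $0$). $a_n\sim b_n$ means $a_n/b_n\to1$. *)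

theory Defs
  imports "HOL-Analysis.Analysis" "HOL-Library.Landau_Symbols"
begin

definition trans_prob :: "(nat \<Rightarrow> real) \<Rightarrow> nat \<Rightarrow> nat \<Rightarrow> real" where
  "trans_prob p x y =
     (if x = 0 then (if y = 1 then 1 else 0)
      else if y = Suc x then p x
      else if Suc y = x then 1 - p x
      else 0)"

text \<open>taboo p k y = P_0(X_k = y and X_j \<noteq> 0 for 1 <= j <= k)
  (chain started at 0 and killed on return to 0). At time k the chain is in {0..k}.\<close>

fun taboo :: "(nat \<Rightarrow> real) \<Rightarrow> nat \<Rightarrow> nat \<Rightarrow> real" where
  "taboo p 0 y = (if y = 0 then 1 else 0)"
| "taboo p (Suc k) y =
     (if y = 0 then 0 else (\<Sum>x\<le>k. taboo p k x * trans_prob p x y))"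

definition first_return_prob :: "(nat \<Rightarrow> real) \<Rightarrow> nat \<Rightarrow> real" where
  "first_return_prob p n =
     (if n = 0 then 0 else (\<Sum>x\<le>n - 1. taboo p (n - 1) x * trans_prob p x 0))"

text \<open>P_0(tau_0 >= n) = P_0(no visit to 0 at times 1..n-1).\<close>
definition return_tail_prob :: "(nat \<Rightarrow> real) \<Rightarrow> nat \<Rightarrow> real" where
  "return_tail_prob p n = (if n = 0 then 1 else (\<Sum>x\<le>n - 1. taboo p (n - 1) x))"

text \<open>R_x defined by p_x = (1/2)(1 - delta/(2x) + R_x/2).\<close>
definition Rterm :: "real \<Rightarrow> (nat \<Rightarrow> real) \<Rightarrow> nat \<Rightarrow> real" where
  "Rterm \<delta> p x = 2 * (2 * p x - 1) + \<delta> / real x"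

definition kappa :: "real \<Rightarrow> real" where
  "kappa \<delta> = (1 + \<delta>) / 2"

definition lam :: "(nat \<Rightarrow> real) \<Rightarrow> nat \<Rightarrow> real" where
  "lam p x = (\<Prod>k\<in>{1..x}. (1 - p k) / p k)"

definition scaleM :: "(nat \<Rightarrow> real) \<Rightarrow> nat \<Rightarrow> real" where
  "scaleM p x = (\<Sum>k<x. lam p k)"

definition Lnat :: "real \<Rightarrow> (nat \<Rightarrow> real) \<Rightarrow> nat \<Rightarrow> real" where
  "Lnat \<delta> p n = exp (\<Sum>k\<in>{1..n}. Rterm \<delta> p k)"

definition Lfun :: "real \<Rightarrow> (nat \<Rightarrow> real) \<Rightarrow> real \<Rightarrow> real" where
  "Lfun \<delta> p y =
     (let n = nat \<lfloor>y\<rfloor> in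
        Lnat \<delta> p n + (y - real n) * (Lnat \<delta> p (Suc n) - Lnat \<delta> p n))"

definition nu :: "real \<Rightarrow> (nat \<Rightarrow> real) \<Rightarrow> nat \<Rightarrow> real" where
  "nu \<delta> p n = (\<Sum>l\<in>{l. 2 \<le> l \<and> l \<le> n \<and> even l}. 1 / (real l * Lfun \<delta> p (sqrt (real l))))"

end

theory Submission
  imports Defs "HOL-Real_Asymp.Real_Asymp"
begin

text \<open>
  Let \<open>M = scaleM p\<close>, which is harmonic for the walk killed at 0 and regularly varying of index \<open>2\<kappa>\<close>. Weighting
  the killed walk with \<open>M\<close> gives a Bessel-like walk \<open>Y\<close> of dimension \<open>2\<kappa> + 2\<close>, and
  \<open>P\<^sub>0(\<tau>\<^sub>0 > n) = E[1 / M(Y\<^sub>n)]\<close>. Since \<open>(1 + 2\<theta>(n-k)) powr -(\<kappa>+1) * exp(-\<theta>y\<^sup>2 / (1 + 2\<theta>(n-k)))\<close> is an approximate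
  space-time martingale for \<open>Y\<close>, the Laplace transform of \<open>Y\<^sub>n\<^sup>2 / n\<close> at \<open>s\<close> tends to \<open>(1 + 2s) powr -(\<kappa>+1)\<close>. For
  \<open>\<kappa> > 0\<close>, writing \<open>x powr -\<kappa>\<close> as a mixture of exponentials yields \<open>P\<^sub>0(\<tau>\<^sub>0 > n) * M(\<surd>n) \<rightarrow> 2 powr -\<kappa> / Gamma(\<kappa>+1)\<close>,
  once small values of \<open>Y\<^sub>n\<close> are controlled by an occupation time bound. For \<open>\<kappa> = 0\<close>, where \<open>M\<close> varies slowly, a
  bound on the exit time from \<open>{1..<H}\<close> replaces the latter. Finally, the killed walk is reversible, so
  \<open>P\<^sub>0(\<tau>\<^sub>0 = 2m)\<close> is decreasing in \<open>m\<close> and a monotone density argument passes from the tail to the point probabilities.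
\<close>

section \<open>Weighted means and ratio asymptotics\<close>

text \<open>The main obstacle is the upper bound for \<kappa> > 0. The limit law of
  \<open>Y_n^2 / n\<close> is Gamma with shape \<kappa> + 1 and scale 2, and its moment of order
  -\<kappa> is the constant in the tail. But \<open>M(sqrt n) / M(y)\<close> is unbounded for y far
  below sqrt n, so convergence of Laplace transforms alone bounds survival only from below. The
  occupation bound that handles small values is itself proportional to the survival probability at
  an earlier time. The estimate thus becomes a recursion, which closes because its coefficient can
  be made arbitrarily small. For \<kappa> = 0 that route breaks down, as
  \<open>conduct z * M z\<close> is no longer \<open>O(z)\<close>; slow variation compensates, since
  all y of order sqrt n then have asymptotically the same \<open>M y\<close>. All limits are stated
  for \<open>survival n * M (isqrt n)\<close>, one normalisation for every \<delta> \<ge> -1.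
  \<open>K0\<close> and \<open>L\<close> enter only at the end: through
  \<open>M x ~ x * lam x / (2\<kappa>)\<close> when \<kappa> > 0, and through a blockwise comparison
  of \<open>nu\<close> with \<open>M\<close> when \<delta> = -1.\<close>

lemma tendsto_obtain_greater:
  fixes f :: "nat \<Rightarrow> real"
  assumes "f \<longlonglongrightarrow> L" "z < L"
  obtains n where "n \<ge> k" "z < f n"
  using eventually_conj[OF eventually_ge_at_top[of k] order_tendstoD(1)[OF assms]]
  by (auto simp: eventually_sequentially)

lemma tendsto_obtain_less:
  fixes f :: "nat \<Rightarrow> real"
  assumes "f \<longlonglongrightarrow> L" "L < z"
  obtains n where "n \<ge> k" "f n < z"
  using eventually_conj[OF eventually_ge_at_top[of k] order_tendstoD(2)[OF assms]]
  by (auto simp: eventually_sequentially)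

text \<open>Toeplitz averaging: the weights have divergent sum, so the finitely many terms with
  \<open>d\<close> far from \<open>l\<close> wash out. With \<open>d k\<close> a quotient of
  increments this is the Stolz-Cesaro theorem, and in that form it plays the role of Karamata's
  theorem for the sums below.\<close>

lemma weighted_mean_tendsto:
  fixes c d :: "nat \<Rightarrow> real"
  assumes c0: "\<And>k. c k \<ge> 0"
    and div: "filterlim (\<lambda>n. \<Sum>k<n. c k) at_top sequentially"
    and d: "d \<longlonglongrightarrow> l"
  shows "(\<lambda>n. (\<Sum>k<n. d k * c k) / (\<Sum>k<n. c k)) \<longlonglongrightarrow> l"
proof (rule LIMSEQ_I)
  fix e :: real assume e: "e > 0"
  obtain N where N: "\<And>k. k \<ge> N \<Longrightarrow> norm (d k - l) < e / 2"
    using LIMSEQ_D[OF d, of "e/2"] e by auto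
  define B where "B = (\<Sum>k<N. \<bar>d k - l\<bar> * c k)"
  have B0: "B \<ge> 0" unfolding B_def by (intro sum_nonneg mult_nonneg_nonneg) (auto simp: c0)
  \<comment> \<open>This size makes the fixed contribution \<open>B\<close> of the first
    \<open>N\<close> terms less than half of \<open>e\<close> times the total weight; the summand 1
    keeps the weight positive.\<close>
  have "eventually (\<lambda>n. (\<Sum>k<n. c k) > 2 * B / e + 1) sequentially"
    using div by (simp add: filterlim_at_top_dense)
  then obtain n0 where n0: "\<And>n. n \<ge> n0 \<Longrightarrow> (\<Sum>k<n. c k) > 2 * B / e + 1"
    by (auto simp: eventually_sequentially)
  show "\<exists>no. \<forall>n\<ge>no. norm ((\<Sum>k<n. d k * c k) / (\<Sum>k<n. c k) - l) < e"
  proof (intro exI allI impI)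
    fix n assume n: "n \<ge> max n0 N"
    define S where "S = (\<Sum>k<n. c k)"
    have S: "S > 2 * B / e + 1" unfolding S_def using n0 n by auto
    moreover have "2 * B / e \<ge> 0" using B0 e by auto
    ultimately have Sp: "S > 0" by linarith
    have "\<bar>(\<Sum>k<n. d k * c k) - l * S\<bar> = \<bar>\<Sum>k<n. (d k - l) * c k\<bar>"
      unfolding S_def by (simp add: sum_distrib_left algebra_simps sum_subtractf)
    also have "\<dots> \<le> (\<Sum>k<n. \<bar>d k - l\<bar> * c k)"
      by (rule order_trans[OF sum_abs]) (auto intro!: sum_mono simp: abs_mult c0)
    also have "\<dots> = B + (\<Sum>k\<in>{N..<n}. \<bar>d k - l\<bar> * c k)"
    proof -
      have "{..<n} = {..<N} \<union> {N..<n}" using n by auto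
      then show ?thesis
        using sum.union_disjoint[of "{..<N}" "{N..<n}" "\<lambda>k. \<bar>d k - l\<bar> * c k"]
        by (simp add: B_def ivl_disj_int)
    qed
    also have "(\<Sum>k\<in>{N..<n}. \<bar>d k - l\<bar> * c k) \<le> (\<Sum>k\<in>{N..<n}. e/2 * c k)"
    proof (intro sum_mono mult_right_mono c0)
      fix k assume "k \<in> {N..<n}"
      then show "\<bar>d k - l\<bar> \<le> e/2" using N[of k] by simp
    qed
    also have "\<dots> \<le> e/2 * S"
      unfolding S_def sum_distrib_left[symmetric] using e
      by (intro mult_left_mono sum_mono2) (auto simp: c0)
    finally have "\<bar>(\<Sum>k<n. d k * c k) - l * S\<bar> \<le> B + e/2 * S" by simp
    also have "B < e/2 * S" using S e by (simp add: field_simps) 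
    finally have *: "\<bar>(\<Sum>k<n. d k * c k) - l * S\<bar> < e * S" by (simp add: field_simps)
    have "(\<Sum>k<n. d k * c k) / S - l = ((\<Sum>k<n. d k * c k) - l * S) / S"
      using Sp by (simp add: field_simps)
    then have "norm ((\<Sum>k<n. d k * c k) / S - l) = \<bar>(\<Sum>k<n. d k * c k) - l * S\<bar> / S"
      using Sp by simp
    also have "\<dots> < e" using * Sp by (simp add: field_simps)
    finally show "norm ((\<Sum>k<n. d k * c k) / (\<Sum>k<n. c k) - l) < e" unfolding S_def .
  qed
qed

text \<open>Discrete analogue of \<open>x * r'(x) / r(x) \<longlonglongrightarrow> \<rho>\<close>,
  that is, of normalised regular variation. It can be read off from one-step ratios.\<close>

definition ratio_index :: "(nat \<Rightarrow> real) \<Rightarrow> real \<Rightarrow> bool" where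
  "ratio_index r \<rho> \<longleftrightarrow> (\<forall>n\<ge>1. r n > 0) \<and> (\<lambda>n. real n * (r (Suc n) / r n - 1)) \<longlonglongrightarrow> \<rho>"

text \<open>The increments of \<open>ln (r n) - \<rho> * ln n\<close> are eventually at most \<eta>
  times the increments of \<open>ln n\<close>, and this telescopes. In logarithmic form no
  multiplicative constant is lost, and the bound is uniform as long as \<open>i / j\<close> stays in
  a compact subset of the positive reals.\<close>

lemma potter_bound:
  assumes r: "ratio_index r \<rho>" and \<eta>: "\<eta> > 0"
  obtains N where "N \<ge> 1" "\<And>i j. i \<ge> N \<Longrightarrow> j \<ge> N \<Longrightarrow>
    \<bar>ln (r i / r j) - \<rho> * ln (real i / real j)\<bar> \<le> \<eta> * \<bar>ln (real i / real j)\<bar>"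
proof -
  have pos: "r n > 0" if "n \<ge> 1" for n using r that by (auto simp: ratio_index_def)
  define x where "x n = r (Suc n) / r n - 1" for n
  have nx: "(\<lambda>n. real n * x n) \<longlonglongrightarrow> \<rho>" using r by (simp add: ratio_index_def x_def)
  have x0: "x \<longlonglongrightarrow> 0"
  proof -
    have "(\<lambda>n. (real n * x n) * (1 / real n)) \<longlonglongrightarrow> \<rho> * 0"
      by (intro tendsto_mult nx) real_asymp
    moreover have "eventually (\<lambda>n. (real n * x n) * (1 / real n) = x n) sequentially"
      using eventually_gt_at_top[of 0] by eventually_elim simp
    ultimately show ?thesis by (auto intro: Lim_transform_eventually)
  qed
  \<comment> \<open>Continuous extension of \<open>ln (1 + t) / t\<close>, so that indices with
    \<open>r (Suc n) = r n\<close> need no separate treatment.\<close>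
  define g where "g t = (if t = 0 then 1 else ln (1 + t) / t)" for t :: real
  have g: "isCont g 0"
  proof -
    have "((\<lambda>t::real. ln (1 + t) / t) \<longlongrightarrow> 1) (at 0)" by real_asymp
    then have "(g \<longlongrightarrow> g 0) (at 0)"
      by (subst tendsto_cong[where g = "\<lambda>t. ln (1 + t) / t"]) (auto simp: g_def eventually_at_filter)
    then show ?thesis by (simp add: isCont_def)
  qed
  have g1: "(\<lambda>n. g (x n)) \<longlonglongrightarrow> 1"
    using isCont_tendsto_compose[OF g x0] by (simp add: g_def)
  have ln_eq: "ln (r (Suc n) / r n) = x n * g (x n)" for n
    by (auto simp: g_def x_def)
  have nl: "(\<lambda>n. real n * ln (1 + 1 / real n)) \<longlonglongrightarrow> 1" by real_asymp
  have "(\<lambda>n. (real n * x n) * g (x n) / (real n * ln (1 + 1 / real n))) \<longlonglongrightarrow> \<rho>"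
    using tendsto_divide[OF tendsto_mult[OF nx g1] nl] by simp
  then have "eventually (\<lambda>n. \<bar>(real n * x n) * g (x n) / (real n * ln (1 + 1 / real n)) - \<rho>\<bar> < \<eta>) sequentially"
    unfolding dist_real_def[symmetric] by (rule tendstoD) (rule \<eta>)
  then obtain N0 where N0: "\<And>n. n \<ge> N0 \<Longrightarrow>
      \<bar>(real n * x n) * g (x n) / (real n * ln (1 + 1 / real n)) - \<rho>\<bar> < \<eta>"
    by (auto simp: eventually_sequentially)
  define N where "N = max N0 1"
  define Z where "Z n = ln (r n) - \<rho> * ln (real n)" for n
  have step: "\<bar>Z (Suc n) - Z n\<bar> \<le> \<eta> * (ln (real (Suc n)) - ln (real n))" if n: "n \<ge> N" for n
  proof -
    have n1: "n \<ge> 1" using n by (simp add: N_def)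
    define l where "l = ln (1 + 1 / real n)"
    have l: "l > 0" unfolding l_def using n1 by (intro ln_gt_zero) simp
    have l': "ln (real (Suc n)) - ln (real n) = l"
    proof -
      have "1 + 1 / real n = real (Suc n) / real n" using n1 by (simp add: field_simps)
      then show ?thesis using n1 by (simp add: l_def ln_div)
    qed
    have "Z (Suc n) - Z n = x n * g (x n) - \<rho> * l"
      using pos[of n] pos[of "Suc n"] n1 l' ln_eq[of n]
      by (simp add: Z_def ln_div algebra_simps)
    also have "\<dots> = ((real n * x n) * g (x n) / (real n * l) - \<rho>) * l"
      using l n1 by (simp add: field_simps)
    finally have "\<bar>Z (Suc n) - Z n\<bar> = \<bar>(real n * x n) * g (x n) / (real n * l) - \<rho>\<bar> * l"
      using l by (simp add: abs_mult)
    also have "\<dots> \<le> \<eta> * l" using N0[of n] n l by (intro mult_right_mono) (auto simp: N_def l_def)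
    finally show ?thesis using l' by simp
  qed
  have tele: "\<bar>Z j - Z i\<bar> \<le> \<eta> * (ln (real j) - ln (real i))" if "i \<ge> N" "j \<ge> i" for i j
    using that(2)
  proof (induction j rule: dec_induct)
    case (step n)
    then show ?case using \<open>\<And>n. n \<ge> N \<Longrightarrow> \<bar>Z (Suc n) - Z n\<bar> \<le> \<eta> * (ln (real (Suc n)) - ln (real n))\<close>[of n] that(1)
      by (auto simp: algebra_simps)
  qed auto
  have "\<bar>ln (r i / r j) - \<rho> * ln (real i / real j)\<bar> \<le> \<eta> * \<bar>ln (real i / real j)\<bar>"
    if ij: "i \<ge> N" "j \<ge> N" for i j
  proof -
    have p: "r i > 0" "r j > 0" "i > 0" "j > 0" using ij pos by (auto simp: N_def)
    have e: "ln (r i / r j) - \<rho> * ln (real i / real j) = Z i - Z j"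
      using p by (simp add: Z_def ln_div algebra_simps)
    have e2: "ln (real i / real j) = ln (real i) - ln (real j)" using p by (simp add: ln_div)
    show ?thesis
    proof (cases "i \<le> j")
      case True
      then have "ln (real i) \<le> ln (real j)" using p by simp
      then show ?thesis using tele[of i j] ij True unfolding e unfolding e2 by (simp add: abs_minus_commute)
    next
      case False
      then have "ln (real j) \<le> ln (real i)" using p by simp
      then show ?thesis using tele[of j i] ij False unfolding e unfolding e2 by simp
    qed
  qed
  moreover have "N \<ge> 1" by (simp add: N_def)
  ultimately show ?thesis using that by blast
qed

text \<open>Eventually \<open>ln (i / j)\<close> is at most \<open>|ln a| + 1\<close> in absolute
  value, so the error in \<open>potter_bound\<close> is arbitrarily small.\<close>

lemma ratio_index_tendsto:
  fixes i j :: "'a \<Rightarrow> nat"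
  assumes r: "ratio_index r \<rho>"
    and i: "filterlim i at_top F" and j: "filterlim j at_top F"
    and ij: "((\<lambda>n. real (i n) / real (j n)) \<longlongrightarrow> a) F" and a: "a > 0"
  shows "((\<lambda>n. r (i n) / r (j n)) \<longlongrightarrow> a powr \<rho>) F"
proof -
  have ln_ij: "((\<lambda>n. ln (real (i n) / real (j n))) \<longlongrightarrow> ln a) F"
    using a by (intro tendsto_ln ij) auto
  have "((\<lambda>n. ln (r (i n) / r (j n)) - \<rho> * ln (real (i n) / real (j n))) \<longlongrightarrow> 0) F"
  proof (rule tendstoI)
    fix e :: real assume e: "e > 0"
    define \<eta> where "\<eta> = e / (\<bar>ln a\<bar> + 1)"
    have \<eta>: "\<eta> > 0" using e by (simp add: \<eta>_def add_nonneg_pos)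
    obtain N where N: "\<And>i j. i \<ge> N \<Longrightarrow> j \<ge> N \<Longrightarrow>
        \<bar>ln (r i / r j) - \<rho> * ln (real i / real j)\<bar> \<le> \<eta> * \<bar>ln (real i / real j)\<bar>"
      using potter_bound[OF r \<eta>] by metis
    have "eventually (\<lambda>n. \<bar>ln (real (i n) / real (j n))\<bar> < \<bar>ln a\<bar> + 1) F"
      by (rule order_tendstoD(2)[OF tendsto_rabs[OF ln_ij]]) simp
    moreover have "eventually (\<lambda>n. i n \<ge> N) F" "eventually (\<lambda>n. j n \<ge> N) F"
      using i j by (auto simp: filterlim_at_top)
    ultimately show "eventually (\<lambda>n. dist (ln (r (i n) / r (j n)) - \<rho> * ln (real (i n) / real (j n))) 0 < e) F"
    proof eventually_elim
      case (elim n)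
      have "\<bar>ln (r (i n) / r (j n)) - \<rho> * ln (real (i n) / real (j n))\<bar> \<le> \<eta> * \<bar>ln (real (i n) / real (j n))\<bar>"
        using N elim by auto
      also have "\<dots> < \<eta> * (\<bar>ln a\<bar> + 1)" using elim \<eta> by (intro mult_strict_left_mono) auto
      also have "\<dots> = e" by (simp add: \<eta>_def add_nonneg_pos less_imp_neq[symmetric])
      finally show ?case by (simp add: dist_real_def)
    qed
  qed
  from tendsto_add[OF this tendsto_mult[OF tendsto_const[of \<rho>] ln_ij]]
  have "((\<lambda>n. ln (r (i n) / r (j n))) \<longlongrightarrow> \<rho> * ln a) F" by simp
  then have "((\<lambda>n. exp (ln (r (i n) / r (j n)))) \<longlongrightarrow> exp (\<rho> * ln a)) F" by (rule tendsto_exp)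
  moreover have "eventually (\<lambda>n. exp (ln (r (i n) / r (j n))) = r (i n) / r (j n)) F"
  proof -
    have "eventually (\<lambda>n. i n \<ge> 1) F" "eventually (\<lambda>n. j n \<ge> 1) F"
      using i j by (auto simp: filterlim_at_top)
    then show ?thesis
    proof eventually_elim
      case (elim n)
      then have "r (i n) > 0" "r (j n) > 0" using r by (auto simp: ratio_index_def)
      then show ?case by simp
    qed
  qed
  ultimately show ?thesis using a by (auto simp: powr_def intro: Lim_transform_eventually)
qed

section \<open>Nearest-neighbour walks killed at 0\<close>

locale nn_walk =
  fixes p :: "nat \<Rightarrow> real"
  assumes p_pos: "x \<ge> 1 \<Longrightarrow> p x > 0" and p_less_1: "x \<ge> 1 \<Longrightarrow> p x < 1"
begin

text \<open>\<open>E\<^sub>1[g(X\<^sub>k); \<tau>\<^sub>0 > k]\<close>; the first step from 0 goes to 1, hence the shift of the time index.\<close>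
definition killed_mean :: "nat \<Rightarrow> (nat \<Rightarrow> real) \<Rightarrow> real" where
  "killed_mean k g = (\<Sum>y=1..Suc k. taboo p (Suc k) y * g y)"

text \<open>The transition operator of the walk killed at 0; the value 0 at state 0 encodes the
  killing, so iterates ignore paths that have returned.\<close>

definition step :: "(nat \<Rightarrow> real) \<Rightarrow> nat \<Rightarrow> real" where
  "step g x = (if x = 0 then 0 else p x * g (Suc x) + (1 - p x) * g (x - 1))"

text \<open>Takes the place of the constant 1, because \<open>killed_mean_Suc\<close> asks for a
  function vanishing at 0.\<close>

definition alive :: "nat \<Rightarrow> real" where
  "alive x = (if x = 0 then 0 else 1)"

definition survival :: "nat \<Rightarrow> real" where
  "survival k = killed_mean k alive"

lemma taboo_nonneg: "taboo p k y \<ge> 0"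
proof (induction k arbitrary: y)
  case (Suc k)
  have "taboo p k x * trans_prob p x y \<ge> 0" for x
    using Suc.IH[of x] p_pos[of x] p_less_1[of x] 
    by (auto simp: trans_prob_def intro!: mult_nonneg_nonneg)
  then show ?case by (auto intro!: sum_nonneg)
qed auto

lemma killed_mean_0: "killed_mean 0 g = g 1"
  by (simp add: killed_mean_def trans_prob_def)

text \<open>Duality: the forward recursion for \<open>taboo\<close> becomes the backward operator
  acting on \<open>g\<close>. The condition at 0 is needed because \<open>step g 1\<close> looks at
  \<open>g 0\<close>, whereas the killed mean leaves state 0 out.\<close>

lemma killed_mean_Suc:
  assumes g: "g 0 = 0"
  shows "killed_mean (Suc k) g = killed_mean k (step g)"
proof -
  have inner: "(\<Sum>y=1..Suc (Suc k). trans_prob p x y * g y) = step g x" if x: "x \<in> {1..Suc k}" for x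
  proof -
    have "(\<Sum>y=1..Suc (Suc k). trans_prob p x y * g y) = (\<Sum>y\<in>{x - 1, Suc x} - {0}. trans_prob p x y * g y)"
      using x by (intro sum.mono_neutral_right) (auto simp: trans_prob_def)
    also have "\<dots> = (\<Sum>y\<in>{x - 1, Suc x}. trans_prob p x y * g y)"
      using g by (intro sum.mono_neutral_left) auto
    also have "\<dots> = step g x" using x by (auto simp: trans_prob_def step_def)
    finally show ?thesis .
  qed
  have "killed_mean (Suc k) g = (\<Sum>y=1..Suc (Suc k). (\<Sum>x\<le>Suc k. taboo p (Suc k) x * trans_prob p x y) * g y)"
    unfolding killed_mean_def by (intro sum.cong) auto
  also have "\<dots> = (\<Sum>y=1..Suc (Suc k). \<Sum>x\<le>Suc k. taboo p (Suc k) x * trans_prob p x y * g y)"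
    by (simp only: sum_distrib_right)
  also have "\<dots> = (\<Sum>x\<le>Suc k. \<Sum>y=1..Suc (Suc k). taboo p (Suc k) x * trans_prob p x y * g y)"
    by (rule sum.swap)
  also have "\<dots> = (\<Sum>x\<le>Suc k. taboo p (Suc k) x * (\<Sum>y=1..Suc (Suc k). trans_prob p x y * g y))"
    by (simp only: sum_distrib_left mult.assoc)
  also have "\<dots> = (\<Sum>x=1..Suc k. taboo p (Suc k) x * (\<Sum>y=1..Suc (Suc k). trans_prob p x y * g y))"
    by (intro sum.mono_neutral_right) (auto simp: not_le)
  also have "\<dots> = killed_mean k (step g)"
    unfolding killed_mean_def by (intro sum.cong refl) (simp only: inner)
  finally show ?thesis .
qed

lemma killed_mean_mono:
  assumes "\<And>x. x \<ge> 1 \<Longrightarrow> x \<le> Suc k \<Longrightarrow> f x \<le> g x"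
  shows "killed_mean k f \<le> killed_mean k g"
  unfolding killed_mean_def using assms by (intro sum_mono mult_left_mono taboo_nonneg) auto

lemma killed_mean_cong:
  assumes "\<And>x. x \<ge> 1 \<Longrightarrow> x \<le> Suc k \<Longrightarrow> f x = g x"
  shows "killed_mean k f = killed_mean k g"
  unfolding killed_mean_def using assms by (intro sum.cong) auto

lemma killed_mean_nonneg:
  assumes "\<And>x. x \<ge> 1 \<Longrightarrow> f x \<ge> 0"
  shows "killed_mean k f \<ge> 0"
  unfolding killed_mean_def using assms by (intro sum_nonneg mult_nonneg_nonneg taboo_nonneg) auto

lemma killed_mean_add: "killed_mean k (\<lambda>x. f x + g x) = killed_mean k f + killed_mean k g"
  by (simp add: killed_mean_def sum.distrib algebra_simps)

lemma killed_mean_diff: "killed_mean k (\<lambda>x. f x - g x) = killed_mean k f - killed_mean k g"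
  by (simp add: killed_mean_def sum_subtractf algebra_simps)

lemma killed_mean_cmult: "killed_mean k (\<lambda>x. c * f x) = c * killed_mean k f"
  by (simp add: killed_mean_def sum_distrib_left algebra_simps)

lemma survival_eq: "survival k = killed_mean k (\<lambda>_. 1)"
  unfolding survival_def by (intro killed_mean_cong) (auto simp: alive_def)

lemma survival_antimono: "antimono survival"
proof (rule antimonoI)
  have "survival (Suc k) \<le> survival k" for k
    unfolding survival_def
    by (subst killed_mean_Suc)
       (auto simp: alive_def step_def p_less_1 p_pos less_imp_le intro!: killed_mean_mono)
  then show "survival j \<le> survival i" if "i \<le> j" for i j
    using that by (rule lift_Suc_antimono_le)
qed

lemma survival_nonneg: "survival k \<ge> 0"
  unfolding survival_def by (intro killed_mean_nonneg) (auto simp: alive_def)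

text \<open>The shift by 2 has two sources: \<open>return_tail_prob p n\<close> refers to the path
  up to time n - 1, and \<open>survival\<close> counts time only after the forced first step from 0
  to 1.\<close>

lemma return_tail_prob_eq: "return_tail_prob p (k + 2) = survival k"
proof -
  have "(\<Sum>x\<le>Suc k. taboo p (Suc k) x) = (\<Sum>x=1..Suc k. taboo p (Suc k) x)"
    by (intro sum.mono_neutral_right) (auto simp: not_le)
  then show ?thesis
    by (simp add: return_tail_prob_def survival_eq killed_mean_def)
qed

lemma first_return_prob_eq:
  "first_return_prob p (k + 2) = (1 - p 1) * killed_mean k (\<lambda>x. if x = 1 then 1 else 0)"
proof -
  have "first_return_prob p (k + 2) = (\<Sum>x\<le>Suc k. taboo p (Suc k) x * trans_prob p x 0)"
    by (simp add: first_return_prob_def del: taboo.simps)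
  also have "\<dots> = (\<Sum>x\<in>{1}. taboo p (Suc k) x * trans_prob p x 0)"
    by (intro sum.mono_neutral_right) (auto simp: trans_prob_def simp del: taboo.simps)
  also have "\<dots> = (1 - p 1) * taboo p (Suc k) 1"
    by (simp add: trans_prob_def del: taboo.simps)
  also have "taboo p (Suc k) 1 = (\<Sum>y\<in>{1}. taboo p (Suc k) y * (if y = 1 then 1 else 0))"
    by (simp del: taboo.simps)
  also have "\<dots> = killed_mean k (\<lambda>x. if x = 1 then 1 else 0)"
    unfolding killed_mean_def by (intro sum.mono_neutral_left) auto
  finally show ?thesis .
qed

text \<open>A surviving walk can die in the next step only from state 1, with probability
  \<open>1 - p 1\<close>.\<close>

lemma survival_diff: "survival k - survival (Suc k) = first_return_prob p (k + 2)"
proof -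
  have "survival (Suc k) = killed_mean k (\<lambda>x. 1 - (1 - p 1) * (if x = 1 then 1 else 0))"
    unfolding survival_def
    by (subst killed_mean_Suc) (auto simp: alive_def step_def intro!: killed_mean_cong)
  then show ?thesis
    by (simp only: killed_mean_diff killed_mean_cmult first_return_prob_eq survival_eq)
qed

lemma taboo_parity: "odd (k + y) \<Longrightarrow> taboo p k y = 0"
proof (induction k arbitrary: y)
  case (Suc k)
  have "taboo p k x * trans_prob p x y = 0" for x
  proof (cases "odd (k + x)")
    case False
    then have "y \<noteq> Suc x" "Suc y \<noteq> x" "\<not> (x = 0 \<and> y = 1)" using Suc.prems by auto
    then show ?thesis by (auto simp: trans_prob_def)
  qed (use Suc.IH in auto)
  then show ?case by (auto intro!: sum.neutral)
qed (auto simp: odd_pos)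

lemma first_return_prob_odd: "odd k \<Longrightarrow> first_return_prob p (k + 2) = 0"
  unfolding first_return_prob_eq killed_mean_def
  by (auto intro!: sum.neutral simp: taboo_parity simp del: taboo.simps)

section \<open>Scale function, reversible measure and Green functions\<close>

abbreviation M :: "nat \<Rightarrow> real" where
  "M \<equiv> scaleM p"

lemma lam_0 [simp]: "lam p 0 = 1" by (simp add: lam_def)

lemma lam_Suc: "lam p (Suc x) = lam p x * ((1 - p (Suc x)) / p (Suc x))"
  by (simp add: lam_def)

lemma lam_pos: "lam p x > 0"
  unfolding lam_def by (intro prod_pos) (auto simp: p_pos p_less_1)

text \<open>This identity yields both the harmonicity of \<open>M\<close> and detailed balance with
  respect to \<open>conduct\<close>.\<close>

lemma lam_balance: "x \<ge> 1 \<Longrightarrow> (1 - p x) * lam p (x - 1) = p x * lam p x"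
  using p_pos[of x] by (cases x) (auto simp: lam_Suc)

lemma scaleM_0 [simp]: "M 0 = 0" by (simp add: scaleM_def)
lemma scaleM_Suc: "M (Suc x) = M x + lam p x" by (simp add: scaleM_def)
lemma scaleM_1 [simp]: "M (Suc 0) = 1" by (simp add: scaleM_Suc)

lemma scaleM_mono: "x \<le> y \<Longrightarrow> M x \<le> M y"
  unfolding scaleM_def using lam_pos by (intro sum_mono2) (auto simp: less_imp_le)

lemma scaleM_pos: "x \<ge> 1 \<Longrightarrow> M x > 0"
  using scaleM_mono[of 1 x] by simp

lemma step_diff:
  "x \<ge> 1 \<Longrightarrow> step g x - g x = p x * (g (Suc x) - g x) - (1 - p x) * (g x - g (x - 1))"
  by (simp add: step_def algebra_simps)

lemma scaleM_harmonic: "x \<ge> 1 \<Longrightarrow> step M x = M x"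
  using step_diff[of x "M"] lam_balance[of x] scaleM_Suc[of x] scaleM_Suc[of "x - 1"] by simp

text \<open>The martingale property of \<open>M\<close>, with starting value \<open>M 1 = 1\<close>.
  Hence the weights \<open>M y\<close> turn the killed law at time k into a probability law, that of
  the transformed walk Y.\<close>

lemma killed_mean_scaleM: "killed_mean k M = 1"
proof (induction k)
  case (Suc k)
  have "killed_mean (Suc k) M = killed_mean k (step M)"
    by (intro killed_mean_Suc) simp
  also have "\<dots> = killed_mean k M" by (intro killed_mean_cong scaleM_harmonic) auto
  finally show ?case using Suc by simp
qed (simp add: killed_mean_0)

text \<open>The reversible measure: \<open>p z * conduct z = 1 / lam p z\<close> is the conductance
  of the edge from z to z + 1, in agreement with the flow back from z + 1.\<close>

definition conduct :: "nat \<Rightarrow> real" where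
  "conduct z = 1 / (p z * lam p z)"

lemma conduct_pos: "z \<ge> 1 \<Longrightarrow> conduct z > 0"
  by (simp add: conduct_def p_pos lam_pos)

text \<open>When \<open>M\<close> diverges, \<open>conduct z * M (min x z)\<close> is the Green
  function of the walk killed at 0, so this is the expected time spent in \<open>{1..H}\<close> from
  x. The proof works only with the one-step identity \<open>occupation_step\<close>.\<close>

definition occupation :: "nat \<Rightarrow> nat \<Rightarrow> real" where
  "occupation H x = (\<Sum>z=1..H. conduct z * M (min x z))"

text \<open>The Green function of the walk killed at 0 and at \<open>H\<close>, summed over the target.\<close>
definition exit_time :: "nat \<Rightarrow> nat \<Rightarrow> real" where
  "exit_time H x = (\<Sum>z\<in>{1..<H}. conduct z * (M (min x z) - M x * M z / M H))"

lemma step_sum: "step (\<lambda>x. \<Sum>z\<in>A. f z x) x = (\<Sum>z\<in>A. step (f z) x)"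
  by (simp add: step_def sum_distrib_left sum.distrib)

lemma step_cmult: "step (\<lambda>x. c * f x) x = c * step f x"
  by (simp add: step_def algebra_simps)

text \<open>Each \<open>M (min x z)\<close> is harmonic in x except at the kink x = z, where one
  step lowers it by \<open>p z * lam p z\<close>; the factor \<open>conduct z\<close> normalises
  this drop to 1.\<close>

lemma occupation_step:
  assumes x: "x \<ge> 1"
  shows "step (occupation H) x = occupation H x - (if x \<le> H then 1 else 0)"
proof -
  have *: "conduct z * step (\<lambda>x. M (min x z)) x
      = conduct z * M (min x z) - (if z = x then 1 else 0)" if z: "z \<ge> 1" for z
  proof -
    have d: "step (\<lambda>x. M (min x z)) x - M (min x z) = (if z = x then - (p x * lam p x) else 0)"
    proof (rule linorder_cases[of x z])
      assume "x < z"
      moreover from this have "min (x - 1) z = x - 1" "min x z = x" "min (Suc x) z = Suc x" by auto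
      ultimately show ?thesis using step_diff[OF x, of "\<lambda>x. M (min x z)"] lam_balance[OF x] x
          scaleM_Suc[of x] scaleM_Suc[of "x - 1"] by simp
    next
      assume "x = z"
      moreover from this have "min (x - 1) z = x - 1" "min x z = x" "min (Suc x) z = x" by auto
      ultimately show ?thesis using step_diff[OF x, of "\<lambda>x. M (min x z)"] lam_balance[OF x] x
          scaleM_Suc[of "x - 1"] by simp
    next
      assume "z < x"
      then have "min (x - 1) z = z" "min x z = z" "min (Suc x) z = z" by auto
      then show ?thesis using step_diff[OF x, of "\<lambda>x. M (min x z)"] \<open>z < x\<close> by simp
    qed
    then have "step (\<lambda>x. M (min x z)) x = M (min x z) + (if z = x then - (p x * lam p x) else 0)"
      by simp
    then show ?thesis using p_pos[OF x] lam_pos[of x] by (simp add: conduct_def algebra_simps)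
  qed
  have "step (occupation H) x = (\<Sum>z=1..H. conduct z * M (min x z) - (if z = x then 1 else 0))"
    unfolding occupation_def step_sum step_cmult using * by (intro sum.cong) auto
  then show ?thesis using x by (simp add: sum_subtractf occupation_def)
qed

lemma occupation_nonneg: "occupation H x \<ge> 0"
  unfolding occupation_def
  using scaleM_mono[of 0] by (intro sum_nonneg mult_nonneg_nonneg) (auto simp: less_imp_le conduct_pos)

lemma occupation_le: "occupation H x \<le> (\<Sum>z=1..H. conduct z * M z)"
  unfolding occupation_def
  by (intro sum_mono mult_left_mono scaleM_mono) (auto simp: less_imp_le conduct_pos)

lemma exit_time_nonneg:
  assumes x: "x \<le> H"
  shows "exit_time H x \<ge> 0"
  unfolding exit_time_def
proof (intro sum_nonneg mult_nonneg_nonneg)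
  fix z assume z: "z \<in> {1..<H}"
  then show "conduct z \<ge> 0" by (simp add: less_imp_le conduct_pos)
  have "M H > 0" using z by (intro scaleM_pos) auto
  moreover have "M x * M z \<le> M (min x z) * M H"
    using x z scaleM_mono[of 0] mult_left_mono[OF scaleM_mono[of z H], of "M x"]
      mult_right_mono[OF scaleM_mono[OF x], of "M z"]
    by (cases "x \<le> z") (auto simp: min_def mult.commute)
  ultimately show "0 \<le> M (min x z) - M x * M z / M H"
    by (simp add: pos_divide_le_eq)
qed

text \<open>\<open>exit_time H\<close> differs from \<open>occupation (H - 1)\<close> by a multiple
  of the harmonic function \<open>M\<close>, chosen so that the result vanishes at H.\<close>

lemma exit_time_step:
  assumes x: "x \<ge> 1" "x < H"
  shows "step (exit_time H) x = exit_time H x - 1"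
proof -
  define c where "c = (\<Sum>z\<in>{1..<H}. conduct z * M z / M H)"
  have "{1..<H} = {1..H - 1}" using x by auto
  then have e: "exit_time H = (\<lambda>x. occupation (H - 1) x - c * M x)"
    by (simp add: fun_eq_iff exit_time_def occupation_def c_def right_diff_distrib sum_subtractf
        sum_distrib_left mult_ac)
  have "step (exit_time H) x = step (occupation (H - 1)) x - c * step M x"
    using x unfolding e by (simp add: step_def algebra_simps)
  then show ?thesis using x by (simp add: occupation_step scaleM_harmonic e)
qed

text \<open>Summation by parts. It exposes the products of \<open>lam p y\<close> with partial sums
  of \<open>conduct\<close>, which are of order y in the critical case.\<close>

lemma exit_time_1: "exit_time H 1 = (\<Sum>y\<in>{1..<H}. lam p y * (\<Sum>z=1..y. conduct z)) / M H"
proof -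
  have "(\<Sum>z\<in>{1..<H}. conduct z * (M H - M z)) = (\<Sum>y\<in>{1..<H}. lam p y * (\<Sum>z=1..y. conduct z))"
  proof (induction H)
    case (Suc H)
    show ?case
    proof (cases "H = 0")
      case False
      have "(\<Sum>z\<in>{1..<Suc H}. conduct z * (M (Suc H) - M z))
          = (\<Sum>z\<in>{1..<H}. conduct z * (M H - M z)) + lam p H * (\<Sum>z=1..H. conduct z)"
      proof -
        have "(\<Sum>z\<in>{1..<Suc H}. conduct z * (M (Suc H) - M z))
            = (\<Sum>z\<in>{1..<Suc H}. conduct z * (M H - M z) + lam p H * conduct z)"
          by (intro sum.cong) (auto simp: scaleM_Suc algebra_simps)
        also have "\<dots> = (\<Sum>z\<in>{1..<Suc H}. conduct z * (M H - M z)) + lam p H * (\<Sum>z=1..H. conduct z)"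
          unfolding sum.distrib sum_distrib_left[symmetric] atLeastLessThanSuc_atLeastAtMost ..
        finally show ?thesis using False by simp
      qed
      moreover have "(\<Sum>y\<in>{1..<Suc H}. lam p y * (\<Sum>z=1..y. conduct z))
          = (\<Sum>y\<in>{1..<H}. lam p y * (\<Sum>z=1..y. conduct z)) + lam p H * (\<Sum>z=1..H. conduct z)"
        using False by (subst sum.atLeastLessThan_Suc) auto
      ultimately show ?thesis using Suc by (simp only:)
    qed auto
  qed auto
  moreover have "exit_time H 1 = (\<Sum>z\<in>{1..<H}. conduct z * (M H - M z)) / M H"
  proof (cases "H \<ge> 1")
    case True
    then show ?thesis using scaleM_pos[of H] unfolding exit_time_def sum_divide_distrib
      by (intro sum.cong) (auto simp: min_def field_simps)
  qed (simp add: exit_time_def)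
  ultimately show ?thesis by simp
qed

section \<open>Backward iterates: exit bound, reversibility and convexity\<close>

lemma killed_mean_funpow: "g 0 = 0 \<Longrightarrow> killed_mean k g = (step ^^ k) g 1"
proof (induction k arbitrary: g)
  case (Suc k)
  have "step g 0 = 0" by (simp add: step_def)
  from Suc.IH[of "step g", OF this] show ?case using Suc.prems
    by (simp add: killed_mean_Suc funpow_swap1)
qed (simp add: killed_mean_0)

lemma step_mono:
  assumes "x \<ge> 1" "f (Suc x) \<le> g (Suc x)" "f (x - 1) \<le> g (x - 1)"
  shows "step f x \<le> step g x"
  unfolding step_def using assms p_pos[of x] p_less_1[of x]
  by (auto intro!: add_mono mult_left_mono)

lemma step_alive_bounds: "(step ^^ k) alive x \<in> {0..1}"
proof (induction k arbitrary: x)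
  case (Suc k)
  let ?f = "(step ^^ k) alive"
  show ?case
  proof (cases "x = 0")
    case False
    then have x: "x \<ge> 1" by simp
    have "step (\<lambda>_. 0) x \<le> step ?f x" "step ?f x \<le> step (\<lambda>_. 1) x"
      using Suc.IH by (intro step_mono x; simp)+
    then show ?thesis using False by (simp add: step_def[of "\<lambda>_. 0"] step_def[of "\<lambda>_. 1"])
  qed (simp add: step_def)
qed (simp add: alive_def)

text \<open>The sum of the first n survival probabilities is the mean of the return time truncated
  at n. Up to leaving \<open>{1..<H}\<close> this costs at most the mean exit time, and after
  reaching H, which has probability \<open>M x / M H\<close>, at most n. Monotonicity of
  \<open>survival\<close> then turns the sum into a bound on its smallest term.\<close>

lemma survival_le_exit:
  assumes H: "H \<ge> 1" and k: "k \<ge> 1"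
  shows "survival k \<le> 1 / M H + exit_time H 1 / real k"
proof -
  define u where "u j = (step ^^ j) alive" for j
  have MH: "M H > 0" using scaleM_pos H by simp
  have u0: "u j 0 = 0" for j unfolding u_def by (cases j) (auto simp: alive_def step_def)
  have u1: "u j x \<le> 1" for j x unfolding u_def using step_alive_bounds[of j x] by simp
  have main: "(\<Sum>j<n. u j x) \<le> real n * (M x / M H) + exit_time H x" if "x \<le> H" for n x
    using that
  proof (induction n arbitrary: x)
    case 0
    then show ?case using exit_time_nonneg by simp
  next
    case (Suc n)
    consider "x = 0" | "x = H" | "1 \<le> x" "x < H" using Suc.prems by linarith
    then show ?case
    proof cases
      case 1 then show ?thesis using u0 exit_time_nonneg[of 0 H] by simp
    next
      case 2
      have "(\<Sum>j<Suc n. u j x) \<le> (\<Sum>j<Suc n. 1)" by (intro sum_mono u1)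
      then show ?thesis using 2 MH exit_time_nonneg[of H H] by simp
    next
      case 3
      have "(\<Sum>j<Suc n. u j x) = u 0 x + (\<Sum>j<n. step (u j) x)"
        by (simp add: sum.lessThan_Suc_shift u_def del: sum.lessThan_Suc)
      also have "\<dots> \<le> 1 + step (\<lambda>x. \<Sum>j<n. u j x) x" using u1[of 0 x] by (simp add: step_sum)
      \<comment> \<open>Comparison principle: the bound for n is inserted at both neighbours, where
        it also holds at the boundary points 0 and H; \<open>exit_time\<close> then drops by 1 and
        pays for the summand \<open>u 0 x\<close>.\<close>
      also have "step (\<lambda>x. \<Sum>j<n. u j x) x \<le> step (\<lambda>x. real n / M H * M x + exit_time H x) x"
        using 3 Suc.IH[of "Suc x"] Suc.IH[of "x - 1"] by (intro step_mono) (auto simp: mult.commute)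
      \<comment> \<open>The two summands are indexed by the booleans, which makes
        \<open>step_sum\<close> applicable.\<close>
      also have "\<dots> = real n / M H * step M x + step (exit_time H) x"
        using step_sum[of "\<lambda>i x. if i then real n / M H * M x else exit_time H x" UNIV x]
        by (simp only: UNIV_bool step_cmult add.commute) (simp add: step_cmult add.commute del: times_divide_eq_left)
      also have "\<dots> = real n / M H * M x + exit_time H x - 1"
        using 3 by (simp add: scaleM_harmonic exit_time_step)
      finally have "(\<Sum>j<Suc n. u j x) \<le> real n / M H * M x + exit_time H x" by simp
      also have "\<dots> \<le> real (Suc n) * (M x / M H) + exit_time H x"
        using scaleM_pos[of x] 3 MH by (simp add: field_simps)
      finally show ?thesis .
    qed
  qed
  have su: "survival j = u j 1" for j
    unfolding survival_def u_def by (intro killed_mean_funpow) (simp add: alive_def)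
  have "real k * survival k = (\<Sum>j<k. survival k)" by simp
  also have "\<dots> \<le> (\<Sum>j<k. survival j)"
    by (intro sum_mono antimonoD[OF survival_antimono]) auto
  also have "\<dots> \<le> real k * (1 / M H) + exit_time H 1"
    using main[of 1 k] H by (simp add: su)
  finally show ?thesis using k by (simp add: field_simps)
qed

text \<open>Both sides equal a sum over edges that is symmetric in f and g, by detailed balance for
  \<open>conduct\<close>. The zeros at 0 and \<open>Suc N\<close> remove the boundary edges.\<close>

lemma step_selfadjoint:
  assumes "f 0 = 0" "g 0 = 0" "f (Suc N) = 0" "g (Suc N) = 0"
  shows "(\<Sum>y=1..N. conduct y * step f y * g y) = (\<Sum>y=1..N. conduct y * f y * step g y)"
proof -
  have sym: "(\<Sum>y=1..N. conduct y * step f y * g y) = (\<Sum>y\<le>N. (f (Suc y) * g y + f y * g (Suc y)) / lam p y)"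
    if "f 0 = 0" "g 0 = 0" "g (Suc N) = 0" for f g :: "nat \<Rightarrow> real"
  proof -
    have c: "conduct y * step f y * g y = f (Suc y) * g y / lam p y + f (y - 1) * g y / lam p (y - 1)"
      if "y \<ge> 1" for y
    proof -
      have "(1 - p y) * conduct y = 1 / lam p (y - 1)"
        using lam_balance[OF that] p_pos[OF that] lam_pos[of y] lam_pos[of "y - 1"]
        by (simp add: conduct_def divide_simps mult.commute)
      moreover have "p y * conduct y = 1 / lam p y"
        using p_pos[OF that] by (simp add: conduct_def)
      moreover have "conduct y * step f y * g y = (p y * conduct y) * f (Suc y) * g y + ((1 - p y) * conduct y) * f (y - 1) * g y"
        using that by (simp add: step_def algebra_simps)
      ultimately show ?thesis by simp
    qed
    have "(\<Sum>y=1..N. conduct y * step f y * g y)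
        = (\<Sum>y=1..N. f (Suc y) * g y / lam p y) + (\<Sum>y=1..N. f (y - 1) * g y / lam p (y - 1))"
      unfolding sum.distrib[symmetric] by (intro sum.cong) (auto simp: c)
    also have "(\<Sum>y=1..N. f (Suc y) * g y / lam p y) = (\<Sum>y\<le>N. f (Suc y) * g y / lam p y)"
      using that by (intro sum.mono_neutral_left) (auto simp: not_le)
    also have "(\<Sum>y=1..N. f (y - 1) * g y / lam p (y - 1)) = (\<Sum>y=1..Suc N. f (y - 1) * g y / lam p (y - 1))"
      using that by simp
    also have "\<dots> = (\<Sum>y\<le>N. f y * g (Suc y) / lam p y)"
      using sum.shift_bounds_cl_Suc_ivl[of "\<lambda>y. f (y - 1) * g y / lam p (y - 1)" 0 N]
      by (simp add: atMost_atLeast0)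
    finally show ?thesis by (simp add: sum.distrib add_divide_distrib)
  qed
  have "(\<Sum>y=1..N. conduct y * f y * step g y) = (\<Sum>y=1..N. conduct y * step g y * f y)"
    by (simp add: mult_ac)
  then show ?thesis using sym[of f g] sym[of g f] assms by (simp add: mult.commute add.commute)
qed

text \<open>The quadratic form of a difference of iterates of the self-adjoint step operator is
  nonnegative, so the even return probabilities form a convex sequence.\<close>
lemma first_return_prob_decreasing:
  "first_return_prob p (2 * m + 4) \<le> first_return_prob p (2 * m + 2)"
proof -
  define a where "a k = (step ^^ k) (\<lambda>x. if x = 1 then 1 else 0 :: real)" for k
  have a0: "a k 0 = 0" for k unfolding a_def by (cases k) (auto simp: step_def)
  have aSuc: "a (Suc k) = step (a k)" for k by (simp add: a_def)
  have supp: "a k x = 0" if "x > Suc k" for k x using that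
  proof (induction k arbitrary: x)
    case (Suc k) then show ?case by (simp add: aSuc step_def)
  qed (simp add: a_def)
  \<comment> \<open>Self-adjointness moves the steps from the second factor to the first one at a
    time, until the second is the indicator of 1. The bound on N keeps every support involved inside
    the range.\<close>
  have inner: "(\<Sum>y=1..N. conduct y * a i y * a j y) = conduct 1 * a (i + j) 1" if "Suc (i + j) \<le> N" for i j N
    using that
  proof (induction j arbitrary: i)
    case 0
    have "(\<Sum>y=1..N. conduct y * a i y * a 0 y) = (\<Sum>y\<in>{1}. conduct y * a i y * a 0 y)"
      using 0 by (intro sum.mono_neutral_right) (auto simp: a_def)
    then show ?case by (simp add: a_def)
  next
    case (Suc j)
    have "(\<Sum>y=1..N. conduct y * a i y * a (Suc j) y) = (\<Sum>y=1..N. conduct y * a (Suc i) y * a j y)"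
      unfolding aSuc using Suc.prems by (intro step_selfadjoint[symmetric] a0 supp) auto
    then show ?case using Suc.IH[of "Suc i"] Suc.prems by simp
  qed
  define g where "g m = a (2 * m) 1" for m
  have conv: "g (m + 1) - g (m + 2) \<le> g m - g (m + 1)" for m
  proof -
    \<comment> \<open>The largest total number of steps below is (m + 2) + (m + 2), and
      \<open>inner\<close> needs one more.\<close>
    define N where "N = 2 * m + 5"
    have "0 \<le> (\<Sum>y=1..N. conduct y * (a m y - a (m + 2) y)\<^sup>2)"
      by (intro sum_nonneg mult_nonneg_nonneg) (auto simp: less_imp_le conduct_pos)
    also have "\<dots> = (\<Sum>y=1..N. conduct y * a m y * a m y) - 2 * (\<Sum>y=1..N. conduct y * a m y * a (m + 2) y)
        + (\<Sum>y=1..N. conduct y * a (m + 2) y * a (m + 2) y)"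
      unfolding sum_distrib_left sum_subtractf[symmetric] sum.distrib[symmetric]
      by (intro sum.cong) (auto simp: power2_eq_square algebra_simps)
    also have "\<dots> = conduct 1 * (g m - 2 * g (m + 1) + g (m + 2))"
    proof -
      have *: "m + m = 2 * m" "m + (m + 2) = 2 * (m + 1)" "m + 2 + (m + 2) = 2 * (m + 2)" by auto
      have "Suc (m + m) \<le> N" "Suc (m + (m + 2)) \<le> N" "Suc (m + 2 + (m + 2)) \<le> N" by (auto simp: N_def)
      from this[THEN inner] show ?thesis unfolding * g_def[symmetric]
        by (simp only:) (simp add: algebra_simps)
    qed
    finally show ?thesis using conduct_pos[of 1] by (simp add: zero_le_mult_iff)
  qed
  have gk: "g m = killed_mean (2 * m) (\<lambda>x. if x = 1 then 1 else 0)" for m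
    by (simp add: g_def a_def killed_mean_funpow)
  have g0: "g m \<ge> 0" for m unfolding gk by (intro killed_mean_nonneg) auto
  have g1: "g m \<le> 1" for m
  proof -
    have "g m \<le> killed_mean (2 * m) M"
      unfolding gk using scaleM_mono[of 0] by (intro killed_mean_mono) auto
    then show ?thesis by (simp add: killed_mean_scaleM)
  qed
  \<comment> \<open>A convex sequence with one positive increment grows at least linearly from there
    on, contradicting \<open>g m \<le> 1\<close>.\<close>
  have "g (m + 1) \<le> g m"
  proof (rule ccontr)
    assume "\<not> g (m + 1) \<le> g m"
    then have d: "g (m + 1) - g m > 0" by simp
    have inc: "g (m + k + 1) - g (m + k) \<ge> g (m + 1) - g m" for k
    proof (induction k)
      case (Suc k) then show ?case using conv[of "m + k"] by simp
    qed auto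
    have "g (m + k) \<ge> g m + real k * (g (m + 1) - g m)" for k
    proof (induction k)
      case (Suc k) then show ?case using inc[of k] by (simp add: algebra_simps)
    qed auto
    moreover obtain k :: nat where "real k * (g (m + 1) - g m) > 1"
      using reals_Archimedean3[OF d] by blast
    ultimately show False using g0[of m] g1[of "m + k"] by (smt (verit))
  qed
  moreover have "2 * m + 4 = 2 * (m + 1) + 2" by simp
  ultimately show ?thesis
    using p_less_1[of 1] by (simp only: first_return_prob_eq gk[symmetric]) simp
qed

text \<open>The chance of being in \<open>{1..H}\<close> at time k is the drop of the mean of
  \<open>occupation H\<close> from k to k + 1, so the sum telescopes. Bounding the mean at time a by
  a maximum keeps the factor \<open>survival a\<close>, which later makes the estimate a
  recursion.\<close>

lemma window_occupation:
  "(\<Sum>k\<in>{a..<b}. killed_mean k (\<lambda>x. if x \<le> H then 1 else 0))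
     \<le> survival a * (\<Sum>z=1..H. conduct z * M z)"
proof (cases "a \<le> b")
  case True
  have st: "killed_mean k (\<lambda>x. if x \<le> H then 1 else 0) = killed_mean k (occupation H) - killed_mean (Suc k) (occupation H)" for k
  proof -
    have "killed_mean (Suc k) (occupation H) = killed_mean k (step (occupation H))"
      by (intro killed_mean_Suc) (simp add: occupation_def)
    also have "\<dots> = killed_mean k (\<lambda>x. occupation H x - (if x \<le> H then 1 else 0))"
      by (intro killed_mean_cong occupation_step) auto
    finally show ?thesis by (simp add: killed_mean_diff)
  qed
  have "(\<Sum>k\<in>{a..<b}. killed_mean k (\<lambda>x. if x \<le> H then 1 else 0)) = killed_mean a (occupation H) - killed_mean b (occupation H)"
    using True unfolding st by (induction b rule: dec_induct) auto
  also have "\<dots> \<le> killed_mean a (occupation H)"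
    using killed_mean_nonneg[of "occupation H" b] occupation_nonneg by auto
  also have "\<dots> \<le> killed_mean a (\<lambda>x. (\<Sum>z=1..H. conduct z * M z) * 1)"
    by (intro killed_mean_mono) (use occupation_le in auto)
  also have "\<dots> = survival a * (\<Sum>z=1..H. conduct z * M z)"
    by (simp only: killed_mean_cmult survival_eq) (simp only: mult.commute)
  finally show ?thesis .
next
  case False
  have "(\<Sum>z=1..H. conduct z * M z) \<ge> 0"
    by (intro sum_nonneg mult_nonneg_nonneg) (auto simp: less_imp_le conduct_pos scaleM_pos)
  then show ?thesis using False survival_nonneg[of a] by simp
qed

end

section \<open>Gaussian estimates\<close>

text \<open>Third-order Taylor expansion of \<open>exp (- u^2)\<close> at
  \<open>u = sqrt \<theta> * y\<close> with increment \<open>sqrt \<theta> * e\<close>. The third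
  derivative is bounded by 28 on the whole line, so the remainder is at most 28/6 times
  \<open>\<theta> powr (3/2)\<close>, uniformly in y.\<close>

lemma gauss_taylor:
  fixes y \<theta> e :: real
  assumes \<theta>: "\<theta> > 0" and e: "\<bar>e\<bar> = 1"
  shows "\<bar>exp (- \<theta> * (y + e)\<^sup>2) - exp (- \<theta> * y\<^sup>2) * (1 - 2 * \<theta> * y * e - \<theta> + 2 * \<theta>\<^sup>2 * y\<^sup>2)\<bar> \<le> 5 * \<theta> powr (3/2)"
proof -
  define h where "h u = exp (- u\<^sup>2)" for u :: real
  define D where "D m u = (if m = 0 then h u else if m = 1 then - 2 * u * h u
     else if m = 2 then (4 * u\<^sup>2 - 2) * h u else (12 * u - 8 * u ^ 3) * h u)" for m :: nat and u
  define u where "u = sqrt \<theta> * y"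
  define s where "s = sqrt \<theta> * e"
  have s0: "s \<noteq> 0" using \<theta> e by (auto simp: s_def)
  have der: "DERIV (D m) t :> D (Suc m) t" if "m < 3" for m t
  proof -
    consider "m = 0" | "m = 1" | "m = 2" using \<open>m < 3\<close> by linarith
    then show ?thesis
    proof cases
      case 1
      have "((\<lambda>u. h u) has_real_derivative - 2 * t * h t) (at t)" unfolding h_def
        by (auto intro!: derivative_eq_intros)
      then show ?thesis using 1 by (simp add: D_def[abs_def])
    next
      case 2
      have "((\<lambda>u. - 2 * u * h u) has_real_derivative (4 * t\<^sup>2 - 2) * h t) (at t)" unfolding h_def
        by (auto intro!: derivative_eq_intros simp: algebra_simps power2_eq_square)
      then show ?thesis using 2 by (simp add: D_def[abs_def])
    next
      case 3
      have "((\<lambda>u. (4 * u\<^sup>2 - 2) * h u) has_real_derivative (12 * t - 8 * t ^ 3) * h t) (at t)" unfolding h_def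
        by (auto intro!: derivative_eq_intros simp: algebra_simps power2_eq_square power3_eq_cube)
      then show ?thesis using 3 by (simp add: D_def[abs_def])
    qed
  qed
  have "\<exists>t. (if u + s < u then u + s < t \<and> t < u else u < t \<and> t < u + s) \<and>
      D 0 (u + s) = (\<Sum>m<3. D m u / fact m * (u + s - u) ^ m) + D 3 t / fact 3 * (u + s - u) ^ 3"
    by (rule Taylor[where a = "u - \<bar>s\<bar>" and b = "u + \<bar>s\<bar>"]) (use der s0 in auto)
  then obtain t where t: "D 0 (u + s) = (\<Sum>m<3. D m u / fact m * s ^ m) + D 3 t / fact 3 * s ^ 3"
    by auto
  have D3: "\<bar>D 3 t\<bar> \<le> 28"
  proof -
    have ex: "exp (t\<^sup>2) \<ge> 1 + t\<^sup>2 + (t\<^sup>2)\<^sup>2 / 2"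
      by (rule exp_lower_Taylor_quadratic) simp
    have a: "12 * \<bar>t\<bar> + 8 * \<bar>t\<bar> ^ 3 \<le> 28 * (1 + t\<^sup>2 + (t\<^sup>2)\<^sup>2 / 2)"
    proof -
      define v where "v = \<bar>t\<bar>"
      have "0 \<le> 28 * (1 + v\<^sup>2 + (v\<^sup>2)\<^sup>2 / 2) - (12 * v + 8 * v ^ 3)"
      proof -
        \<comment> \<open>A sum-of-squares certificate for nonnegativity.\<close>
        have "28 * (1 + v\<^sup>2 + (v\<^sup>2)\<^sup>2 / 2) - (12 * v + 8 * v ^ 3)
            = 22 + 6 * (v - 1)\<^sup>2 + 4 * v\<^sup>2 * (v - 1)\<^sup>2 + 18 * v\<^sup>2 + 10 * (v\<^sup>2)\<^sup>2"
          by (simp add: power2_eq_square power3_eq_cube algebra_simps)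
        also have "\<dots> \<ge> 0" by (intro add_nonneg_nonneg mult_nonneg_nonneg) auto
        finally show ?thesis .
      qed
      moreover have "v\<^sup>2 = t\<^sup>2" by (simp add: v_def)
      ultimately show ?thesis by (simp add: v_def)
    qed
    have "\<bar>D 3 t\<bar> = \<bar>12 * t - 8 * t ^ 3\<bar> * h t" by (simp add: D_def abs_mult h_def)
    also have "\<dots> \<le> (12 * \<bar>t\<bar> + 8 * \<bar>t\<bar> ^ 3) * h t"
      by (intro mult_right_mono order_trans[OF abs_triangle_ineq4]) (auto simp: abs_mult power_abs h_def)
    also have "\<dots> \<le> (28 * exp (t\<^sup>2)) * h t"
      using a ex by (intro mult_right_mono) (auto simp: h_def)
    also have "\<dots> = 28" by (simp add: h_def exp_minus)
    finally show ?thesis .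
  qed
  have s2: "s\<^sup>2 = \<theta>" using e \<theta> by (auto simp: s_def power_mult_distrib abs_if split: if_splits)
  have s3: "\<bar>s\<bar> ^ 3 = \<theta> powr (3/2)"
  proof -
    have "\<bar>s\<bar> = \<theta> powr (1/2)" using e \<theta> by (simp add: s_def abs_mult powr_half_sqrt)
    then show ?thesis using \<theta> by (simp add: powr_power)
  qed
  have hu: "h u = exp (- \<theta> * y\<^sup>2)" using \<theta> by (simp add: h_def u_def power_mult_distrib)
  have hus: "h (u + s) = exp (- \<theta> * (y + e)\<^sup>2)"
  proof -
    have "u + s = sqrt \<theta> * (y + e)" by (simp add: u_def s_def algebra_simps)
    then show ?thesis using \<theta> by (simp add: h_def power_mult_distrib)
  qed
  have us: "u * s = \<theta> * y * e" using \<theta> by (simp add: u_def s_def algebra_simps)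
  have u2: "u\<^sup>2 = \<theta> * y\<^sup>2" using \<theta> by (simp add: u_def power_mult_distrib)
  have "(\<Sum>m<3. D m u / fact m * s ^ m) = h u * (1 - 2 * (u * s) + (2 * u\<^sup>2 - 1) * s\<^sup>2)"
    by (simp add: D_def numeral_3_eq_3 field_simps power2_eq_square)
  also have "\<dots> = exp (- \<theta> * y\<^sup>2) * (1 - 2 * \<theta> * y * e - \<theta> + 2 * \<theta>\<^sup>2 * y\<^sup>2)"
    unfolding us u2 s2 hu by (simp add: algebra_simps power2_eq_square)
  finally have "exp (- \<theta> * (y + e)\<^sup>2) - exp (- \<theta> * y\<^sup>2) * (1 - 2 * \<theta> * y * e - \<theta> + 2 * \<theta>\<^sup>2 * y\<^sup>2)
      = D 3 t / 6 * s ^ 3"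
    using t hus by (simp add: D_def fact_numeral)
  then have "\<bar>exp (- \<theta> * (y + e)\<^sup>2) - exp (- \<theta> * y\<^sup>2) * (1 - 2 * \<theta> * y * e - \<theta> + 2 * \<theta>\<^sup>2 * y\<^sup>2)\<bar>
      = \<bar>D 3 t\<bar> / 6 * \<bar>s\<bar> ^ 3"
    by (simp only: abs_mult power_abs abs_divide abs_numeral)
  also have "\<dots> \<le> 5 * \<theta> powr (3/2)"
    unfolding s3 using D3 by (intro mult_right_mono) auto
  finally show ?thesis .
qed

lemma exp_quadratic_bound:
  fixes w :: real
  assumes "w \<ge> 0"
  shows "\<bar>exp w - 1 - w\<bar> \<le> w\<^sup>2 * exp w"
proof (cases "w = 0")
  case False
  obtain t where t: "\<bar>t\<bar> \<le> \<bar>w\<bar>" "exp w = (\<Sum>m<2. w ^ m / fact m) + exp t / fact 2 * w ^ 2"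
    using Maclaurin_exp_le[of w 2] by blast
  have "exp w - 1 - w = exp t / 2 * w\<^sup>2" using t(2) by (simp add: numeral_2_eq_2)
  also have "\<dots> \<le> exp w * w\<^sup>2"
  proof (intro mult_right_mono)
    have "exp t \<le> exp w" using t(1) assms by simp
    then show "exp t / 2 \<le> exp w" using exp_gt_zero[of t] by linarith
  qed auto
  finally have "exp w - 1 - w \<le> exp w * w\<^sup>2" .
  moreover have "exp t / 2 * w\<^sup>2 \<ge> 0" by simp
  ultimately show ?thesis using \<open>exp w - 1 - w = exp t / 2 * w\<^sup>2\<close> by (simp only: mult.commute abs_of_nonneg)
qed auto

lemma powr_neg_taylor:
  fixes a \<theta> :: real
  assumes "a \<ge> 0" "\<theta> > 0"
  shows "\<bar>(1 + 2 * \<theta>) powr (- a) - (1 - 2 * a * \<theta>)\<bar> \<le> 2 * a * (a + 1) * \<theta>\<^sup>2"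
proof -
  define D where "D m t = (if m = 0 then (1 + t) powr (- a) else if m = 1 then - a * (1 + t) powr (- a - 1)
    else a * (a + 1) * (1 + t) powr (- a - 2))" for m :: nat and t :: real
  have der: "DERIV (D m) t :> D (Suc m) t" if "m < 2" "t \<ge> 0" for m t
  proof -
    consider "m = 0" | "m = 1" using \<open>m < 2\<close> by linarith
    then show ?thesis
    proof cases
      case 1
      have "((\<lambda>t. (1 + t) powr (- a)) has_real_derivative - a * (1 + t) powr (- a - 1)) (at t)"
        using that by (auto intro!: derivative_eq_intros)
      then show ?thesis using 1 by (simp add: D_def[abs_def])
    next
      case 2
      have "((\<lambda>t. - a * (1 + t) powr (- a - 1)) has_real_derivative - a * ((- a - 1) * (1 + t) powr (- a - 1 - 1))) (at t)"
        using that by (intro DERIV_cmult) (auto intro!: derivative_eq_intros)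
      then show ?thesis using 2 by (simp add: D_def[abs_def] algebra_simps)
    qed
  qed
  have "\<exists>t. (if 2 * \<theta> < 0 then 2 * \<theta> < t \<and> t < 0 else 0 < t \<and> t < 2 * \<theta>) \<and>
      D 0 (2 * \<theta>) = (\<Sum>m<2. D m 0 / fact m * (2 * \<theta> - 0) ^ m) + D 2 t / fact 2 * (2 * \<theta> - 0) ^ 2"
    by (rule Taylor[where a = 0 and b = "2 * \<theta>"]) (use der assms in auto)
  then obtain t where t: "0 < t" "D 0 (2 * \<theta>) = (\<Sum>m<2. D m 0 / fact m * (2 * \<theta>) ^ m) + D 2 t / fact 2 * (2 * \<theta>) ^ 2"
    using assms by auto
  have "(1 + 2 * \<theta>) powr (- a) - (1 - 2 * a * \<theta>) = 2 * a * (a + 1) * \<theta>\<^sup>2 * (1 + t) powr (- a - 2)"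
    using t(2) by (simp add: D_def numeral_2_eq_2 algebra_simps)
  moreover have "(1 + t) powr (- a - 2) \<le> 1"
    using powr_mono[of "- a - 2" 0 "1 + t"] t assms by simp
  ultimately show ?thesis using assms
    by (simp add: abs_mult mult_left_le)
qed

text \<open>The first term is the time-1 Laplace transform at \<theta> of a squared Bessel process
  of dimension 2a started at \<open>y^2\<close>; the second is its expansion to first order in
  \<theta>, with \<theta> y^2 kept of order 1. Powers of \<theta> y^2 are absorbed by the
  exponential, whence an error of order \<theta>^2 uniform in y. In the constant, 12 comes from
  linearising the exponential (8) and dropping the denominator of w (4), 6a(a + 1) from the power,
  and 4a from the cross term.\<close>

lemma gauss_heat_step:
  fixes a \<theta> y :: real
  assumes a: "a \<ge> 0" and \<theta>: "0 < \<theta>" "\<theta> \<le> 1"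
  shows "\<bar>(1 + 2 * \<theta>) powr (- a) * exp (- (\<theta> / (1 + 2 * \<theta>)) * y\<^sup>2)
           - exp (- \<theta> * y\<^sup>2) * (1 - 2 * a * \<theta> + 2 * \<theta>\<^sup>2 * y\<^sup>2)\<bar> \<le> (6 * a * (a + 1) + 4 * a + 12) * \<theta>\<^sup>2"
proof -
  define E where "E = exp (- \<theta> * y\<^sup>2)"
  define E' where "E' = exp (- (\<theta> / (1 + 2 * \<theta>)) * y\<^sup>2)"
  define w where "w = 2 * \<theta>\<^sup>2 * y\<^sup>2 / (1 + 2 * \<theta>)"
  define w0 where "w0 = 2 * \<theta>\<^sup>2 * y\<^sup>2"
  define v where "v = \<theta> * y\<^sup>2"
  define v' where "v' = \<theta> / (1 + 2 * \<theta>) * y\<^sup>2"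
  define b where "b = (1 + 2 * \<theta>) powr (- a)"
  have pos: "1 + 2 * \<theta> > 0" using \<theta> by simp
  have v0: "v \<ge> 0" "v' \<ge> 0" using \<theta> by (auto simp: v_def v'_def)
  have small: "x * exp (- x) \<le> 1" "x\<^sup>2 * exp (- x) \<le> 2" if "x \<ge> 0" for x :: real
  proof -
    have "1 + x + x\<^sup>2 / 2 \<le> exp x" using exp_lower_Taylor_quadratic[OF that] .
    moreover have "x\<^sup>2 \<ge> 0" by simp
    ultimately have "x \<le> exp x" "x\<^sup>2 \<le> 2 * exp x" using that by linarith+
    then show "x * exp (- x) \<le> 1" "x\<^sup>2 * exp (- x) \<le> 2" by (auto simp: exp_minus field_simps)
  qed
  have E'E: "E' = E * exp w"
    unfolding E'_def E_def w_def exp_add[symmetric] using pos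
    by (simp add: field_simps power2_eq_square)
  have w: "w = 2 * \<theta> * v'" by (simp add: w_def v'_def power2_eq_square)
  have E'v: "E' = exp (- v')" by (simp add: E'_def v'_def)
  have Ev: "E = exp (- v)" by (simp add: E_def v_def)
  have 1: "\<bar>E' - E * (1 + w)\<bar> \<le> 8 * \<theta>\<^sup>2"
  proof -
    have "E' - E * (1 + w) = E * (exp w - 1 - w)" unfolding E'E by (simp add: algebra_simps)
    then have "\<bar>E' - E * (1 + w)\<bar> = E * \<bar>exp w - 1 - w\<bar>" by (simp add: abs_mult E_def)
    also have "\<dots> \<le> E * (w\<^sup>2 * exp w)"
      using exp_quadratic_bound[of w] v0 \<theta> by (intro mult_left_mono) (auto simp: w E_def)
    also have "\<dots> = 4 * \<theta>\<^sup>2 * (v'\<^sup>2 * exp (- v'))" unfolding E'v[symmetric] E'E by (simp add: w power_mult_distrib)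
    also have "\<dots> \<le> 4 * \<theta>\<^sup>2 * 2" using small(2)[OF v0(2)] by (intro mult_left_mono) auto
    finally show ?thesis by simp
  qed
  have 2: "\<bar>E * (1 + w) - E * (1 + w0)\<bar> \<le> 4 * \<theta>\<^sup>2"
  proof -
    have "w0 - w = 4 * \<theta>\<^sup>2 * v / (1 + 2 * \<theta>)" using pos
      by (simp add: w0_def w_def v_def field_simps power2_eq_square)
    moreover have "\<dots> \<le> 4 * \<theta>\<^sup>2 * v" using \<theta> v0 by (simp add: field_simps)
    moreover have "\<dots> \<ge> 0 \<Longrightarrow> 4 * \<theta>\<^sup>2 * v / (1 + 2 * \<theta>) \<ge> 0" using pos v0 by simp
    ultimately have "\<bar>w - w0\<bar> \<le> 4 * \<theta>\<^sup>2 * v" using v0 by auto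
    then have "E * \<bar>w - w0\<bar> \<le> E * (4 * \<theta>\<^sup>2 * v)" by (intro mult_left_mono) (auto simp: E_def)
    also have "\<dots> = 4 * \<theta>\<^sup>2 * (v * exp (- v))" by (simp add: Ev)
    also have "\<dots> \<le> 4 * \<theta>\<^sup>2 * 1" using small(1)[OF v0(1)] by (intro mult_left_mono) auto
    finally have "E * \<bar>w - w0\<bar> \<le> 4 * \<theta>\<^sup>2" by simp
    moreover have "E * (1 + w) - E * (1 + w0) = E * (w - w0)" by (simp add: algebra_simps)
    ultimately show ?thesis by (simp add: abs_mult E_def)
  qed
  have E01: "E \<le> 1" "E \<ge> 0" "E' \<le> 1" "E' \<ge> 0" using v0 by (auto simp: Ev E'v)
  have b1: "\<bar>b\<bar> \<le> 1" using powr_mono[of "- a" 0 "1 + 2 * \<theta>"] a \<theta> by (simp add: b_def)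
  have Ew0: "0 \<le> E * w0" "E * w0 \<le> 2 * \<theta>"
  proof -
    have "E * w0 = 2 * \<theta> * (v * exp (- v))" by (simp add: Ev w0_def v_def power2_eq_square)
    then show "0 \<le> E * w0" "E * w0 \<le> 2 * \<theta>" using small(1)[OF v0(1)] \<theta> v0 by auto
  qed
  have b2: "\<bar>b * E' - b * (E * (1 + w0))\<bar> \<le> 12 * \<theta>\<^sup>2"
  proof -
    have "\<bar>b * E' - b * (E * (1 + w0))\<bar> = \<bar>b\<bar> * \<bar>E' - E * (1 + w0)\<bar>" by (simp add: abs_mult[symmetric] algebra_simps)
    also have "\<dots> \<le> 1 * \<bar>E' - E * (1 + w0)\<bar>" using b1 by (intro mult_right_mono) auto
    also have "\<dots> = \<bar>(E' - E * (1 + w)) + (E * (1 + w) - E * (1 + w0))\<bar>" by simp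
    also have "\<dots> \<le> 8 * \<theta>\<^sup>2 + 4 * \<theta>\<^sup>2" by (rule order_trans[OF abs_triangle_ineq add_mono[OF 1 2]])
    also have "\<dots> = 12 * \<theta>\<^sup>2" by simp
    finally show ?thesis .
  qed
  have b3: "\<bar>(b - (1 - 2 * a * \<theta>)) * (E * (1 + w0))\<bar> \<le> 2 * a * (a + 1) * \<theta>\<^sup>2 * 3"
    unfolding abs_mult[of "b - _"]
  proof (intro mult_mono)
    show "\<bar>b - (1 - 2 * a * \<theta>)\<bar> \<le> 2 * a * (a + 1) * \<theta>\<^sup>2"
      using powr_neg_taylor[OF a \<theta>(1)] by (simp add: b_def)
    have "E * (1 + w0) = E + E * w0" by (simp add: algebra_simps)
    then show "\<bar>E * (1 + w0)\<bar> \<le> 3" using E01 Ew0 \<theta> by simp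
  qed (use a in auto)
  have b4: "\<bar>2 * a * \<theta> * (E * w0)\<bar> \<le> 4 * a * \<theta>\<^sup>2"
    using mult_left_mono[OF Ew0(2), of "2 * a * \<theta>"] Ew0(1) a \<theta> by (simp add: power2_eq_square)
  have "b * E' - E * (1 - 2 * a * \<theta> + w0) = (b * E' - b * (E * (1 + w0)))
      + (b - (1 - 2 * a * \<theta>)) * (E * (1 + w0)) - 2 * a * \<theta> * (E * w0)"
    by (simp add: algebra_simps)
  then have "\<bar>b * E' - E * (1 - 2 * a * \<theta> + w0)\<bar> \<le> 12 * \<theta>\<^sup>2 + 2 * a * (a + 1) * \<theta>\<^sup>2 * 3 + 4 * a * \<theta>\<^sup>2"
    using b2 b3 b4 by linarith
  then show ?thesis by (simp add: b_def E_def E'_def w0_def algebra_simps)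
qed

section \<open>Truncated power functions\<close>

text \<open>\<open>\<integral>\<^sub>0\<^sup>S s powr (\<kappa> - 1) * exp (- s * x) ds\<close> after substituting \<open>s = r powr (1 / \<kappa>)\<close>, which removes the
  singularity at 0 and the factor \<open>1 / \<kappa>\<close>; it increases to \<open>Gamma (\<kappa> + 1) * x powr - \<kappa>\<close>.\<close>
definition trunc_power :: "real \<Rightarrow> real \<Rightarrow> real \<Rightarrow> real" where
  "trunc_power \<kappa> R x = integral {0..R} (\<lambda>r. exp (- (r powr (1 / \<kappa>) * x)))"

lemma continuous_on_root_powr:
  fixes \<kappa> :: real assumes "\<kappa> > 0"
  shows "continuous_on {0..R} (\<lambda>r. r powr (1 / \<kappa>))"
  using assms by (intro continuous_on_powr' continuous_intros) auto

lemma trunc_power_integrable: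
  fixes \<kappa> x R :: real
  assumes "\<kappa> > 0"
  shows "(\<lambda>r. exp (- (r powr (1 / \<kappa>) * x))) integrable_on {0..R}"
  by (intro integrable_continuous_real continuous_on_exp continuous_on_minus continuous_on_mult
        continuous_on_const continuous_on_root_powr assms)

lemma trunc_power_mono:
  assumes "\<kappa> > 0" "R \<le> R'"
  shows "trunc_power \<kappa> R x \<le> trunc_power \<kappa> R' x"
  unfolding trunc_power_def using assms
  by (intro integral_subset_le trunc_power_integrable) auto

lemma trunc_power_le:
  assumes "\<kappa> > 0" "R \<ge> 0" "x \<ge> 0"
  shows "trunc_power \<kappa> R x \<le> R"
proof -
  have "trunc_power \<kappa> R x \<le> integral {0..R} (\<lambda>_. 1)"
    unfolding trunc_power_def using assms
    by (intro integral_le trunc_power_integrable) auto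
  then show ?thesis using assms by simp
qed

text \<open>Substitution \<open>r * x powr \<kappa>\<close> for r: the dependence on x moves into a
  power and the cutoff, so only x = 1 has to be studied.\<close>

lemma trunc_power_scale:
  assumes \<kappa>: "\<kappa> > 0" and R: "R \<ge> 0" and x: "x > 0"
  shows "trunc_power \<kappa> R x = x powr (- \<kappa>) * trunc_power \<kappa> (R * x powr \<kappa>) 1"
proof -
  define c where "c = x powr \<kappa>"
  have c: "c > 0" using x by (simp add: c_def)
  define f where "f r = exp (- (r powr (1 / \<kappa>) * 1))" for r :: real
  have "(f has_integral trunc_power \<kappa> (R * c) 1) {0..R * c}"
    unfolding f_def trunc_power_def using trunc_power_integrable[OF \<kappa>] by (rule integrable_integral)
  from has_integral_stretch_real[OF this, of c] c
  have "((\<lambda>r. f (c * r)) has_integral (trunc_power \<kappa> (R * c) 1 / c)) ((\<lambda>r. r / c) ` {0..R * c})"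
    by simp
  moreover have "(\<lambda>r. r / c) ` {0..R * c} = {0..R}"
  proof -
    have "(\<lambda>r. r / c) ` {0..R * c} = (\<lambda>r. r * inverse c) ` {0..R * c}" by (simp add: divide_inverse)
    then show ?thesis using c R by (simp add: image_mult_atLeastAtMost mult.commute)
  qed
  ultimately have "((\<lambda>r. f (c * r)) has_integral (trunc_power \<kappa> (R * c) 1 / c)) {0..R}" by simp
  moreover have "f (c * r) = exp (- (r powr (1 / \<kappa>) * x))" if "r \<in> {0..R}" for r
    using that x \<kappa> by (simp add: f_def c_def powr_mult powr_powr mult.commute)
  ultimately have "((\<lambda>r. exp (- (r powr (1 / \<kappa>) * x))) has_integral (trunc_power \<kappa> (R * c) 1 / c)) {0..R}"
    by (rule has_integral_eq[rotated])
  then show ?thesis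
    by (simp add: trunc_power_def integral_unique c_def powr_minus divide_inverse)
qed

text \<open>Integration by parts together with \<open>t = r powr (1 / \<kappa>)\<close>. The result
  is an incomplete Gamma integral for \<kappa> + 1, whose integrand is continuous at 0.\<close>

lemma trunc_power_1_eq:
  assumes \<kappa>: "\<kappa> > 0" and R: "R > 0"
  shows "trunc_power \<kappa> R 1 = R * exp (- (R powr (1 / \<kappa>)))
    + integral {0..R powr (1 / \<kappa>)} (\<lambda>t. t powr \<kappa> / exp t)"
proof -
  define g where "g t = t powr \<kappa> / exp t" for t :: real
  define T where "T = R powr (1 / \<kappa>)"
  define G where "G u = integral {0..u} g" for u
  have gc: "continuous_on {0..T} g" unfolding g_def using \<kappa>
    by (intro continuous_on_divide continuous_on_powr' continuous_intros) auto
  have Gd: "(G has_real_derivative g u) (at u within {0..T})" if "u \<in> {0..T}" for u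
    unfolding G_def using integral_has_real_derivative[OF gc that] .
  have Gc: "continuous_on {0..T} G"
    unfolding continuous_on_eq_continuous_within using Gd DERIV_continuous by blast
  define F where "F r = r * exp (- (r powr (1 / \<kappa>))) + G (r powr (1 / \<kappa>))" for r
  have "((\<lambda>r. exp (- (r powr (1 / \<kappa>) * 1))) has_integral (F R - F 0)) {0..R}"
  \<comment> \<open>Differentiability is asked for in the interior only, since
    \<open>r powr (1 / \<kappa>)\<close> has infinite slope at 0 when \<kappa> > 1.\<close>
  proof (rule fundamental_theorem_of_calculus_interior)
    show "continuous_on {0..R} F" unfolding F_def
    proof (intro continuous_on_add continuous_on_exp continuous_on_minus continuous_on_mult
        continuous_on_id continuous_on_root_powr \<kappa>)
      show "continuous_on {0..R} (\<lambda>r. G (r powr (1 / \<kappa>)))"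
        by (rule continuous_on_compose2[OF Gc continuous_on_root_powr[OF \<kappa>]])
           (use \<kappa> in \<open>auto simp: T_def intro!: powr_mono2\<close>)
    qed
  next
    fix r assume r: "r \<in> {0<..<R}"
    define v where "v = r powr (1 / \<kappa>)"
    have v: "v \<in> {0<..<T}" using r \<kappa> by (auto simp: v_def T_def intro!: powr_less_mono2)
    have "(G has_real_derivative g v) (at v)"
      using Gd[of v] v by (simp add: at_within_Icc_at)
    then have "(G has_real_derivative g v) (at (r powr (1 / \<kappa>)))" by (simp add: v_def)
    then have d: "((\<lambda>r. G (r powr (1 / \<kappa>))) has_real_derivative g v * (1 / \<kappa> * r powr (1 / \<kappa> - 1))) (at r)"
      using r by (intro DERIV_chain2[where f = G and g = "\<lambda>r. r powr (1 / \<kappa>)"])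
        (auto intro!: derivative_eq_intros)
    have "(F has_real_derivative (1 * exp (- v) + r * (exp (- v) * - (1 / \<kappa> * r powr (1 / \<kappa> - 1))))
        + g v * (1 / \<kappa> * r powr (1 / \<kappa> - 1))) (at r)"
      unfolding F_def using r
      by (intro DERIV_add d) (auto intro!: derivative_eq_intros simp: v_def)
    moreover have "g v = r * exp (- v)"
      using r \<kappa> by (simp add: g_def v_def powr_powr exp_minus divide_inverse)
    ultimately have "(F has_real_derivative exp (- v)) (at r)" by (simp add: algebra_simps)
    then show "(F has_vector_derivative exp (- (r powr (1 / \<kappa>) * 1))) (at r)"
      by (simp add: has_real_derivative_iff_has_vector_derivative v_def)
  qed (use R in simp)
  then have "trunc_power \<kappa> R 1 = F R - F 0" unfolding trunc_power_def by (rule integral_unique)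
  then show ?thesis by (simp add: F_def G_def g_def[abs_def])
qed

lemma incomplete_Gamma_tendsto:
  fixes \<kappa> :: real assumes \<kappa>: "\<kappa> > 0"
  shows "(\<lambda>n. integral {0..real n} (\<lambda>t. t powr \<kappa> / exp t)) \<longlonglongrightarrow> Gamma (\<kappa> + 1)"
proof -
  define g where "g t = t powr \<kappa> / exp t" for t :: real
  have g: "(g has_integral Gamma (\<kappa> + 1)) {0..}"
    using Gamma_integral_real[of "\<kappa> + 1"] \<kappa> by (simp add: g_def[abs_def])
  define f where "f n t = (if t \<in> {0..real n} then g t else 0)" for n t
  have eq: "(f n has_integral (integral {0..real n} g)) {0..}" for n
  proof -
    have "g integrable_on {0..real n}"
      by (rule integrable_on_subinterval[of _ "{0..}"]) (use g in auto)
    then have "(g has_integral (integral {0..real n} g)) {0..real n}" by (rule integrable_integral)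
    then show ?thesis unfolding f_def by (subst has_integral_restrict) auto
  qed
  have "(\<lambda>n. integral {0..} (f n)) \<longlonglongrightarrow> integral {0..} g"
  proof (rule dominated_convergence(2))
    show "f n integrable_on {0..}" for n using eq by blast
    show "g integrable_on {0..}" using g by blast
    show "norm (f n t) \<le> g t" for n t by (auto simp: f_def g_def)
    fix t :: real assume t: "t \<in> {0..}"
    have "eventually (\<lambda>n. f n t = g t) sequentially"
      using eventually_ge_at_top[of "nat \<lceil>t\<rceil>"]
    proof eventually_elim
      case (elim n)
      then show ?case using t by (simp add: f_def)
    qed
    then show "(\<lambda>n. f n t) \<longlonglongrightarrow> g t" by (rule tendsto_eventually)
  qed
  then show ?thesis unfolding integral_unique[OF eq] integral_unique[OF g] by (simp add: g_def[abs_def])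
qed

lemma trunc_power_tendsto:
  assumes \<kappa>: "\<kappa> > 0"
  shows "(\<lambda>n. trunc_power \<kappa> (real n powr \<kappa>) 1) \<longlonglongrightarrow> Gamma (\<kappa> + 1)"
proof -
  have "(\<lambda>n. real n powr \<kappa> * exp (- real n)) \<longlonglongrightarrow> 0" by real_asymp
  from tendsto_add[OF this incomplete_Gamma_tendsto[OF \<kappa>]]
  have "(\<lambda>n. real n powr \<kappa> * exp (- real n) + integral {0..real n} (\<lambda>t. t powr \<kappa> / exp t)) \<longlonglongrightarrow> Gamma (\<kappa> + 1)" by simp
  moreover have "eventually (\<lambda>n. real n powr \<kappa> * exp (- real n) + integral {0..real n} (\<lambda>t. t powr \<kappa> / exp t)
      = trunc_power \<kappa> (real n powr \<kappa>) 1) sequentially"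
    using eventually_gt_at_top[of 0]
    by eventually_elim (use \<kappa> in \<open>simp add: trunc_power_1_eq powr_powr\<close>)
  ultimately show ?thesis by (rule Lim_transform_eventually)
qed

lemma trunc_power_1_le:
  assumes \<kappa>: "\<kappa> > 0"
  shows "trunc_power \<kappa> R 1 \<le> Gamma (\<kappa> + 1)"
proof -
  have "filterlim (\<lambda>n. real n powr \<kappa>) at_top sequentially" using \<kappa> by real_asymp
  then have "eventually (\<lambda>n. R \<le> real n powr \<kappa>) sequentially" by (simp add: filterlim_at_top)
  then have "eventually (\<lambda>n. trunc_power \<kappa> R 1 \<le> trunc_power \<kappa> (real n powr \<kappa>) 1) sequentially"
    by eventually_elim (intro trunc_power_mono \<kappa>)
  then show ?thesis by (intro tendsto_lowerbound[OF trunc_power_tendsto[OF \<kappa>]]) auto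
qed

lemma trunc_power_upper:
  assumes "\<kappa> > 0" "R \<ge> 0" "x > 0"
  shows "trunc_power \<kappa> R x \<le> Gamma (\<kappa> + 1) * x powr (- \<kappa>)"
  using mult_left_mono[OF trunc_power_1_le[OF assms(1), of "R * x powr \<kappa>"], of "x powr (- \<kappa>)"]
  by (simp add: trunc_power_scale[OF assms] mult.commute)

text \<open>One cutoff serves all x \<ge> h, because after rescaling the effective cutoff is
  \<open>R * x powr \<kappa>\<close>, at least \<open>R * h powr \<kappa>\<close>. The error at x =
  1 is taken as \<open>e * h powr \<kappa>\<close> to offset the factor
  \<open>x powr - \<kappa>\<close>.\<close>

lemma trunc_power_lower:
  assumes \<kappa>: "\<kappa> > 0" and h: "h > 0" and e: "e > 0"
  obtains R0 where "R0 \<ge> 0"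
    "\<And>R x. R \<ge> R0 \<Longrightarrow> x \<ge> h \<Longrightarrow> Gamma (\<kappa> + 1) * x powr (- \<kappa>) \<le> trunc_power \<kappa> R x + e"
proof -
  define e' where "e' = e * h powr \<kappa>"
  have e': "e' > 0" using e h by (simp add: e'_def)
  from order_tendstoD(1)[OF trunc_power_tendsto[OF \<kappa>], of "Gamma (\<kappa> + 1) - e'"] e'
  obtain N where N: "trunc_power \<kappa> (real N powr \<kappa>) 1 > Gamma (\<kappa> + 1) - e'"
    by (auto simp: eventually_sequentially)
  define R0 where "R0 = real N powr \<kappa> / h powr \<kappa>"
  have R0: "R0 \<ge> 0" by (simp add: R0_def)
  have "Gamma (\<kappa> + 1) * x powr (- \<kappa>) \<le> trunc_power \<kappa> R x + e" if R: "R \<ge> R0" and x: "x \<ge> h" for R x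
  proof -
    have "real N powr \<kappa> = R0 * h powr \<kappa>" using h by (simp add: R0_def)
    also have "\<dots> \<le> R * x powr \<kappa>" using R x h R0 \<kappa> by (intro mult_mono powr_mono2) auto
    finally have "trunc_power \<kappa> (real N powr \<kappa>) 1 \<le> trunc_power \<kappa> (R * x powr \<kappa>) 1"
      by (intro trunc_power_mono \<kappa>)
    then have "Gamma (\<kappa> + 1) \<le> trunc_power \<kappa> (R * x powr \<kappa>) 1 + e'" using N by linarith
    then have "x powr (- \<kappa>) * Gamma (\<kappa> + 1) \<le> x powr (- \<kappa>) * (trunc_power \<kappa> (R * x powr \<kappa>) 1 + e')"
      by (intro mult_left_mono) auto
    also have "\<dots> = trunc_power \<kappa> R x + x powr (- \<kappa>) * e'"
      using trunc_power_scale[OF \<kappa>, of R x] R R0 x h by (simp add: algebra_simps)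
    also have "x powr (- \<kappa>) * e' \<le> h powr (- \<kappa>) * e'"
      using x h \<kappa> e' by (intro mult_right_mono powr_mono2') auto
    also have "\<dots> = e" using h by (simp add: e'_def powr_minus)
    finally show ?thesis by (simp add: mult.commute)
  qed
  then show ?thesis using that R0 by blast
qed

text \<open>The limiting Laplace transform has the explicit antiderivative
  \<open>r * (1 + 2 * r powr (1 / \<kappa>)) powr - \<kappa>\<close> in the variable of
  \<open>trunc_power\<close>. Its limit at infinity, \<open>2 powr - \<kappa>\<close>, is the
  numerator of the tail constant.\<close>

lemma integral_power_mean:
  fixes \<kappa> :: real
  assumes \<kappa>: "\<kappa> > 0" and R: "R > 0"
  shows "integral {0..R} (\<lambda>r. (1 + 2 * r powr (1 / \<kappa>)) powr (- (\<kappa> + 1))) = R * (1 + 2 * R powr (1 / \<kappa>)) powr (- \<kappa>)"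
proof -
  define F where "F r = r * (1 + 2 * r powr (1 / \<kappa>)) powr (- \<kappa>)" for r
  have "((\<lambda>r. (1 + 2 * r powr (1 / \<kappa>)) powr (- (\<kappa> + 1))) has_integral (F R - F 0)) {0..R}"
  proof (rule fundamental_theorem_of_calculus_interior)
    show "continuous_on {0..R} F" unfolding F_def
      by (intro continuous_intros continuous_on_root_powr \<kappa> continuous_on_powr)
         (auto intro!: pos_add_strict add_pos_nonneg simp: less_imp_neq[symmetric] add_pos_nonneg)
  next
    fix r assume r: "r \<in> {0<..<R}"
    define v where "v = r powr (1 / \<kappa>)"
    have v: "v > 0" using r by (simp add: v_def)
    have dv: "((\<lambda>r. r powr (1 / \<kappa>)) has_real_derivative v / (\<kappa> * r)) (at r)"
      using r \<kappa> by (auto intro!: derivative_eq_intros simp: v_def powr_diff)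
    have "((\<lambda>r. (1 + 2 * r powr (1 / \<kappa>)) powr (- \<kappa>)) has_real_derivative
        (- \<kappa> * (1 + 2 * v) powr (- \<kappa> - 1)) * (2 * (v / (\<kappa> * r)))) (at r)"
      using v r \<kappa> by (auto intro!: derivative_eq_intros dv simp: v_def[symmetric] powr_diff)
    then have "(F has_real_derivative 1 * (1 + 2 * v) powr (- \<kappa>)
        + (- \<kappa> * (1 + 2 * v) powr (- \<kappa> - 1)) * (2 * (v / (\<kappa> * r))) * r) (at r)"
      unfolding F_def v_def by (rule DERIV_mult[OF DERIV_ident])
    also have "1 * (1 + 2 * v) powr (- \<kappa>) + (- \<kappa> * (1 + 2 * v) powr (- \<kappa> - 1)) * (2 * (v / (\<kappa> * r))) * r
        = (1 + 2 * v) powr (- \<kappa> - 1) * ((1 + 2 * v) - 2 * v)"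
    proof -
      have "(1 + 2 * v) powr (- \<kappa>) = (1 + 2 * v) powr (- \<kappa> - 1) * (1 + 2 * v)"
        using v powr_add[of "1 + 2 * v" "- \<kappa> - 1" 1] by simp
      then show ?thesis using r \<kappa> by (simp add: field_simps)
    qed
    finally have "(F has_real_derivative (1 + 2 * v) powr (- (\<kappa> + 1))) (at r)" by simp
    then show "(F has_vector_derivative (1 + 2 * r powr (1 / \<kappa>)) powr (- (\<kappa> + 1))) (at r)"
      by (simp add: has_real_derivative_iff_has_vector_derivative v_def)
  qed (use R in simp)
  then show ?thesis by (simp add: integral_unique F_def)
qed

section \<open>Bessel-like walks and their scale transform\<close>

locale bessel_walk = nn_walk p for p +
  fixes \<delta> :: real
  assumes R_small: "(\<lambda>x. real x * Rterm \<delta> p x) \<longlonglongrightarrow> 0"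
begin

lemma drift_tendsto: "(\<lambda>x. real x * (2 * p x - 1)) \<longlonglongrightarrow> - (\<delta> / 2)"
proof -
  have "(\<lambda>x. (real x * Rterm \<delta> p x - \<delta>) / 2) \<longlonglongrightarrow> (0 - \<delta>) / 2"
    by (intro tendsto_intros R_small) simp
  moreover have "eventually (\<lambda>x. (real x * Rterm \<delta> p x - \<delta>) / 2 = real x * (2 * p x - 1)) sequentially"
    using eventually_gt_at_top[of 0] by eventually_elim (simp add: Rterm_def field_simps)
  ultimately show ?thesis by (auto intro: Lim_transform_eventually)
qed

lemma p_tendsto: "p \<longlonglongrightarrow> 1 / 2"
proof -
  have "(\<lambda>x. real x * (2 * p x - 1) * (1 / real x)) \<longlonglongrightarrow> - (\<delta> / 2) * 0"
    by (intro tendsto_mult drift_tendsto) real_asymp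
  moreover have "eventually (\<lambda>x. real x * (2 * p x - 1) * (1 / real x) = 2 * p x - 1) sequentially"
    using eventually_gt_at_top[of 0] by eventually_elim simp
  ultimately have "(\<lambda>x. 2 * p x - 1) \<longlonglongrightarrow> 0" by (auto intro: Lim_transform_eventually)
  then have "(\<lambda>x. ((2 * p x - 1) + 1) / 2) \<longlonglongrightarrow> (0 + 1) / 2" by (intro tendsto_intros) auto
  then show ?thesis by simp
qed

lemma lam_ratio_index: "ratio_index (lam p) \<delta>"
  unfolding ratio_index_def
proof (intro conjI allI impI lam_pos)
  have "(\<lambda>n. (- (real (Suc n) * (2 * p (Suc n) - 1)) + (2 * p (Suc n) - 1)) / p (Suc n))
      \<longlonglongrightarrow> (- (- (\<delta> / 2)) + (2 * (1 / 2) - 1)) / (1 / 2)"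
    by (intro tendsto_intros LIMSEQ_Suc[OF p_tendsto] LIMSEQ_Suc[OF drift_tendsto]) simp
  moreover have "(- (real (Suc n) * (2 * p (Suc n) - 1)) + (2 * p (Suc n) - 1)) / p (Suc n)
      = real n * (lam p (Suc n) / lam p n - 1)" for n
    using lam_pos[of n] p_pos[of "Suc n"] by (simp add: lam_Suc field_simps)
  ultimately show "(\<lambda>n. real n * (lam p (Suc n) / lam p n - 1)) \<longlonglongrightarrow> \<delta>" by simp
qed

lemma lam_ratio_tendsto: "(\<lambda>n. lam p (Suc n) / lam p n) \<longlonglongrightarrow> 1"
proof -
  have "(\<lambda>n. (1 - p (Suc n)) / p (Suc n)) \<longlonglongrightarrow> (1 - 1 / 2) / (1 / 2)"
    by (intro tendsto_intros LIMSEQ_Suc[OF p_tendsto]) simp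
  moreover have "(1 - p (Suc n)) / p (Suc n) = lam p (Suc n) / lam p n" for n
    using lam_pos[of n] by (simp add: lam_Suc)
  ultimately show ?thesis by simp
qed

text \<open>Stolz-Cesaro input for comparing \<open>n * lam p n\<close> with \<open>M n\<close>. It
  also shows that \<open>n * lam p n\<close> eventually increases when \<delta> > -1.\<close>

lemma lam_increment:
  "(\<lambda>n. (real (Suc n) * lam p (Suc n) - real n * lam p n) / lam p n) \<longlonglongrightarrow> \<delta> + 1"
proof -
  have "(\<lambda>n. real n * (lam p (Suc n) / lam p n - 1) + lam p (Suc n) / lam p n) \<longlonglongrightarrow> \<delta> + 1"
    using lam_ratio_index by (intro tendsto_add lam_ratio_tendsto) (simp add: ratio_index_def)
  moreover have "real n * (lam p (Suc n) / lam p n - 1) + lam p (Suc n) / lam p n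
      = (real (Suc n) * lam p (Suc n) - real n * lam p n) / lam p n" for n
    using lam_pos[of n] by (simp add: field_simps)
  ultimately show ?thesis by simp
qed

text \<open>Since \<open>n * lam p n\<close> is eventually increasing, \<open>lam p n\<close> is at
  least a multiple of \<open>1 / n\<close>, and the harmonic series diverges.\<close>

lemma scaleM_diverges:
  assumes "\<delta> > -1"
  shows "filterlim M at_top sequentially"
proof -
  have "eventually (\<lambda>n. (real (Suc n) * lam p (Suc n) - real n * lam p n) / lam p n > 0) sequentially"
    by (rule order_tendstoD(1)[OF lam_increment]) (use assms in simp)
  then obtain N0 where N0: "\<And>n. n \<ge> N0 \<Longrightarrow> (real (Suc n) * lam p (Suc n) - real n * lam p n) / lam p n > 0"
    by (auto simp: eventually_sequentially)
  define N where "N = max N0 1"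
  define c where "c = real N * lam p N"
  have c: "c > 0" using lam_pos[of N] by (simp add: c_def N_def)
  have ge: "real n * lam p n \<ge> c" if "n \<ge> N" for n
    using that
  proof (induction n rule: dec_induct)
    case (step n)
    then have "(real (Suc n) * lam p (Suc n) - real n * lam p n) / lam p n > 0"
      by (intro N0) (simp add: N_def)
    then have "real (Suc n) * lam p (Suc n) > real n * lam p n"
      using lam_pos[of n] by (simp add: zero_less_divide_iff)
    then show ?case using step by linarith
  qed (simp add: c_def)
  have "M (Suc n) \<ge> c * (harm n - harm N)" if "n \<ge> N" for n
    using that
  proof (induction n rule: dec_induct)
    case base
    then show ?case using scaleM_pos[of "Suc N"] by simp
  next
    case (step n)
    have "lam p (Suc n) \<ge> c / real (Suc n)"
      using ge[of "Suc n"] step by (simp add: field_simps)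
    then show ?case using step
      by (simp add: scaleM_Suc[of "Suc n"] harm_Suc algebra_simps divide_inverse)
  qed
  then have ev: "eventually (\<lambda>n. c * (harm n - harm N) \<le> M (Suc n)) sequentially"
    by (auto simp: eventually_sequentially)
  have "filterlim (\<lambda>n. harm n - harm N :: real) at_top sequentially"
    using filterlim_tendsto_add_at_top[OF tendsto_const harm_at_top, of "- harm N"] by simp
  then have "filterlim (\<lambda>n. c * (harm n - harm N)) at_top sequentially"
    using c by (intro filterlim_tendsto_pos_mult_at_top[OF tendsto_const]) auto
  from filterlim_at_top_mono[OF this ev] show ?thesis
    by (simp add: filterlim_sequentially_Suc)
qed

end

text \<open>Divergence of \<open>M\<close> is assumed here so that both parts of the theorem share
  one development: it is supplied by \<open>scaleM_diverges\<close> for \<delta> > -1 and by the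
  recurrence hypothesis for \<delta> = -1.\<close>

locale recurrent_bessel_walk = bessel_walk +
  assumes \<delta>_ge: "\<delta> \<ge> -1"
    and diverges: "filterlim M at_top sequentially"
begin

abbreviation \<kappa> :: real where "\<kappa> \<equiv> kappa \<delta>"

lemma \<kappa>_nonneg: "\<kappa> \<ge> 0" using \<delta>_ge by (simp add: kappa_def)

text \<open>Numerator and denominator are sums of increments whose quotient is handled by
  \<open>lam_increment\<close>, so this is a weighted mean. Only divergence of \<open>M\<close>
  matters, which covers \<kappa> = 0 with limit 0.\<close>

lemma scale_quotient: "(\<lambda>n. real n * lam p n / M n) \<longlonglongrightarrow> 2 * \<kappa>"
proof -
  have "(\<lambda>n. (\<Sum>k<n. (real (Suc k) * lam p (Suc k) - real k * lam p k) / lam p k * lam p k) / (\<Sum>k<n. lam p k)) \<longlonglongrightarrow> \<delta> + 1"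
    by (rule weighted_mean_tendsto[OF _ _ lam_increment])
       (use diverges lam_pos in \<open>auto simp: less_imp_le scaleM_def[abs_def]\<close>)
  moreover have "(\<Sum>k<n. (real (Suc k) * lam p (Suc k) - real k * lam p k) / lam p k * lam p k) = real n * lam p n" for n
  proof -
    have "(\<Sum>k<n. (real (Suc k) * lam p (Suc k) - real k * lam p k) / lam p k * lam p k)
        = (\<Sum>k<n. real (Suc k) * lam p (Suc k) - real k * lam p k)"
      using lam_pos by (intro sum.cong) (auto simp: less_imp_neq[symmetric])
    also have "\<dots> = real n * lam p n - real 0 * lam p 0" by (rule sum_lessThan_telescope)
    finally show ?thesis by simp
  qed
  moreover have "\<delta> + 1 = 2 * \<kappa>" by (simp add: kappa_def)
  ultimately show ?thesis by (simp only: scaleM_def)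
qed

lemma scaleM_ratio_index: "ratio_index M (2 * \<kappa>)"
  unfolding ratio_index_def
proof (intro conjI allI impI scaleM_pos)
  have "eventually (\<lambda>n. real n * lam p n / M n = real n * (M (Suc n) / M n - 1)) sequentially"
    using eventually_ge_at_top[of 1]
    by eventually_elim (use scaleM_pos in \<open>force simp: scaleM_Suc field_simps\<close>)
  with scale_quotient show "(\<lambda>n. real n * (M (Suc n) / M n - 1)) \<longlonglongrightarrow> 2 * \<kappa>"
    by (auto intro: Lim_transform_eventually)
qed

text \<open>In \<open>survival_le_exit\<close>, first H is taken large to make
  \<open>1 / M H\<close> small, then the time large compared with the exit time.\<close>

lemma survival_tendsto_0: "survival \<longlonglongrightarrow> 0"
proof (rule LIMSEQ_I)
  fix e :: real assume e: "e > 0"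
  have "eventually (\<lambda>H. H \<ge> 1 \<and> M H > 2 / e) sequentially"
    using diverges by (intro eventually_conj eventually_ge_at_top) (simp add: filterlim_at_top_dense)
  then obtain H where H: "H \<ge> 1" "M H > 2 / e" by (auto simp: eventually_sequentially)
  have MH: "1 / M H < e / 2" using H(2) e scaleM_pos[OF H(1)] by (simp add: field_simps)
  have "(\<lambda>k. exit_time H 1 / real k) \<longlonglongrightarrow> 0" by (rule lim_const_over_n)
  then have "eventually (\<lambda>k. exit_time H 1 / real k < e / 2) sequentially"
    by (rule order_tendstoD(2)) (use e in simp)
  then have "eventually (\<lambda>k. survival k < e) sequentially"
    using eventually_ge_at_top[of 1]
  proof eventually_elim
    case (elim k)
    then show ?case using survival_le_exit[OF H(1) elim(2)] MH by linarith
  qed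
  then show "\<exists>no. \<forall>n\<ge>no. norm (survival n - 0) < e"
    using survival_nonneg by (auto simp: eventually_sequentially)
qed

text \<open>Weighting the killed walk with its harmonic function \<open>scaleM\<close> gives a Markov chain whose drift at
  \<open>y\<close> is \<open>(\<kappa> + 1/2) / y\<close> up to the error \<open>drift_error y / y\<close>, like a Bessel process of dimension \<open>2 * \<kappa> + 2\<close>.\<close>
definition drift_error :: "nat \<Rightarrow> real" where
  "drift_error y = real y * (p y * M (Suc y) - (1 - p y) * M (y - 1)) / M y - (\<kappa> + 1 / 2)"

lemma drift_error_tendsto: "drift_error \<longlonglongrightarrow> 0"
proof -
  have "(\<lambda>y. real y * (2 * p y - 1) + 2 * p y * (real y * lam p y / M y) - (\<kappa> + 1 / 2))
     \<longlonglongrightarrow> - (\<delta> / 2) + 2 * (1 / 2) * (2 * \<kappa>) - (\<kappa> + 1 / 2)"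
    by (intro tendsto_intros drift_tendsto p_tendsto scale_quotient)
  moreover have "eventually (\<lambda>y. real y * (2 * p y - 1) + 2 * p y * (real y * lam p y / M y) - (\<kappa> + 1 / 2)
      = drift_error y) sequentially"
    using eventually_ge_at_top[of 1]
  proof eventually_elim
    case (elim y)
    have M: "M y > 0" using scaleM_pos elim by simp
    have "M y = M (y - 1) + lam p (y - 1)" using scaleM_Suc[of "y - 1"] elim by simp
    then have *: "p y * M (Suc y) - (1 - p y) * M (y - 1) = (2 * p y - 1) * M y + 2 * p y * lam p y"
      using lam_balance[of y] elim by (simp add: scaleM_Suc algebra_simps)
    show ?case unfolding drift_error_def * using M by (simp add: field_simps)
  qed
  ultimately have "drift_error \<longlonglongrightarrow> - (\<delta> / 2) + 2 * (1 / 2) * (2 * \<kappa>) - (\<kappa> + 1 / 2)"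
    by (auto intro: Lim_transform_eventually)
  then show ?thesis by (simp add: kappa_def field_simps)
qed

section \<open>Laplace transform of the transformed walk\<close>

definition laplace :: "nat \<Rightarrow> real \<Rightarrow> real" where
  "laplace k \<theta> = killed_mean k (\<lambda>y. M y * exp (- \<theta> * (real y)\<^sup>2))"

definition mean_error :: "nat \<Rightarrow> real" where
  "mean_error k = killed_mean k (\<lambda>y. M y * \<bar>drift_error y\<bar>)"

text \<open>The 5 comes from \<open>gauss_taylor\<close>, the bracket from
  \<open>gauss_heat_step\<close> with \<open>a = \<kappa> + 1\<close>.\<close>

definition err_const :: real where
  "err_const = 5 + (6 * (\<kappa> + 1) * (\<kappa> + 1 + 1) + 4 * (\<kappa> + 1) + 12)"

lemma err_const_pos: "err_const > 0"
  using \<kappa>_nonneg by (simp add: err_const_def add_pos_nonneg)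

text \<open>\<open>P\<close> and \<open>Q\<close> are the up and down probabilities of Y at y; they
  sum to 1 because \<open>M\<close> is harmonic, and \<open>y * (P - Q)\<close> is \<kappa> + 1/2 up
  to \<open>drift_error y\<close>. In the Taylor expansion the linear terms combine to
  \<open>-\<theta> - 2\<theta>(\<kappa> + 1/2) = -2(\<kappa> + 1)\<theta>\<close>, exactly what
  \<open>gauss_heat_step\<close> produces for \<open>a = \<kappa> + 1\<close>.\<close>

lemma laplace_step:
  assumes y: "y \<ge> 1" and \<theta>: "0 < \<theta>" "\<theta> \<le> 1"
  shows "\<bar>step (\<lambda>y. M y * exp (- \<theta> * (real y)\<^sup>2)) y
     - (1 + 2 * \<theta>) powr (- (\<kappa> + 1)) * (M y * exp (- (\<theta> / (1 + 2 * \<theta>)) * (real y)\<^sup>2))\<bar>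
     \<le> M y * (2 * \<theta> * \<bar>drift_error y\<bar> + err_const * \<theta> powr (3 / 2))"
proof -
  define m where "m = M y"
  have m: "m > 0" using scaleM_pos y by (simp add: m_def)
  define P where "P = p y * M (Suc y) / m"
  define Q where "Q = (1 - p y) * M (y - 1) / m"
  have PQ: "P \<ge> 0" "Q \<ge> 0"
    using m p_pos[OF y] p_less_1[OF y] scaleM_mono[of 0] by (auto simp: P_def Q_def less_imp_le)
  have "P + Q = step M y / m" using y by (simp add: P_def Q_def step_def add_divide_distrib)
  then have PQ1: "P + Q = 1" using scaleM_harmonic[OF y] m by (simp add: m_def)
  have D: "real y * (P - Q) = drift_error y + (\<kappa> + 1 / 2)"
    by (simp add: drift_error_def P_def Q_def m_def diff_divide_distrib[symmetric])
  define E where "E = exp (- \<theta> * (real y)\<^sup>2)"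
  define A where "A e = exp (- \<theta> * (real y + e)\<^sup>2)" for e
  define T where "T = \<theta> powr (3/2)"
  have A: "\<bar>A e - E * (1 - 2 * \<theta> * real y * e - \<theta> + 2 * \<theta>\<^sup>2 * (real y)\<^sup>2)\<bar> \<le> 5 * T" if "\<bar>e\<bar> = 1" for e
    unfolding A_def E_def T_def by (rule gauss_taylor) (use \<theta> that in auto)
  have st: "step (\<lambda>y. M y * exp (- \<theta> * (real y)\<^sup>2)) y = m * (P * A 1 + Q * A (- 1))"
    using y m by (simp add: step_def P_def Q_def A_def of_nat_diff field_simps)
  have T: "\<theta>\<^sup>2 \<le> T"
    using powr_mono'[of "3/2" 2 \<theta>] \<theta> by (simp add: T_def)
  define W where "W = (1 + 2 * \<theta>) powr (- (\<kappa> + 1)) * exp (- (\<theta> / (1 + 2 * \<theta>)) * (real y)\<^sup>2)"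
  define C where "C = 6 * (\<kappa> + 1) * (\<kappa> + 1 + 1) + 4 * (\<kappa> + 1) + 12"
  have C: "C \<ge> 0" using \<kappa>_nonneg by (simp add: C_def)
  have W: "\<bar>W - E * (1 - 2 * (\<kappa> + 1) * \<theta> + 2 * \<theta>\<^sup>2 * (real y)\<^sup>2)\<bar> \<le> C * \<theta>\<^sup>2"
    using gauss_heat_step[of "\<kappa> + 1" \<theta> "real y"] \<theta> \<kappa>_nonneg by (simp only: W_def E_def C_def add_nonneg_nonneg zero_le_one)
  define a1 where "a1 = A 1 - E * (1 - 2 * \<theta> * real y * 1 - \<theta> + 2 * \<theta>\<^sup>2 * (real y)\<^sup>2)"
  define a2 where "a2 = A (- 1) - E * (1 - 2 * \<theta> * real y * (- 1) - \<theta> + 2 * \<theta>\<^sup>2 * (real y)\<^sup>2)"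
  have a: "\<bar>P * a1\<bar> \<le> P * (5 * T)" "\<bar>Q * a2\<bar> \<le> Q * (5 * T)"
    using A[of 1] A[of "- 1"] PQ by (auto simp: abs_mult a1_def a2_def intro!: mult_left_mono)
  have E: "0 \<le> E" "E \<le> 1" using \<theta> by (auto simp: E_def)
  have "P * A 1 + Q * A (- 1) = (P + Q) * E * (1 - \<theta> + 2 * \<theta>\<^sup>2 * (real y)\<^sup>2)
      - 2 * \<theta> * E * (real y * (P - Q)) + P * a1 + Q * a2"
    by (simp add: a1_def a2_def algebra_simps)
  also have "\<dots> = E * (1 - 2 * (\<kappa> + 1) * \<theta> + 2 * \<theta>\<^sup>2 * (real y)\<^sup>2) - 2 * \<theta> * E * drift_error y + P * a1 + Q * a2"
    unfolding PQ1 D by (simp add: algebra_simps)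
  finally have "(P * A 1 + Q * A (- 1)) - W = (E * (1 - 2 * (\<kappa> + 1) * \<theta> + 2 * \<theta>\<^sup>2 * (real y)\<^sup>2) - W)
      - 2 * \<theta> * E * drift_error y + P * a1 + Q * a2" by simp
  moreover have "\<bar>2 * \<theta> * E * drift_error y\<bar> \<le> 2 * \<theta> * \<bar>drift_error y\<bar>"
    using E \<theta> by (simp add: abs_mult mult_left_le_one_le mult_right_mono)
  moreover have "P * (5 * T) + Q * (5 * T) = 5 * T" using PQ1 by (simp add: distrib_right[symmetric])
  moreover have "C * \<theta>\<^sup>2 \<le> C * T" using C T by (intro mult_left_mono)
  ultimately have "\<bar>(P * A 1 + Q * A (- 1)) - W\<bar> \<le> 2 * \<theta> * \<bar>drift_error y\<bar> + (5 * T + C * T)"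
    using a W by linarith
  also have "5 * T + C * T = err_const * T" by (simp add: err_const_def C_def algebra_simps)
  finally have main: "\<bar>(P * A 1 + Q * A (- 1)) - W\<bar> \<le> 2 * \<theta> * \<bar>drift_error y\<bar> + err_const * T" .
  have "step (\<lambda>y. M y * exp (- \<theta> * (real y)\<^sup>2)) y
     - (1 + 2 * \<theta>) powr (- (\<kappa> + 1)) * (M y * exp (- (\<theta> / (1 + 2 * \<theta>)) * (real y)\<^sup>2))
     = m * ((P * A 1 + Q * A (- 1)) - W)"
    unfolding st W_def m_def by (simp add: algebra_simps)
  then show ?thesis using main m by (simp add: abs_mult m_def[symmetric] T_def[symmetric])
qed

text \<open>One step of the walk replaces \<theta> by \<open>\<theta> / (1 + 2\<theta>)\<close>,
  that is, adds 2 to \<open>1 / \<theta>\<close>. The new parameter is smaller and the prefactor at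
  most 1, so accumulated errors are bounded by their values at the original \<theta>.\<close>

lemma laplace_bound:
  assumes \<theta>: "0 < \<theta>" "\<theta> \<le> 1"
  shows "\<bar>laplace k \<theta> - (1 + 2 * real k * \<theta>) powr (- (\<kappa> + 1)) * exp (- (\<theta> / (1 + 2 * real k * \<theta>)))\<bar>
    \<le> (\<Sum>j<k. 2 * \<theta> * mean_error j + err_const * \<theta> powr (3 / 2))"
  using \<theta>
proof (induction k arbitrary: \<theta>)
  case 0
  then show ?case by (simp add: laplace_def killed_mean_0)
next
  case (Suc k)
  define t where "t = \<theta> / (1 + 2 * \<theta>)"
  define b where "b = (1 + 2 * \<theta>) powr (- (\<kappa> + 1))"
  have p: "1 + 2 * \<theta> > 0" using Suc.prems by simp
  have t: "0 < t" "t \<le> \<theta>" "t \<le> 1" using Suc.prems by (auto simp: t_def field_simps)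
  have b: "0 \<le> b" "b \<le> 1"
    using powr_mono[of "- (\<kappa> + 1)" 0 "1 + 2 * \<theta>"] \<kappa>_nonneg Suc.prems by (auto simp: b_def)
  define F where "F y = step (\<lambda>y. M y * exp (- \<theta> * (real y)\<^sup>2)) y
     - b * (M y * exp (- t * (real y)\<^sup>2))" for y
  define B where "B y = 2 * \<theta> * (M y * \<bar>drift_error y\<bar>) + err_const * \<theta> powr (3 / 2) * M y" for y
  have FB: "\<bar>F y\<bar> \<le> B y" if "y \<ge> 1" for y
    using laplace_step[OF that Suc.prems] by (simp add: F_def B_def b_def t_def algebra_simps)
  have "laplace (Suc k) \<theta> - b * laplace k t = killed_mean k F"
    unfolding laplace_def F_def killed_mean_diff killed_mean_cmult by (subst killed_mean_Suc) auto
  moreover have "killed_mean k F \<le> killed_mean k B" using FB by (intro killed_mean_mono) (auto simp: abs_le_iff)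
  moreover have "killed_mean k (\<lambda>y. (-1) * B y) \<le> killed_mean k F"
    using FB by (intro killed_mean_mono) (force simp: abs_le_iff)
  moreover have "killed_mean k B = 2 * \<theta> * mean_error k + err_const * \<theta> powr (3 / 2)"
    unfolding B_def killed_mean_add killed_mean_cmult by (simp add: mean_error_def killed_mean_scaleM)
  ultimately have 1: "\<bar>laplace (Suc k) \<theta> - b * laplace k t\<bar> \<le> 2 * \<theta> * mean_error k + err_const * \<theta> powr (3 / 2)"
    unfolding killed_mean_cmult by linarith
  define V where "V = (1 + 2 * real k * t) powr (- (\<kappa> + 1)) * exp (- (t / (1 + 2 * real k * t)))"
  have me: "mean_error j \<ge> 0" for j
    unfolding mean_error_def using scaleM_mono[of 0] by (intro killed_mean_nonneg) auto
  have "\<bar>laplace k t - V\<bar> \<le> (\<Sum>j<k. 2 * t * mean_error j + err_const * t powr (3 / 2))"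
    unfolding V_def by (rule Suc.IH[OF t(1) t(3)])
  also have "\<dots> \<le> (\<Sum>j<k. 2 * \<theta> * mean_error j + err_const * \<theta> powr (3 / 2))"
    using t me err_const_pos by (intro sum_mono add_mono mult_right_mono mult_left_mono powr_mono2) auto
  finally have 2: "\<bar>laplace k t - V\<bar> \<le> (\<Sum>j<k. 2 * \<theta> * mean_error j + err_const * \<theta> powr (3 / 2))" .
  have "\<bar>b * laplace k t - b * V\<bar> = b * \<bar>laplace k t - V\<bar>"
    using b by (simp add: abs_mult right_diff_distrib[symmetric])
  also have "\<dots> \<le> \<bar>laplace k t - V\<bar>" using b by (simp add: mult_left_le_one_le)
  finally have 3: "\<bar>b * laplace k t - b * V\<bar> \<le> (\<Sum>j<k. 2 * \<theta> * mean_error j + err_const * \<theta> powr (3 / 2))"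
    using 2 by linarith
  \<comment> \<open>Semigroup law of the parameter flow: one step followed by k steps is k + 1
    steps.\<close>
  have pk: "(1 + 2 * \<theta>) * (1 + 2 * real k * t) = 1 + 2 * real (Suc k) * \<theta>"
    using p by (simp add: t_def field_simps)
  have kt: "1 + 2 * real k * t > 0" using t by (simp add: add_pos_nonneg)
  have "t / (1 + 2 * real k * t) = \<theta> / ((1 + 2 * \<theta>) * (1 + 2 * real k * t))" by (simp add: t_def)
  then have e: "t / (1 + 2 * real k * t) = \<theta> / (1 + 2 * real (Suc k) * \<theta>)" unfolding pk .
  have "b * V = ((1 + 2 * \<theta>) * (1 + 2 * real k * t)) powr (- (\<kappa> + 1)) * exp (- (t / (1 + 2 * real k * t)))"
    using p kt by (simp add: b_def V_def powr_mult)
  then have bV: "b * V = (1 + 2 * real (Suc k) * \<theta>) powr (- (\<kappa> + 1)) * exp (- (\<theta> / (1 + 2 * real (Suc k) * \<theta>)))"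
    unfolding pk e .
  show ?case using 1 3 unfolding bV[symmetric] by simp
qed

text \<open>Y escapes to infinity: it lies below A at time k with probability at most
  \<open>M A * survival k\<close>, which tends to 0. Above A the drift error is small, below A it is
  bounded.\<close>

lemma mean_error_tendsto: "mean_error \<longlonglongrightarrow> 0"
proof (rule LIMSEQ_I)
  fix e :: real assume e: "e > 0"
  obtain A where A: "\<And>y. y \<ge> A \<Longrightarrow> \<bar>drift_error y\<bar> < e / 2"
    using LIMSEQ_D[OF drift_error_tendsto, of "e/2"] e by auto
  obtain B where B: "B > 0" "\<And>y. \<bar>drift_error y\<bar> \<le> B"
    using Bseq_def[of drift_error] convergent_imp_Bseq[of drift_error] drift_error_tendsto by (auto simp: convergent_def)
  have le: "mean_error k \<le> e / 2 + B * M A * survival k" for k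
  proof -
    have "mean_error k \<le> killed_mean k (\<lambda>y. e / 2 * M y + B * M A * 1)"
      unfolding mean_error_def
    proof (intro killed_mean_mono)
      fix y :: nat assume y: "y \<ge> 1"
      have M: "M y \<ge> 0" "M A \<ge> 0" using scaleM_mono[of 0] by auto
      show "M y * \<bar>drift_error y\<bar> \<le> e / 2 * M y + B * M A * 1"
      proof (cases "y \<ge> A")
        case True
        then have "M y * \<bar>drift_error y\<bar> \<le> M y * (e / 2)"
          using A[of y] M by (intro mult_left_mono) auto
        moreover have "B * M A \<ge> 0" using B M by simp
        ultimately show ?thesis by (simp add: mult.commute)
      next
        case False
        then have "M y * \<bar>drift_error y\<bar> \<le> M A * B"
          using B M by (intro mult_mono scaleM_mono) auto
        moreover have "e / 2 * M y \<ge> 0" using e M by simp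
        ultimately show ?thesis by (simp add: mult.commute)
      qed
    qed
    also have "\<dots> = e / 2 + B * M A * survival k"
      unfolding killed_mean_add killed_mean_cmult killed_mean_scaleM survival_eq by simp
    finally show ?thesis .
  qed
  have "(\<lambda>k. B * M A * survival k) \<longlonglongrightarrow> B * M A * 0"
    by (intro tendsto_intros survival_tendsto_0)
  then have "eventually (\<lambda>k. B * M A * survival k < e / 2) sequentially"
    by (intro order_tendstoD(2)) (use e in auto)
  then have "eventually (\<lambda>k. mean_error k < e) sequentially"
  proof eventually_elim
    case (elim k) then show ?case using le[of k] by linarith
  qed
  moreover have "mean_error k \<ge> 0" for k
    unfolding mean_error_def using scaleM_mono[of 0] by (intro killed_mean_nonneg) auto
  ultimately show "\<exists>no. \<forall>n\<ge>no. norm (mean_error n - 0) < e"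
    by (auto simp: eventually_sequentially)
qed

text \<open>At \<open>\<theta> = s / n\<close> the accumulated error is 2s times the Cesaro mean of
  \<open>mean_error\<close> plus a multiple of \<open>n powr (-1/2)\<close>.\<close>

lemma laplace_tendsto:
  assumes s: "s \<ge> 0"
  shows "(\<lambda>n. laplace n (s / real n)) \<longlonglongrightarrow> (1 + 2 * s) powr (- (\<kappa> + 1))"
proof (cases "s = 0")
  case True
  then show ?thesis by (simp add: laplace_def killed_mean_scaleM)
next
  case False
  with s have s: "s > 0" by simp
  define T where "T n = (1 + 2 * s) powr (- (\<kappa> + 1)) * exp (- (s / real n / (1 + 2 * s)))" for n :: nat
  have T: "T \<longlonglongrightarrow> (1 + 2 * s) powr (- (\<kappa> + 1)) * exp (- (0 / (1 + 2 * s)))"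
  proof -
    have "1 + 2 * s \<noteq> 0" using s by linarith
    moreover have "(\<lambda>n. s / real n) \<longlonglongrightarrow> 0" by (rule lim_const_over_n)
    ultimately show ?thesis unfolding T_def by (intro tendsto_intros)
  qed
  define U where "U n = 2 * s * ((\<Sum>j<n. mean_error j * 1) / (\<Sum>j<n. 1)) + err_const * (s powr (3 / 2) * (real n * (1 / real n) powr (3 / 2)))" for n :: nat
  have "(\<lambda>n. (\<Sum>j<n. mean_error j * 1) / (\<Sum>j<n. 1::real)) \<longlonglongrightarrow> 0"
    by (rule weighted_mean_tendsto[OF _ _ mean_error_tendsto]) (auto simp: filterlim_real_sequentially)
  moreover have "(\<lambda>n. real n * (1 / real n) powr (3 / 2)) \<longlonglongrightarrow> 0" by real_asymp
  ultimately have U: "U \<longlonglongrightarrow> 2 * s * 0 + err_const * (s powr (3 / 2) * 0)"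
    unfolding U_def by (intro tendsto_intros)
  have "(\<lambda>n. laplace n (s / real n) - T n) \<longlonglongrightarrow> 0"
  proof (rule Lim_null_comparison)
    show "U \<longlonglongrightarrow> 0" using U by simp
    have "eventually (\<lambda>n. real n \<ge> max s 1) sequentially"
      using filterlim_real_sequentially unfolding filterlim_at_top by blast
    then show "eventually (\<lambda>n. norm (laplace n (s / real n) - T n) \<le> U n) sequentially"
    proof eventually_elim
      case (elim n)
      have n: "n > 0" using elim by auto
      have \<theta>: "0 < s / real n" "s / real n \<le> 1" using elim s n by (auto simp: field_simps)
      have e: "1 + 2 * real n * (s / real n) = 1 + 2 * s" using n by simp
      have "\<bar>laplace n (s / real n) - T n\<bar> \<le> (\<Sum>j<n. 2 * (s / real n) * mean_error j + err_const * (s / real n) powr (3 / 2))"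
        using laplace_bound[OF \<theta>, of n] unfolding e T_def by simp
      also have "\<dots> = U n"
      proof -
        have "(\<Sum>j<n. 2 * (s / real n) * mean_error j) = 2 * s * ((\<Sum>j<n. mean_error j * 1) / (\<Sum>j<n. 1))"
          by (simp only: sum_distrib_left[symmetric]) simp
        then show ?thesis using n s by (simp add: U_def sum.distrib powr_divide del: times_divide_eq_right) simp
      qed
      finally show ?case by simp
    qed
  qed
  from tendsto_add[OF this T] show ?thesis by simp
qed

end

section \<open>Survival probabilities\<close>

text \<open>The recursion is used twice. With coefficient 1/2 it gives boundedness of t by strong
  induction; once t is bounded, a small coefficient makes the term \<open>\<rho> * t a\<close>
  negligible.\<close>

lemma contraction_limsup:
  fixes t :: "nat \<Rightarrow> real"
  assumes t0: "\<And>n. t n \<ge> 0" and c: "c \<ge> 0"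
    and rec: "\<And>\<rho> z. \<rho> > 0 \<Longrightarrow> z > c \<Longrightarrow> eventually (\<lambda>n. \<exists>a<n. t n \<le> \<rho> * t a + z) sequentially"
    and z: "z > c"
  shows "eventually (\<lambda>n. t n < z) sequentially"
proof -
  obtain N where N: "\<And>n. n \<ge> N \<Longrightarrow> \<exists>a<n. t n \<le> 1 / 2 * t a + (c + 1)"
    using rec[of "1/2" "c + 1"] by (auto simp: eventually_sequentially)
  \<comment> \<open>The second entry ensures \<open>B / 2 + (c + 1) \<le> B\<close>, which
    propagates the bound.\<close>
  define B where "B = max (Max (t ` {..N})) (2 * (c + 1))"
  have B: "t n \<le> B" for n
  proof (induction n rule: less_induct)
    case (less n)
    show ?case
    proof (cases "n \<le> N")
      case True
      then have "t n \<le> Max (t ` {..N})" by (intro Max_ge) auto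
      then show ?thesis by (simp add: B_def)
    next
      case False
      then obtain a where a: "a < n" "t n \<le> 1 / 2 * t a + (c + 1)" using N[of n] by auto
      have "c + 1 \<le> B / 2" by (simp add: B_def)
      then show ?thesis using a less[of a] by linarith
    qed
  qed
  have B0: "B > 0" using c by (simp add: B_def less_max_iff_disj)
  define z' where "z' = (z + c) / 2"
  define \<rho> where "\<rho> = (z - z') / (2 * B)"
  have z': "c < z'" "z' < z" using z by (auto simp: z'_def)
  have \<rho>: "\<rho> > 0" using z' B0 by (simp add: \<rho>_def)
  show ?thesis
    using rec[OF \<rho> z'(1)]
  proof eventually_elim
    case (elim n)
    then obtain a where a: "t n \<le> \<rho> * t a + z'" by auto
    also have "\<rho> * t a \<le> \<rho> * B" using \<rho> B[of a] by (intro mult_left_mono) auto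
    also have "\<rho> * B = (z - z') / 2" using B0 by (simp add: \<rho>_def)
    also have "(z - z') / 2 + z' < z" using z'(2) by (simp add: field_simps)
    finally show ?case by simp
  qed
qed

section \<open>Integer square roots\<close>

definition isqrt :: "nat \<Rightarrow> nat" where
  "isqrt n = nat \<lfloor>sqrt (real n)\<rfloor>"

lemma isqrt_bounds: "real (isqrt n) \<le> sqrt (real n)" "sqrt (real n) < real (isqrt n) + 1"
  unfolding isqrt_def by (simp_all add: of_nat_nat)

lemma isqrt_quotient: "(\<lambda>n. real (isqrt n) / sqrt (real n)) \<longlonglongrightarrow> 1"
proof (rule real_tendsto_sandwich[where f = "\<lambda>n. 1 - 1 / sqrt (real n)" and h = "\<lambda>_. 1"])
  show "eventually (\<lambda>n. 1 - 1 / sqrt (real n) \<le> real (isqrt n) / sqrt (real n)) sequentially"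
    using eventually_gt_at_top[of 0]
  proof eventually_elim
    case (elim n)
    have "1 - 1 / sqrt (real n) = (sqrt (real n) - 1) / sqrt (real n)" using elim by (simp add: diff_divide_distrib)
    also have "\<dots> \<le> real (isqrt n) / sqrt (real n)"
      using isqrt_bounds(2)[of n] by (intro divide_right_mono) auto
    finally show ?case .
  qed
  show "eventually (\<lambda>n. real (isqrt n) / sqrt (real n) \<le> 1) sequentially"
    using eventually_gt_at_top[of 0]
  proof eventually_elim
    case (elim n)
    then show ?case using isqrt_bounds(1)[of n] by (simp add: field_simps)
  qed
  show "(\<lambda>n. 1 - 1 / sqrt (real n)) \<longlonglongrightarrow> 1" by real_asymp
qed auto

lemma isqrt_at_top: "filterlim isqrt at_top sequentially"
  unfolding isqrt_def by real_asymp

lemma isqrt_mono: "m \<le> n \<Longrightarrow> isqrt m \<le> isqrt n"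
  unfolding isqrt_def by (intro nat_mono floor_mono) simp

lemma isqrt_ratio_tendsto:
  assumes i: "filterlim i at_top F" and j: "filterlim j at_top F"
    and ij: "((\<lambda>n. real (i n) / real (j n)) \<longlongrightarrow> a) F" and a: "a > 0"
  shows "((\<lambda>n. real (isqrt (i n)) / real (isqrt (j n))) \<longlongrightarrow> sqrt a) F"
proof -
  have "((\<lambda>n. (real (isqrt (i n)) / sqrt (real (i n))) * sqrt (real (i n) / real (j n))
      / (real (isqrt (j n)) / sqrt (real (j n)))) \<longlongrightarrow> 1 * sqrt a / 1) F"
    by (intro tendsto_intros ij filterlim_compose[OF isqrt_quotient i] filterlim_compose[OF isqrt_quotient j]) auto
  moreover have "eventually (\<lambda>n. (real (isqrt (i n)) / sqrt (real (i n))) * sqrt (real (i n) / real (j n))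
      / (real (isqrt (j n)) / sqrt (real (j n))) = real (isqrt (i n)) / real (isqrt (j n))) F"
  proof -
    have "eventually (\<lambda>n. i n \<ge> 1) F" "eventually (\<lambda>n. j n \<ge> 1) F"
      using i j by (auto simp: filterlim_at_top)
    then show ?thesis
      by eventually_elim (simp add: real_sqrt_divide)
  qed
  ultimately show ?thesis by (auto intro: Lim_transform_eventually)
qed

section \<open>Comparison of the scale function with truncated powers\<close>

context recurrent_bessel_walk
begin

lemma scaleM_isqrt_ratio:
  assumes i: "filterlim i at_top F" and j: "filterlim j at_top F"
    and ij: "((\<lambda>n. real (i n) / real (j n)) \<longlongrightarrow> a) F" and a: "a > 0"
  shows "((\<lambda>n. M (isqrt (i n)) / M (isqrt (j n))) \<longlongrightarrow> a powr \<kappa>) F"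
proof -
  have "((\<lambda>n. M (isqrt (i n)) / M (isqrt (j n))) \<longlongrightarrow> sqrt a powr (2 * \<kappa>)) F"
    by (rule ratio_index_tendsto[OF scaleM_ratio_index])
       (use a in \<open>auto intro!: filterlim_compose[OF isqrt_at_top] i j isqrt_ratio_tendsto ij\<close>)
  moreover have "sqrt a powr (2 * \<kappa>) = a powr \<kappa>"
    using a by (simp add: powr_half_sqrt[symmetric] powr_powr)
  ultimately show ?thesis by simp
qed

lemma laplace_le_1: "\<theta> \<ge> 0 \<Longrightarrow> laplace n \<theta> \<le> 1"
proof -
  assume \<theta>: "\<theta> \<ge> 0"
  have "laplace n \<theta> \<le> killed_mean n M"
    unfolding laplace_def using \<theta> scaleM_mono[of 0]
    by (intro killed_mean_mono) (simp add: mult_left_le)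
  then show ?thesis by (simp add: killed_mean_scaleM)
qed

lemma laplace_nonneg: "laplace n \<theta> \<ge> 0"
  unfolding laplace_def using scaleM_mono[of 0] by (intro killed_mean_nonneg) auto

abbreviation trunc_mean :: "real \<Rightarrow> nat \<Rightarrow> real" where
  "trunc_mean R n \<equiv> killed_mean n (\<lambda>y. M y * trunc_power \<kappa> R ((real y)\<^sup>2 / real n))"

abbreviation trunc_limit :: "real \<Rightarrow> real" where
  "trunc_limit R \<equiv> R * (1 + 2 * R powr (1 / \<kappa>)) powr (- \<kappa>)"

abbreviation large_mean :: "real \<Rightarrow> nat \<Rightarrow> real" where
  "large_mean h n \<equiv> killed_mean n (\<lambda>y. if h * sqrt (real n) \<le> real y then 1 else 0)"

abbreviation small_mean :: "nat \<Rightarrow> nat \<Rightarrow> real" where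
  "small_mean H n \<equiv> killed_mean n (\<lambda>y. if y \<le> H then 1 else 0)"

text \<open>\<open>trunc_power\<close> is a mixture of exponentials, so its mean under Y is a
  mixture of Laplace transforms; these are bounded by 1 and converge pointwise.\<close>

lemma trunc_power_mean_tendsto:
  assumes \<kappa>: "\<kappa> > 0" and R: "R > 0"
  shows "(\<lambda>n. trunc_mean R n)
    \<longlonglongrightarrow> trunc_limit R"
proof -
  define f where "f n r = laplace n (r powr (1 / \<kappa>) / real n)" for n r
  have fsum: "f n r = (\<Sum>y=1..Suc n. taboo p (Suc n) y * M y * exp (- (r powr (1 / \<kappa>) * ((real y)\<^sup>2 / real n))))" for n r
    by (simp add: f_def laplace_def killed_mean_def mult.assoc del: taboo.simps)
  have f_int: "f n integrable_on {0..R}" for n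
    unfolding fsum[abs_def]
    by (intro integrable_sum integrable_on_mult_right trunc_power_integrable \<kappa>) auto
  have eq: "trunc_mean R n = integral {0..R} (f n)" for n
  proof -
    have "integral {0..R} (f n) = (\<Sum>y=1..Suc n. integral {0..R} (\<lambda>r. taboo p (Suc n) y * M y
        * exp (- (r powr (1 / \<kappa>) * ((real y)\<^sup>2 / real n)))))"
      unfolding fsum[abs_def]
      by (intro integral_sum integrable_on_mult_right trunc_power_integrable \<kappa>) auto
    then show ?thesis
      by (simp only: integral_mult_right killed_mean_def trunc_power_def mult.assoc)
  qed
  have "(\<lambda>n. integral {0..R} (f n)) \<longlonglongrightarrow> integral {0..R} (\<lambda>r. (1 + 2 * r powr (1 / \<kappa>)) powr (- (\<kappa> + 1)))"
  proof (rule dominated_convergence(2))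
    show "f n integrable_on {0..R}" for n by (rule f_int)
    show "(\<lambda>_. 1 :: real) integrable_on {0..R}" by (rule integrable_const_ivl)
    show "norm (f n r) \<le> 1" for n r
      using laplace_le_1 laplace_nonneg by (simp add: f_def)
    show "(\<lambda>n. f n r) \<longlonglongrightarrow> (1 + 2 * r powr (1 / \<kappa>)) powr (- (\<kappa> + 1))" for r
      unfolding f_def by (rule laplace_tendsto) simp
  qed
  then show ?thesis unfolding eq integral_power_mean[OF \<kappa> R] .
qed

text \<open>Potter bounds between \<open>isqrt n\<close> and y. Half of \<eta> pays for the Potter
  error, where \<open>|ln (isqrt n / y)| \<le> K\<close>, and half for replacing sqrt n by its
  integer part.\<close>

lemma scaleM_uniform:
  assumes h: "0 < h" and \<eta>: "\<eta> > 0"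
  shows "eventually (\<lambda>n. \<forall>y. h * sqrt (real n) \<le> real y \<and> real y \<le> C * sqrt (real n) \<longrightarrow>
    exp (- \<eta>) * ((real y)\<^sup>2 / real n) powr (- \<kappa>) \<le> M (isqrt n) / M y \<and>
    M (isqrt n) / M y \<le> exp \<eta> * ((real y)\<^sup>2 / real n) powr (- \<kappa>)) sequentially"
proof -
  define K where "K = \<bar>ln h\<bar> + \<bar>ln C\<bar> + 1"
  have K: "K > 0" by (simp add: K_def add_nonneg_pos)
  \<comment> \<open>The entry 1 accounts for the summand 1 in \<open>K\<close>; the other gives
    \<open>2 * \<kappa> * e \<le> \<eta> / 2\<close>. The denominator uses
    \<open>2 * \<kappa> + 1\<close> to allow \<kappa> = 0.\<close>
  define e where "e = min 1 (\<eta> / (2 * (2 * \<kappa> + 1)))"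
  have e: "e > 0" using \<eta> \<kappa>_nonneg by (simp add: e_def)
  obtain N where N: "N \<ge> 1" "\<And>i j. i \<ge> N \<Longrightarrow> j \<ge> N \<Longrightarrow>
    \<bar>ln (M i / M j) - 2 * \<kappa> * ln (real i / real j)\<bar> \<le> \<eta> / (2 * K) * \<bar>ln (real i / real j)\<bar>"
    using potter_bound[OF scaleM_ratio_index, of "\<eta> / (2 * K)"] \<eta> K by auto
  have "(\<lambda>n. ln (real (isqrt n) / sqrt (real n))) \<longlonglongrightarrow> ln 1"
    by (intro tendsto_ln isqrt_quotient) simp
  then have "eventually (\<lambda>n. \<bar>ln (real (isqrt n) / sqrt (real n))\<bar> < e) sequentially"
    by (intro order_tendstoD(2)[OF tendsto_rabs]) (use e in auto)
  moreover have "eventually (\<lambda>n. isqrt n \<ge> N) sequentially"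
    using isqrt_at_top unfolding filterlim_at_top by blast
  moreover have "filterlim (\<lambda>n. h * sqrt (real n)) at_top sequentially"
    using h by real_asymp
  then have "eventually (\<lambda>n. h * sqrt (real n) \<ge> real N) sequentially"
    unfolding filterlim_at_top by blast
  ultimately show ?thesis using eventually_gt_at_top[of 0]
  proof eventually_elim
    case (elim n)
    define m where "m = isqrt n"
    define q where "q = sqrt (real n)"
    have q: "q > 0" using elim by (simp add: q_def)
    have m: "m \<ge> N" "m \<ge> 1" "\<bar>ln (real m / q)\<bar> < e" using elim N(1) by (auto simp: m_def q_def)
    show ?case
    proof (intro allI impI)
      fix y assume y: "h * sqrt (real n) \<le> real y \<and> real y \<le> C * sqrt (real n)"
      have yN: "y \<ge> N" "y \<ge> 1" using y elim N(1) by linarith+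
      define x where "x = (real y)\<^sup>2 / real n"
      have n: "real n = q\<^sup>2" by (simp add: q_def)
      have x: "x = (real y / q)\<^sup>2" by (simp add: x_def n power_divide)
      have x0: "x > 0" using yN q by (simp add: x)
      have yq: "h \<le> real y / q" "real y / q \<le> C" using y q by (auto simp: q_def field_simps)
      have "ln h \<le> ln (real y / q)" using yq h by (intro ln_mono) auto
      moreover have "ln (real y / q) \<le> ln C"
        using yq h by (intro ln_mono) auto
      ultimately have lny: "\<bar>ln (real y / q)\<bar> \<le> \<bar>ln h\<bar> + \<bar>ln C\<bar>" by linarith
      have lx: "ln x = 2 * ln (real y / q)" unfolding x using yN q ln_realpow[of "real y / q" 2] by simp
      have lmy: "ln (real m / real y) = ln (real m / q) - ln (real y / q)"
        using m yN q by (simp add: ln_div)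
      define D where "D = ln (M m / M y) + \<kappa> * ln x"
      have "D = (ln (M m / M y) - 2 * \<kappa> * ln (real m / real y)) + 2 * \<kappa> * ln (real m / q)"
        unfolding D_def lmy lx by (simp add: algebra_simps)
      then have "\<bar>D\<bar> \<le> \<bar>ln (M m / M y) - 2 * \<kappa> * ln (real m / real y)\<bar> + \<bar>2 * \<kappa> * ln (real m / q)\<bar>"
        by (simp add: abs_triangle_ineq)
      also have "\<bar>ln (M m / M y) - 2 * \<kappa> * ln (real m / real y)\<bar> \<le> \<eta> / (2 * K) * \<bar>ln (real m / real y)\<bar>"
        by (rule N(2)[OF m(1) yN(1)])
      also have "\<dots> \<le> \<eta> / (2 * K) * K"
      proof (intro mult_left_mono)
        have "e \<le> 1" by (simp add: e_def)
        then show "\<bar>ln (real m / real y)\<bar> \<le> K" unfolding lmy K_def using lny m by linarith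
      qed (use \<eta> K in auto)
      also have "\<dots> = \<eta> / 2" using K by simp
      also have "\<bar>2 * \<kappa> * ln (real m / q)\<bar> \<le> \<eta> / 2"
      proof -
        have "\<bar>2 * \<kappa> * ln (real m / q)\<bar> = 2 * \<kappa> * \<bar>ln (real m / q)\<bar>" using \<kappa>_nonneg by (simp add: abs_mult)
        also have "\<dots> \<le> (2 * \<kappa> + 1) * (\<eta> / (2 * (2 * \<kappa> + 1)))"
          using m \<kappa>_nonneg by (intro mult_mono) (auto simp: e_def)
        also have "\<dots> = \<eta> / 2" using \<kappa>_nonneg by (simp add: field_simps)
        finally show ?thesis .
      qed
      finally have D: "\<bar>D\<bar> \<le> \<eta>" by simp
      have Mp: "M m / M y > 0" using scaleM_pos m yN by simp
      have eD: "M m / M y = exp D * x powr (- \<kappa>)"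
        using Mp x0 by (simp add: D_def powr_def exp_add[symmetric])
      have "exp (- \<eta>) \<le> exp D" "exp D \<le> exp \<eta>" using D by auto
      then show "exp (- \<eta>) * ((real y)\<^sup>2 / real n) powr (- \<kappa>) \<le> M (isqrt n) / M y \<and>
         M (isqrt n) / M y \<le> exp \<eta> * ((real y)\<^sup>2 / real n) powr (- \<kappa>)"
        unfolding m_def[symmetric] x_def[symmetric] eD by (intro conjI mult_right_mono) auto
    qed
  qed
qed

lemma trunc_power_mean_limit:
  assumes \<kappa>: "\<kappa> > 0"
  shows "(\<lambda>N. trunc_limit (real N powr \<kappa>)) \<longlonglongrightarrow> 2 powr (- \<kappa>)"
proof -
  have "(\<lambda>N. real N / (1 + 2 * real N)) \<longlonglongrightarrow> 1 / 2" by real_asymp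
  then have "(\<lambda>N. (real N / (1 + 2 * real N)) powr \<kappa>) \<longlonglongrightarrow> (1 / 2) powr \<kappa>"
    by (intro tendsto_powr tendsto_const) auto
  moreover have "(real N / (1 + 2 * real N)) powr \<kappa>
      = trunc_limit (real N powr \<kappa>)" for N
  proof -
    have "(real N powr \<kappa>) powr (1 / \<kappa>) = real N" using \<kappa> by (simp add: powr_powr)
    moreover have "(real N / (1 + 2 * real N)) powr \<kappa> = real N powr \<kappa> / (1 + 2 * real N) powr \<kappa>"
      by (rule powr_divide)
    ultimately show ?thesis by (simp only: powr_minus divide_inverse)
  qed
  moreover have "(1 / 2 :: real) powr \<kappa> = 2 powr (- \<kappa>)" by (simp add: powr_minus_divide powr_divide)
  ultimately show ?thesis by simp
qed

lemma trunc_power_mean_limit_le: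
  assumes \<kappa>: "\<kappa> > 0" and R: "R > 0"
  shows "trunc_limit R \<le> 2 powr (- \<kappa>)"
proof -
  have "(1 + 2 * R powr (1 / \<kappa>)) powr (- \<kappa>) \<le> (2 * R powr (1 / \<kappa>)) powr (- \<kappa>)"
    using \<kappa> R by (intro powr_mono2') auto
  also have "\<dots> = 2 powr (- \<kappa>) / R"
    using \<kappa> R by (simp add: powr_mult powr_powr powr_minus_divide)
  finally show ?thesis using R by (simp add: field_simps)
qed

text \<open>A pointwise bound of the truncated integrand by \<open>M (isqrt n)\<close>, integrated
  against the killed law. For y of order sqrt n it is \<open>scaleM_uniform\<close>. For smaller y
  the truncation is at most R, and monotonicity of \<open>M\<close> reduces to a point z near
  \<open>h * sqrt n\<close>. For larger y the subtracted term makes the left side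
  nonpositive.\<close>

lemma survival_lower_aux:
  assumes \<kappa>: "\<kappa> > 0" and R: "R > 0" and C: "C > 0" and \<eta>: "\<eta> > 0"
  shows "eventually (\<lambda>n. exp (- \<eta>) * (trunc_mean R n / Gamma (\<kappa> + 1)
      - (C\<^sup>2) powr (- \<kappa>)) \<le> survival n * M (isqrt n)) sequentially"
proof -
  define G where "G = Gamma (\<kappa> + 1)"
  have G: "G > 0" unfolding G_def using \<kappa> by (intro Gamma_real_pos) auto
  \<comment> \<open>The auxiliary point z lies between \<open>h * sqrt n\<close> and
    \<open>2 * h * sqrt n\<close>. The first entry keeps it below \<open>C * sqrt n\<close>, the
    second makes \<open>(4 * h^2) powr - \<kappa>\<close> at least R / G.\<close>
  define h where "h = min (C / 2) (sqrt ((R / G) powr (- 1 / \<kappa>)) / 2)"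
  have h: "h > 0" using C R G by (simp add: h_def)
  have hR: "(4 * h\<^sup>2) powr (- \<kappa>) \<ge> R / G"
  proof -
    have "2 * h \<le> sqrt ((R / G) powr (- 1 / \<kappa>))" by (simp add: h_def)
    then have "(2 * h)\<^sup>2 \<le> (sqrt ((R / G) powr (- 1 / \<kappa>)))\<^sup>2" using h by (intro power_mono) auto
    then have "4 * h\<^sup>2 \<le> (R / G) powr (- 1 / \<kappa>)" by (simp add: power_mult_distrib)
    then have "((R / G) powr (- 1 / \<kappa>)) powr (- \<kappa>) \<le> (4 * h\<^sup>2) powr (- \<kappa>)"
      using h \<kappa> by (intro powr_mono2') auto
    then show ?thesis using R G \<kappa> by (simp add: powr_powr)
  qed
  have "filterlim (\<lambda>n. h * sqrt (real n)) at_top sequentially" using h by real_asymp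
  then have "eventually (\<lambda>n. h * sqrt (real n) \<ge> 1) sequentially"
    unfolding filterlim_at_top by blast
  with scaleM_uniform[OF h \<eta>, of C] show ?thesis using eventually_gt_at_top[of 0]
  proof eventually_elim
    case (elim n)
    define x where "x y = (real y)\<^sup>2 / real n" for y
    define J where "J y = trunc_power \<kappa> R (x y)" for y
    note U = elim(1)[rule_format, folded x_def]
    have n: "real n > 0" using elim by simp
    have Mp: "M (isqrt n) \<ge> 0" using scaleM_mono[of 0] by simp
    have pt: "exp (- \<eta>) * (M y * J y / G - (C\<^sup>2) powr (- \<kappa>) * M y) \<le> M (isqrt n) * 1"
      if y: "y \<ge> 1" for y
    proof -
      have My: "M y > 0" using scaleM_pos y by simp
      have x0: "x y > 0" using y n by (simp add: x_def)
      have J1: "J y / G \<le> x y powr (- \<kappa>)"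
        using trunc_power_upper[OF \<kappa>, of R "x y"] R x0 G by (simp add: J_def G_def field_simps)
      have J2: "J y / G \<le> R / G"
        using trunc_power_le[OF \<kappa>, of R "x y"] R x0 G by (intro divide_right_mono) (auto simp: J_def)
      have C0: "(C\<^sup>2) powr (- \<kappa>) \<ge> 0" by simp
      have "exp (- \<eta>) * (J y / G - (C\<^sup>2) powr (- \<kappa>)) \<le> M (isqrt n) / M y"
      proof -
        consider "real y < h * sqrt (real n)" | "h * sqrt (real n) \<le> real y" "real y \<le> C * sqrt (real n)" | "C * sqrt (real n) < real y"
          by linarith
        then show ?thesis
        proof cases
          case 1
          define z where "z = nat \<lceil>h * sqrt (real n)\<rceil>"
          have z: "h * sqrt (real n) \<le> real z" unfolding z_def by linarith
          have "real z \<le> h * sqrt (real n) + 1"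
            unfolding z_def using h by (simp add: of_nat_nat ceiling_le_iff)
          then have z2: "real z \<le> 2 * h * sqrt (real n)" using elim(2) by linarith
          also have "\<dots> \<le> C * sqrt (real n)" by (intro mult_right_mono) (auto simp: h_def)
          finally have Uz: "exp (- \<eta>) * (x z) powr (- \<kappa>) \<le> M (isqrt n) / M z"
            using U[of z] z by blast
          have z1: "z \<ge> 1" using z elim(2) by linarith
          have yz: "y \<le> z" using 1 z by linarith
          have "(real z)\<^sup>2 \<le> (2 * h * sqrt (real n))\<^sup>2" using z2 by (intro power_mono) auto
          then have "x z \<le> 4 * h\<^sup>2" using n by (simp add: x_def power_mult_distrib divide_le_eq)
          moreover have "x z > 0" using z1 n by (simp add: x_def)
          ultimately have "R / G \<le> x z powr (- \<kappa>)"
            using hR \<kappa> by (intro order_trans[OF hR powr_mono2']) auto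
          then have "J y / G - (C\<^sup>2) powr (- \<kappa>) \<le> x z powr (- \<kappa>)" using J2 C0 by linarith
          then have "exp (- \<eta>) * (J y / G - (C\<^sup>2) powr (- \<kappa>)) \<le> exp (- \<eta>) * x z powr (- \<kappa>)"
            by (intro mult_left_mono) auto
          also note Uz
          also have "M (isqrt n) / M z \<le> M (isqrt n) / M y"
            using scaleM_mono[OF yz] My Mp by (intro divide_left_mono mult_pos_pos scaleM_pos z1 y) auto
          finally show ?thesis .
        next
          case 2
          have "exp (- \<eta>) * (J y / G - (C\<^sup>2) powr (- \<kappa>)) \<le> exp (- \<eta>) * x y powr (- \<kappa>)"
          proof (intro mult_left_mono)
            show "J y / G - (C\<^sup>2) powr (- \<kappa>) \<le> x y powr (- \<kappa>)" using J1 C0 by linarith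
          qed auto
          also have "\<dots> \<le> M (isqrt n) / M y" using U[of y] 2 by blast
          finally show ?thesis .
        next
          case 3
          have "(C * sqrt (real n))\<^sup>2 \<le> (real y)\<^sup>2" using 3 C by (intro power_mono) auto
          then have "C\<^sup>2 \<le> x y" using n by (simp add: x_def power_mult_distrib le_divide_eq)
          then have "x y powr (- \<kappa>) \<le> (C\<^sup>2) powr (- \<kappa>)" using C \<kappa> by (intro powr_mono2') auto
          then have "exp (- \<eta>) * (J y / G - (C\<^sup>2) powr (- \<kappa>)) \<le> 0"
            using J1 by (intro mult_nonneg_nonpos) auto
          also have "0 \<le> M (isqrt n) / M y" using Mp My by simp
          finally show ?thesis .
        qed
      qed
      then have "exp (- \<eta>) * (J y / G - (C\<^sup>2) powr (- \<kappa>)) * M y \<le> M (isqrt n)"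
        using My by (simp add: pos_le_divide_eq)
      then show ?thesis by (simp add: algebra_simps)
    qed
    have "killed_mean n (\<lambda>y. exp (- \<eta>) * (1 / G * (M y * J y) - (C\<^sup>2) powr (- \<kappa>) * M y))
        \<le> killed_mean n (\<lambda>y. M (isqrt n) * 1)"
      using pt by (intro killed_mean_mono) auto
    then show ?case
      unfolding killed_mean_cmult killed_mean_diff killed_mean_scaleM survival_eq G_def[symmetric]
      by (simp add: J_def x_def mult.commute)
  qed
qed

text \<open>Converse of the preceding bound, on \<open>y \<ge> h * sqrt n\<close> only: there one
  cutoff R makes the truncation error at most e. Beyond \<open>C * sqrt n\<close>, monotonicity of
  \<open>M\<close> reduces to a point above \<open>C / 2 * sqrt n\<close>, hence
  \<open>C^2 / 4\<close>.\<close>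

lemma large_upper_aux:
  assumes \<kappa>: "\<kappa> > 0" and h: "h > 0" and C: "C \<ge> 2 * h" and \<eta>: "\<eta> > 0" and e: "e > 0"
  obtains R where "R > 0" "eventually (\<lambda>n. large_mean h n * M (isqrt n)
     \<le> exp \<eta> * (trunc_mean R n / Gamma (\<kappa> + 1)
      + (e + (C\<^sup>2 / 4) powr (- \<kappa>)))) sequentially"
proof -
  define G where "G = Gamma (\<kappa> + 1)"
  have G: "G > 0" unfolding G_def using \<kappa> by (intro Gamma_real_pos) auto
  obtain R0 where R0: "R0 \<ge> 0" "\<And>R x. R \<ge> R0 \<Longrightarrow> x \<ge> h\<^sup>2 \<Longrightarrow> G * x powr (- \<kappa>) \<le> trunc_power \<kappa> R x + G * e"
    using trunc_power_lower[OF \<kappa>, of "h\<^sup>2" "G * e"] h e G unfolding G_def by auto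
  define R where "R = R0 + 1"
  have R: "R > 0" using R0 by (simp add: R_def)
  have C0: "C > 0" using h C by linarith
  have "filterlim (\<lambda>n. C * sqrt (real n)) at_top sequentially" using C0 by real_asymp
  then have "eventually (\<lambda>n. C * sqrt (real n) \<ge> 2) sequentially"
    unfolding filterlim_at_top by blast
  with scaleM_uniform[OF h \<eta>, of C] have "eventually (\<lambda>n. large_mean h n * M (isqrt n)
     \<le> exp \<eta> * (trunc_mean R n / Gamma (\<kappa> + 1)
      + (e + (C\<^sup>2 / 4) powr (- \<kappa>)))) sequentially"
    using eventually_gt_at_top[of 0]
  proof eventually_elim
    case (elim n)
    define x where "x y = (real y)\<^sup>2 / real n" for y
    define J where "J y = trunc_power \<kappa> R (x y)" for y
    define B where "B = e + (C\<^sup>2 / 4) powr (- \<kappa>)"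
    note U = elim(1)[rule_format, folded x_def]
    have n: "real n > 0" using elim by simp
    have Mp: "M (isqrt n) \<ge> 0" using scaleM_mono[of 0] by simp
    have J0: "J y \<ge> 0" for y unfolding J_def trunc_power_def
      by (intro integral_nonneg trunc_power_integrable \<kappa>) auto
    have B0: "B > 0" using e by (simp add: B_def add_pos_nonneg)
    have pt: "M (isqrt n) * (if h * sqrt (real n) \<le> real y then 1 else 0)
        \<le> exp \<eta> * (1 / G * (M y * J y) + B * M y)" if y: "y \<ge> 1" for y
    proof (cases "h * sqrt (real n) \<le> real y")
      case False
      have "M y > 0" using scaleM_pos y by simp
      then show ?thesis using False J0[of y] B0 G by simp
    next
      case True
      have My: "M y > 0" using scaleM_pos y by simp
      have "M (isqrt n) / M y \<le> exp \<eta> * (J y / G + B)"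
      proof (cases "real y \<le> C * sqrt (real n)")
        case yC: True
        have "(h * sqrt (real n))\<^sup>2 \<le> (real y)\<^sup>2" using True h by (intro power_mono) auto
        then have "h\<^sup>2 \<le> x y" using n by (simp add: x_def power_mult_distrib le_divide_eq)
        then have "G * x y powr (- \<kappa>) \<le> J y + G * e" unfolding J_def by (intro R0) (auto simp: R_def)
        then have "x y powr (- \<kappa>) \<le> J y / G + e" using G by (simp add: field_simps)
        also have "\<dots> \<le> J y / G + B" by (simp add: B_def)
        finally have "exp \<eta> * x y powr (- \<kappa>) \<le> exp \<eta> * (J y / G + B)" by (intro mult_left_mono) auto
        then show ?thesis using U[of y] True yC by linarith
      next
        case False
        define z where "z = nat \<lfloor>C * sqrt (real n)\<rfloor>"
        have z: "real z \<le> C * sqrt (real n)" "C * sqrt (real n) < real z + 1"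
          unfolding z_def using C0 by (auto simp: of_nat_nat)
        have z2: "C / 2 * sqrt (real n) \<le> real z" using z elim(2) by linarith
        moreover have "h * sqrt (real n) \<le> C / 2 * sqrt (real n)" using C by (intro mult_right_mono) auto
        ultimately have "h * sqrt (real n) \<le> real z" by linarith
        then have Uz: "M (isqrt n) / M z \<le> exp \<eta> * (x z) powr (- \<kappa>)"
          using U[of z] z(1) by blast
        have z1: "z \<ge> 1" using z2 elim(2) by linarith
        have zy: "z \<le> y" using False z by linarith
        have "(C / 2 * sqrt (real n))\<^sup>2 \<le> (real z)\<^sup>2" using z2 C0 by (intro power_mono) auto
        then have "C\<^sup>2 / 4 \<le> x z" using n by (simp add: x_def power_mult_distrib power_divide le_divide_eq)
        then have "x z powr (- \<kappa>) \<le> (C\<^sup>2 / 4) powr (- \<kappa>)" using C0 \<kappa> by (intro powr_mono2') auto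
        also have "\<dots> \<le> J y / G + B" using J0[of y] G e by (simp add: B_def)
        finally have "exp \<eta> * x z powr (- \<kappa>) \<le> exp \<eta> * (J y / G + B)" by (intro mult_left_mono) auto
        moreover have "M (isqrt n) / M y \<le> M (isqrt n) / M z"
          using scaleM_mono[OF zy] My Mp by (intro divide_left_mono mult_pos_pos scaleM_pos z1 y) auto
        ultimately show ?thesis using Uz by linarith
      qed
      then have "M (isqrt n) \<le> exp \<eta> * (J y / G + B) * M y"
        using My by (simp add: pos_divide_le_eq)
      then show ?thesis using True by (simp add: algebra_simps)
    qed
    have "killed_mean n (\<lambda>y. M (isqrt n) * (if h * sqrt (real n) \<le> real y then 1 else 0))
        \<le> killed_mean n (\<lambda>y. exp \<eta> * (1 / G * (M y * J y) + B * M y))"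
      using pt by (intro killed_mean_mono) auto
    then show ?case
      unfolding killed_mean_cmult killed_mean_add killed_mean_scaleM G_def[symmetric] B_def[symmetric]
      by (simp add: J_def x_def mult.commute)
  qed
  with that R show ?thesis by blast
qed

end

lemma div_quotient_tendsto:
  assumes N: "N > 0"
  shows "(\<lambda>n. real (n div N) / real n) \<longlonglongrightarrow> 1 / real N"
proof (rule real_tendsto_sandwich[where f = "\<lambda>n. 1 / real N - 1 / real n" and h = "\<lambda>_. 1 / real N"])
  show "eventually (\<lambda>n. 1 / real N - 1 / real n \<le> real (n div N) / real n) sequentially"
    using eventually_gt_at_top[of 0]
  proof eventually_elim
    case (elim n)
    have "n < N * (n div N) + N" using dividend_less_times_div[of N n] N by (simp add: add.commute)
    then have "real n \<le> real N * real (n div N) + real N" by (metis less_imp_le of_nat_add of_nat_le_iff of_nat_mult)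
    then have "real n / real N - 1 \<le> real (n div N)" using N by (simp add: field_simps)
    then have "(real n / real N - 1) / real n \<le> real (n div N) / real n" by (intro divide_right_mono) auto
    then show ?case using elim by (simp add: diff_divide_distrib)
  qed
  show "eventually (\<lambda>n. real (n div N) / real n \<le> 1 / real N) sequentially"
    using eventually_gt_at_top[of 0]
  proof eventually_elim
    case (elim n)
    have "n div N * N \<le> n" by (rule div_times_less_eq_dividend)
    then have "real (n div N) * real N \<le> real n" by (metis of_nat_le_iff of_nat_mult)
    then show ?case using elim N by (simp add: field_simps)
  qed
  show "(\<lambda>n. 1 / real N - 1 / real n) \<longlonglongrightarrow> 1 / real N"
    using tendsto_diff[OF tendsto_const lim_const_over_n[of 1], of "1 / real N"] by simp
qed auto

section \<open>Survival for positive \<kappa>\<close>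

context recurrent_bessel_walk
begin

text \<open>The moment of order -\<kappa> of the Gamma law with shape \<kappa> + 1 and scale 2; it
  equals 1 for \<kappa> = 0.\<close>

definition tail_const :: real where
  "tail_const = 2 powr (- \<kappa>) / Gamma (\<kappa> + 1)"

lemma tail_const_pos: "tail_const > 0"
  unfolding tail_const_def using \<kappa>_nonneg by (intro divide_pos_pos Gamma_real_pos) auto

lemma survival_lower:
  assumes \<kappa>: "\<kappa> > 0" and z: "z < tail_const"
  shows "eventually (\<lambda>n. z < survival n * M (isqrt n)) sequentially"
proof -
  define G where "G = Gamma (\<kappa> + 1)"
  have G: "G > 0" unfolding G_def using \<kappa> by (intro Gamma_real_pos) auto
  define l where "l R = trunc_limit R" for R
  have "(\<lambda>N. l (real N powr \<kappa>) / G) \<longlonglongrightarrow> tail_const"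
    unfolding tail_const_def G_def[symmetric] l_def
    by (intro tendsto_divide trunc_power_mean_limit \<kappa> tendsto_const) (use G in auto)
  from tendsto_obtain_greater[OF this z]
  obtain N0 where N0: "N0 \<ge> 1" "z < l (real N0 powr \<kappa>) / G" .
  define R where "R = real N0 powr \<kappa>"
  have R: "R > 0" using N0 by (simp add: R_def)
  \<comment> \<open>With R fixed, a single N supplies both parameters of
    \<open>survival_lower_aux\<close>: \<open>C = N\<close> and
    \<open>\<eta> = 1 / N\<close>.\<close>
  have "(\<lambda>N. exp (- (1 / real N)) * (l R / G - ((real N)\<^sup>2) powr (- \<kappa>))) \<longlonglongrightarrow> exp (- 0) * (l R / G - 0)"
  proof -
    have "(\<lambda>N. 1 / real N) \<longlonglongrightarrow> 0" by real_asymp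
    moreover have "(\<lambda>N. ((real N)\<^sup>2) powr (- \<kappa>)) \<longlonglongrightarrow> 0" using \<kappa> by real_asymp
    ultimately show ?thesis
      by (intro tendsto_mult tendsto_exp tendsto_minus tendsto_diff tendsto_const)
  qed
  then obtain N where N: "N \<ge> 1" "z < exp (- (1 / real N)) * (l R / G - ((real N)\<^sup>2) powr (- \<kappa>))"
    by (rule tendsto_obtain_greater) (use N0 in \<open>auto simp: R_def\<close>)
  have "(\<lambda>n. exp (- (1 / real N)) * (trunc_mean R n / G
      - ((real N)\<^sup>2) powr (- \<kappa>))) \<longlonglongrightarrow> exp (- (1 / real N)) * (l R / G - ((real N)\<^sup>2) powr (- \<kappa>))"
    unfolding l_def by (intro tendsto_intros trunc_power_mean_tendsto \<kappa> R) (use G in auto)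
  from order_tendstoD(1)[OF this N(2)]
    survival_lower_aux[OF \<kappa> R, of "real N" "1 / real N", folded G_def]
  show ?thesis using N(1) by (auto elim: eventually_elim2)
qed

text \<open>Here the cutoff R is chosen after N and depends on it. This is harmless because
  \<open>trunc_limit R\<close> is at most \<open>2 powr - \<kappa>\<close> for every R.\<close>

lemma large_upper:
  assumes \<kappa>: "\<kappa> > 0" and h: "h > 0" and z: "z > tail_const"
  shows "eventually (\<lambda>n. large_mean h n * M (isqrt n) < z) sequentially"
proof -
  define G where "G = Gamma (\<kappa> + 1)"
  have G: "G > 0" unfolding G_def using \<kappa> by (intro Gamma_real_pos) auto
  define l where "l R = trunc_limit R" for R
  have "(\<lambda>N. exp (1 / real N) * (tail_const + (1 / real N + ((real N)\<^sup>2 / 4) powr (- \<kappa>)))) \<longlonglongrightarrow> exp 0 * (tail_const + (0 + 0))"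
  proof -
    have "(\<lambda>N. 1 / real N) \<longlonglongrightarrow> 0" by real_asymp
    moreover have "(\<lambda>N. ((real N)\<^sup>2 / 4) powr (- \<kappa>)) \<longlonglongrightarrow> 0" using \<kappa> by real_asymp
    ultimately show ?thesis
      by (intro tendsto_mult tendsto_exp tendsto_add tendsto_const)
  qed
  then obtain N where "N \<ge> nat \<lceil>max (2 * h) 1\<rceil>"
      and N: "exp (1 / real N) * (tail_const + (1 / real N + ((real N)\<^sup>2 / 4) powr (- \<kappa>))) < z"
    by (rule tendsto_obtain_less) (use z in simp)
  then have "real N \<ge> max (2 * h) 1" by linarith
  then have N': "real N \<ge> 2 * h" "1 / real N > 0" by auto
  obtain R where R: "R > 0" and ev: "eventually (\<lambda>n. large_mean h n * M (isqrt n)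
     \<le> exp (1 / real N) * (trunc_mean R n / G
      + (1 / real N + ((real N)\<^sup>2 / 4) powr (- \<kappa>)))) sequentially"
    using large_upper_aux[OF \<kappa> h N'(1) N'(2) N'(2)] unfolding G_def by blast
  have "l R \<le> 2 powr (- \<kappa>)" unfolding l_def by (rule trunc_power_mean_limit_le[OF \<kappa> R])
  then have "l R / G \<le> tail_const"
    unfolding tail_const_def G_def[symmetric] using G by (intro divide_right_mono) auto
  then have "exp (1 / real N) * (l R / G + (1 / real N + ((real N)\<^sup>2 / 4) powr (- \<kappa>)))
     \<le> exp (1 / real N) * (tail_const + (1 / real N + ((real N)\<^sup>2 / 4) powr (- \<kappa>)))"
    by (intro mult_left_mono) auto
  with N have lz: "exp (1 / real N) * (l R / G + (1 / real N + ((real N)\<^sup>2 / 4) powr (- \<kappa>))) < z" by linarith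
  have "(\<lambda>n. exp (1 / real N) * (trunc_mean R n / G
      + (1 / real N + ((real N)\<^sup>2 / 4) powr (- \<kappa>)))) \<longlonglongrightarrow> exp (1 / real N) * (l R / G + (1 / real N + ((real N)\<^sup>2 / 4) powr (- \<kappa>)))"
    unfolding l_def by (intro tendsto_intros trunc_power_mean_tendsto \<kappa> R) (use G in auto)
  from order_tendstoD(2)[OF this lz] ev show ?thesis
    by eventually_elim linarith
qed

text \<open>\<open>conduct z * M z / z\<close> is the reciprocal of
  \<open>p z * (z * lam p z / M z)\<close>, which tends to \<kappa>. Positivity of \<kappa> is
  essential: for \<kappa> = 0 this quotient tends to infinity.\<close>

lemma conduct_scaleM_bound:
  assumes \<kappa>: "\<kappa> > 0"
  obtains C where "C > 0" "\<And>H. (\<Sum>z=1..H. conduct z * M z) \<le> C * (real H)\<^sup>2"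
proof -
  have "(\<lambda>z. 1 / (p z * (real z * lam p z / M z))) \<longlonglongrightarrow> 1 / ((1 / 2) * (2 * \<kappa>))"
    by (intro tendsto_intros p_tendsto scale_quotient) (use \<kappa> in auto)
  then have "Bseq (\<lambda>z. 1 / (p z * (real z * lam p z / M z)))"
    by (intro convergent_imp_Bseq) (auto simp: convergent_def)
  then obtain C where C: "C > 0" "\<And>z. \<bar>1 / (p z * (real z * lam p z / M z))\<bar> \<le> C"
    by (auto simp: Bseq_def)
  have b: "conduct z * M z \<le> C * real z" if z: "z \<ge> 1" for z
  proof -
    have "conduct z * M z = 1 / (p z * (real z * lam p z / M z)) * real z"
      using p_pos[OF z] lam_pos[of z] scaleM_pos[OF z] z by (simp add: conduct_def)
    also have "\<dots> \<le> C * real z" using order_trans[OF abs_ge_self C(2)] by (intro mult_right_mono) auto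
    finally show ?thesis .
  qed
  have "(\<Sum>z=1..H. conduct z * M z) \<le> C * (real H)\<^sup>2" for H
  proof -
    have "(\<Sum>z=1..H. conduct z * M z) \<le> (\<Sum>z=1..H. C * real H)"
      using C(1) by (intro sum_mono order_trans[OF b]) auto
    then show ?thesis by (simp add: power2_eq_square mult.left_commute)
  qed
  with C(1) that show ?thesis by blast
qed

text \<open>\<open>survival n\<close> is at most its average over a time window before \<open>n\<close>. There the walk is rarely below
  \<open>h * sqrt n\<close>, since the expected total time spent there by a survivor is \<open>O(h\<^sup>2 n)\<close>.\<close>
lemma survival_recursion:
  assumes \<kappa>: "\<kappa> > 0" and \<rho>: "\<rho> > 0" and z: "z > tail_const"
  shows "eventually (\<lambda>n. \<exists>a<n. survival n * M (isqrt n) \<le> \<rho> * (survival a * M (isqrt a)) + z) sequentially"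
proof -
  obtain C where C: "C > 0" "\<And>H. (\<Sum>z=1..H. conduct z * M z) \<le> C * (real H)\<^sup>2"
    using conduct_scaleM_bound[OF \<kappa>] by blast
  define z1 where "z1 = (z + tail_const) / 2"
  have z1: "z1 > tail_const" "z1 < z" "z1 > 0" using z tail_const_pos by (auto simp: z1_def)
  \<comment> \<open>q bounds the growth of \<open>M (isqrt n)\<close> across the window: the entry 2
    is absorbed by the halved coefficient \<rho> / 2, and \<open>z1 * q \<le> z\<close> absorbs the
    rest.\<close>
  define q where "q = min 2 (z / z1)"
  have q: "q > 1" "q \<le> 2" "z1 * q \<le> z" using z1 by (auto simp: q_def min_mult_distrib_left)
  have "(\<lambda>N. (1 / (1 - 1 / real N)) powr \<kappa>) \<longlonglongrightarrow> 1 powr \<kappa>"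
  proof -
    have "(\<lambda>N. 1 / (1 - 1 / real N)) \<longlonglongrightarrow> 1" by real_asymp
    then show ?thesis by (intro tendsto_powr tendsto_const) auto
  qed
  then obtain N where N: "N \<ge> 2" "(1 / (1 - 1 / real N)) powr \<kappa> < q"
    by (rule tendsto_obtain_less) (use q in auto)
  \<comment> \<open>With this h the occupation bound \<open>C * (h * sqrt n)^2\<close> equals
    \<open>\<rho> * n / (4 * N)\<close>, at most \<rho> / 2 times the window length d, since
    \<open>n \<le> 2 * N * d\<close>.\<close>
  define h where "h = sqrt (\<rho> / (4 * C * real N))"
  have h: "h > 0" using \<rho> C N by (simp add: h_def)
  have h2: "h\<^sup>2 = \<rho> / (4 * C * real N)" using \<rho> C N by (simp add: h_def)
  define a where "a n = n - n div N" for n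
  have "(\<lambda>n. real n / real (a n)) \<longlonglongrightarrow> 1 / (1 - 1 / real N)"
  proof -
    have "(\<lambda>n. real (n div N) / real n) \<longlonglongrightarrow> 1 / real N" using N(1) by (intro div_quotient_tendsto) simp
    then have "(\<lambda>n. 1 / (1 - real (n div N) / real n)) \<longlonglongrightarrow> 1 / (1 - 1 / real N)"
      by (rule tendsto_divide[OF tendsto_const tendsto_diff[OF tendsto_const]]) (use N(1) in auto)
    moreover have "eventually (\<lambda>n. 1 / (1 - real (n div N) / real n) = real n / real (a n)) sequentially"
      using eventually_gt_at_top[of 0]
    proof eventually_elim
      case (elim n)
      have "n div N < n" using elim N(1) by (intro div_less_dividend) auto
      then show ?case using elim by (simp add: a_def of_nat_diff field_simps)
    qed
    ultimately show ?thesis by (auto intro: Lim_transform_eventually)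
  qed
  moreover have a_top: "filterlim a at_top sequentially"
  proof (rule filterlim_at_top_mono[where f = "\<lambda>n. n div 2"])
    show "filterlim (\<lambda>n::nat. n div 2) at_top sequentially"
      by (rule filterlim_at_top_div_const_nat) simp
    have "n div 2 \<le> a n" for n
    proof -
      have "n div N \<le> n div 2" using N(1) by (intro div_le_mono2) auto
      then show ?thesis unfolding a_def by linarith
    qed
    then show "eventually (\<lambda>n. n div 2 \<le> a n) sequentially" by simp
  qed
  ultimately have "(\<lambda>n. M (isqrt n) / M (isqrt (a n))) \<longlonglongrightarrow> (1 / (1 - 1 / real N)) powr \<kappa>"
    using N(1) by (intro scaleM_isqrt_ratio filterlim_ident) auto
  from order_tendstoD(2)[OF this N(2)]
  have ratio: "eventually (\<lambda>n. M (isqrt n) / M (isqrt (a n)) < q) sequentially" .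
  obtain K where K: "\<And>k. k \<ge> K \<Longrightarrow> large_mean h k * M (isqrt k) < z1"
    using large_upper[OF \<kappa> h z1(1)] by (auto simp: eventually_sequentially)
  have "eventually (\<lambda>n. a n \<ge> max K 1) sequentially"
    using a_top unfolding filterlim_at_top by blast
  with ratio show ?thesis using eventually_ge_at_top[of "N * 2"]
  proof eventually_elim
    case (elim n)
    define A where "A = a n"
    define d where "d = n div N"
    have d1: "d \<ge> 1" using elim(3) N(1) by (simp add: d_def div_greater_zero_iff Suc_le_eq)
    have d2: "real n \<le> 2 * real N * real d"
    proof -
      have "n < N * d + N" unfolding d_def using dividend_less_times_div[of N n] N(1) by (simp add: add.commute)
      also have "\<dots> \<le> N * d + N * d" using d1 by simp
      finally have "n \<le> 2 * N * d" by simp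
      then show ?thesis by (metis of_nat_le_iff of_nat_mult of_nat_numeral)
    qed
    have An: "A < n" "n - A = d" using d1 elim(2) by (auto simp: A_def a_def d_def)
    have A1: "A \<ge> 1" "A \<ge> K" using elim(2) by (auto simp: A_def)
    have isq1: "isqrt k \<ge> 1" if "k \<ge> 1" for k
    proof -
      have "isqrt 1 \<le> isqrt k" using that by (rule isqrt_mono)
      then show ?thesis by (simp add: isqrt_def)
    qed
    define Mn where "Mn = M (isqrt n)"
    define MA where "MA = M (isqrt A)"
    have M: "Mn > 0" "MA > 0" using isq1 A1 An scaleM_pos by (auto simp: Mn_def MA_def)
    have MnA: "Mn < q * MA" using elim(1) M by (simp add: Mn_def MA_def A_def pos_divide_less_eq)
    define H where "H = nat \<lfloor>h * sqrt (real n)\<rfloor>"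
    have H: "real H \<le> h * sqrt (real n)" "h * sqrt (real n) < real H + 1"
      unfolding H_def using h by (auto simp: of_nat_nat)
    have "real d * survival n = (\<Sum>k\<in>{A..<n}. survival n)" using An by simp
    also have "\<dots> \<le> (\<Sum>k\<in>{A..<n}. small_mean H k + z1 / MA)"
    proof (rule sum_mono)
      fix k assume k: "k \<in> {A..<n}"
      have Mk: "M (isqrt k) > 0" using k A1 by (intro scaleM_pos isq1) auto
      have "survival n \<le> survival k" using k by (intro antimonoD[OF survival_antimono]) auto
      also have "\<dots> \<le> killed_mean k (\<lambda>x. (if x \<le> H then 1 else 0) + (if h * sqrt (real k) \<le> real x then 1 else 0))"
        unfolding survival_eq
      proof (intro killed_mean_mono)
        fix x :: nat
        have "h * sqrt (real k) \<le> real x" if "\<not> x \<le> H"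
        proof -
          have "h * sqrt (real k) \<le> h * sqrt (real n)" using k h by (intro mult_left_mono) auto
          also have "\<dots> \<le> real x" using H(2) that by linarith
          finally show ?thesis .
        qed
        then show "1 \<le> (if x \<le> H then 1 else 0) + (if h * sqrt (real k) \<le> real x then 1 else (0::real))" by auto
      qed
      also have "\<dots> = small_mean H k + large_mean h k"
        by (rule killed_mean_add)
      also have "large_mean h k \<le> z1 / M (isqrt k)"
        using K[of k] k A1 Mk by (simp add: pos_le_divide_eq)
      also have "z1 / M (isqrt k) \<le> z1 / MA"
        using z1 k M Mk unfolding MA_def by (intro divide_left_mono scaleM_mono isqrt_mono mult_pos_pos) (auto simp: MA_def)
      finally show "survival n \<le> small_mean H k + z1 / MA" by simp
    qed
    also have "\<dots> = (\<Sum>k\<in>{A..<n}. small_mean H k) + real d * (z1 / MA)"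
      using An by (simp add: sum.distrib)
    also have "(\<Sum>k\<in>{A..<n}. small_mean H k) \<le> survival A * (\<Sum>z=1..H. conduct z * M z)"
      by (rule window_occupation)
    also have "\<dots> \<le> survival A * (C * (real H)\<^sup>2)"
      using C(2) survival_nonneg by (intro mult_left_mono)
    also have "\<dots> \<le> survival A * (\<rho> / 2 * real d)"
    proof (intro mult_left_mono survival_nonneg)
      have "(real H)\<^sup>2 \<le> (h * sqrt (real n))\<^sup>2" using H(1) by (intro power_mono) auto
      also have "\<dots> = \<rho> / (4 * C * real N) * real n" by (simp add: power_mult_distrib h2)
      also have "\<dots> \<le> \<rho> / (4 * C * real N) * (2 * real N * real d)"
        using d2 \<rho> C by (intro mult_left_mono) auto
      also have "\<dots> = \<rho> / 2 * real d / C" using C N(1) by (simp add: field_simps)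
      finally show "C * (real H)\<^sup>2 \<le> \<rho> / 2 * real d" using C by (simp add: field_simps)
    qed
    finally have "real d * survival n \<le> real d * (survival A * (\<rho> / 2) + z1 / MA)"
      by (simp add: algebra_simps)
    then have s: "survival n \<le> survival A * (\<rho> / 2) + z1 / MA" using d1 by simp
    have "survival n * Mn \<le> (survival A * (\<rho> / 2) + z1 / MA) * Mn"
      using s M by (intro mult_right_mono) auto
    also have "\<dots> \<le> (survival A * (\<rho> / 2) + z1 / MA) * (q * MA)"
      using MnA M z1 \<rho> survival_nonneg[of A] by (intro mult_left_mono) auto
    also have "\<dots> = q / 2 * (\<rho> * (survival A * MA)) + z1 * q" using M by (simp add: field_simps)
    also have "q / 2 * (\<rho> * (survival A * MA)) \<le> 1 * (\<rho> * (survival A * MA))"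
      using q M \<rho> survival_nonneg[of A] by (intro mult_right_mono) auto
    finally have "survival n * Mn \<le> \<rho> * (survival A * MA) + z" using q by simp
    then show ?case using An unfolding Mn_def MA_def by blast
  qed
qed

lemma survival_asymp_pos:
  assumes \<kappa>: "\<kappa> > 0"
  shows "(\<lambda>n. survival n * M (isqrt n)) \<longlonglongrightarrow> tail_const"
proof (rule order_tendstoI)
  show "eventually (\<lambda>n. z < survival n * M (isqrt n)) sequentially" if "z < tail_const" for z
    using survival_lower[OF \<kappa> that] .
  show "eventually (\<lambda>n. survival n * M (isqrt n) < z) sequentially" if "z > tail_const" for z
  proof (rule contraction_limsup[OF _ _ _ that])
    show "survival n * M (isqrt n) \<ge> 0" for n
      using survival_nonneg scaleM_mono[of 0] by simp
  qed (use tail_const_pos survival_recursion[OF \<kappa>] in auto)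
qed

end

section \<open>Monotone densities and the critical case\<close>

text \<open>As g decreases, with \<open>d = m div N\<close> the quantity \<open>d * g m\<close> lies
  between the drop of U over \<open>[m, m + d]\<close> and the drop over \<open>[m - d, m]\<close>.
  The resulting limits \<open>N * (1 - (1 + 1/N) powr - \<kappa>)\<close> and
  \<open>N * ((1 - 1/N) powr - \<kappa> - 1)\<close> both tend to \<kappa> as N grows.\<close>

lemma monotone_density:
  fixes U g :: "nat \<Rightarrow> real"
  assumes U: "\<And>m. U m > 0" and g: "\<And>m. U m - U (Suc m) = g m" and mono: "\<And>m. g (Suc m) \<le> g m"
    and index: "\<And>i a. filterlim i at_top sequentially \<Longrightarrow> a > 0 \<Longrightarrow>
      (\<lambda>m. real (i m) / real m) \<longlonglongrightarrow> a \<Longrightarrow> (\<lambda>m. U (i m) / U m) \<longlonglongrightarrow> a powr (- \<kappa>)"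
  shows "(\<lambda>m. real m * g m / U m) \<longlonglongrightarrow> \<kappa>"
proof (rule order_tendstoI)
  have anti: "g j \<le> g i" if "i \<le> j" for i j
    using mono that by (rule lift_Suc_antimono_le)
  have tele: "U a - U b = (\<Sum>j\<in>{a..<b}. g j)" if "a \<le> b" for a b
    using that by (induction b rule: dec_induct) (auto simp: g[symmetric])
  have quot: "(\<lambda>m. real m / real (m div N)) \<longlonglongrightarrow> real N" if "N > 0" for N
  proof -
    have "(\<lambda>m. inverse (real (m div N) / real m)) \<longlonglongrightarrow> inverse (1 / real N)"
      using that by (intro tendsto_inverse div_quotient_tendsto) auto
    then show ?thesis by simp
  qed
  fix z
  { assume z: "z < \<kappa>"
    have "(\<lambda>N. real N * (1 - (1 + 1 / real N) powr (- \<kappa>))) \<longlonglongrightarrow> \<kappa>" by real_asymp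
    then obtain N where N: "N \<ge> 1" "z < real N * (1 - (1 + 1 / real N) powr (- \<kappa>))"
      using z by (rule tendsto_obtain_greater)
    have "(\<lambda>m. 1 + real (m div N) / real m) \<longlonglongrightarrow> 1 + 1 / real N"
      using N(1) by (intro tendsto_add tendsto_const div_quotient_tendsto) auto
    moreover have "eventually (\<lambda>m. 1 + real (m div N) / real m = real (m + m div N) / real m) sequentially"
      using eventually_gt_at_top[of 0] by eventually_elim (simp add: field_simps)
    ultimately have "(\<lambda>m. real (m + m div N) / real m) \<longlonglongrightarrow> 1 + 1 / real N"
      by (rule Lim_transform_eventually)
    moreover have "filterlim (\<lambda>m. m + m div N) at_top sequentially"
      by (rule filterlim_at_top_mono[OF filterlim_ident]) simp
    ultimately have "(\<lambda>m. U (m + m div N) / U m) \<longlonglongrightarrow> (1 + 1 / real N) powr (- \<kappa>)"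
      by (intro index) (auto simp: add_pos_nonneg)
    then have "(\<lambda>m. real m / real (m div N) * (1 - U (m + m div N) / U m)) \<longlonglongrightarrow> real N * (1 - (1 + 1 / real N) powr (- \<kappa>))"
      using N(1) by (intro tendsto_mult tendsto_diff tendsto_const quot) auto
    from order_tendstoD(1)[OF this N(2)]
    show "eventually (\<lambda>m. z < real m * g m / U m) sequentially"
      using eventually_ge_at_top[of N]
    proof eventually_elim
      case (elim m)
      define d where "d = m div N"
      have d: "d > 0" using elim N(1) by (simp add: d_def div_greater_zero_iff)
      have "U m - U (m + d) \<le> (\<Sum>j\<in>{m..<m + d}. g m)"
        unfolding tele[OF le_add1] by (intro sum_mono anti) auto
      also have "\<dots> = real d * g m" by simp
      finally have "(U m - U (m + d)) / U m \<le> real d * g m / U m"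
        using U[of m] by (intro divide_right_mono) auto
      then have "1 - U (m + d) / U m \<le> real d * g m / U m" using U[of m] by (simp add: diff_divide_distrib)
      then have "real m / real d * (1 - U (m + d) / U m) \<le> real m / real d * (real d * g m / U m)"
        by (intro mult_left_mono) auto
      also have "\<dots> = real m * g m / U m" using d by simp
      finally show ?case using elim(1) unfolding d_def[symmetric] by linarith
    qed
  }
  { assume z: "z > \<kappa>"
    have "(\<lambda>N. real N * ((1 - 1 / real N) powr (- \<kappa>) - 1)) \<longlonglongrightarrow> \<kappa>" by real_asymp
    then obtain N where N: "N \<ge> 2" "real N * ((1 - 1 / real N) powr (- \<kappa>) - 1) < z"
      using z by (rule tendsto_obtain_less)
    have "(\<lambda>m. 1 - real (m div N) / real m) \<longlonglongrightarrow> 1 - 1 / real N"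
      using N(1) by (intro tendsto_diff tendsto_const div_quotient_tendsto) auto
    moreover have "eventually (\<lambda>m. 1 - real (m div N) / real m = real (m - m div N) / real m) sequentially"
      using eventually_gt_at_top[of 0] by eventually_elim (simp add: field_simps of_nat_diff)
    ultimately have "(\<lambda>m. real (m - m div N) / real m) \<longlonglongrightarrow> 1 - 1 / real N"
      by (rule Lim_transform_eventually)
    moreover have "filterlim (\<lambda>m. m - m div N) at_top sequentially"
    proof (rule filterlim_at_top_mono[where f = "\<lambda>n. n div 2"])
      show "filterlim (\<lambda>n::nat. n div 2) at_top sequentially"
        by (rule filterlim_at_top_div_const_nat) simp
      have "m div 2 \<le> m - m div N" for m
      proof -
        have "m div N \<le> m div 2" using N(1) by (intro div_le_mono2) auto
        then show ?thesis by linarith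
      qed
      then show "eventually (\<lambda>m. m div 2 \<le> m - m div N) sequentially" by simp
    qed
    ultimately have "(\<lambda>m. U (m - m div N) / U m) \<longlonglongrightarrow> (1 - 1 / real N) powr (- \<kappa>)"
      using N(1) by (intro index) auto
    then have "(\<lambda>m. real m / real (m div N) * (U (m - m div N) / U m - 1)) \<longlonglongrightarrow> real N * ((1 - 1 / real N) powr (- \<kappa>) - 1)"
      using N(1) by (intro tendsto_mult tendsto_diff tendsto_const quot) auto
    from order_tendstoD(2)[OF this N(2)]
    show "eventually (\<lambda>m. real m * g m / U m < z) sequentially"
      using eventually_ge_at_top[of N]
    proof eventually_elim
      case (elim m)
      define d where "d = m div N"
      have d: "d > 0" using elim N(1) by (simp add: d_def div_greater_zero_iff)
      have dm: "d \<le> m" by (simp add: d_def)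
      have "real d * g m = (\<Sum>j\<in>{m - d..<m}. g m)" using dm by simp
      also have "\<dots> \<le> U (m - d) - U m"
        unfolding tele[OF diff_le_self] by (intro sum_mono anti) auto
      finally have "real d * g m / U m \<le> (U (m - d) - U m) / U m"
        using U[of m] by (intro divide_right_mono) auto
      then have "real d * g m / U m \<le> U (m - d) / U m - 1" using U[of m] by (simp add: diff_divide_distrib)
      then have "real m / real d * (real d * g m / U m) \<le> real m / real d * (U (m - d) / U m - 1)"
        by (intro mult_left_mono) auto
      also have "real m / real d * (real d * g m / U m) = real m * g m / U m" using d by simp
      finally show ?case using elim(1) unfolding d_def[symmetric] by linarith
    qed
  }
qed

text \<open>For the block between consecutive squares, on which \<open>isqrt\<close> is constant and
  whose length is 2k + 1.\<close>

lemma card_even_interval: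
  fixes a k :: nat
  shows "k \<le> card {l \<in> {a..<a + (2 * k + 1)}. even l}" "card {l \<in> {a..<a + (2 * k + 1)}. even l} \<le> k + 1"
proof -
  define E where "E b = {l \<in> {..<b}. even l}" for b :: nat
  have fin: "finite (E b)" for b by (simp add: E_def)
  have *: "card (E b) = (b + 1) div 2" for b
  proof (induction b)
    case (Suc b)
    have "E (Suc b) = (if even b then insert b (E b) else E b)" "b \<notin> E b"
      by (auto simp: E_def less_Suc_eq)
    then show ?case using Suc fin[of b] by (auto elim!: evenE oddE)
  qed (simp add: E_def)
  have "{l \<in> {a..<a + (2 * k + 1)}. even l} = E (a + (2 * k + 1)) - E a"
    by (auto simp: E_def)
  moreover have "card (E (a + (2 * k + 1)) - E a) = card (E (a + (2 * k + 1))) - card (E a)"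
    by (intro card_Diff_subset fin) (auto simp: E_def)
  ultimately have "card {l \<in> {a..<a + (2 * k + 1)}. even l} = (a + (2 * k + 1) + 1) div 2 - (a + 1) div 2"
    by (simp only: *)
  moreover have "(a + (2 * k + 1) + 1) div 2 = k + 1 + a div 2" by simp
  moreover have "a div 2 \<le> (a + 1) div 2" "(a + 1) div 2 \<le> a div 2 + 1" by auto
  ultimately show "k \<le> card {l \<in> {a..<a + (2 * k + 1)}. even l}" "card {l \<in> {a..<a + (2 * k + 1)}. even l} \<le> k + 1"
    by linarith+
qed

section \<open>The slowly varying factor\<close>

lemma Lnat_pos: "Lnat \<delta> p n > 0" by (simp add: Lnat_def)

lemma Lfun_of_nat: "Lfun \<delta> p (real n) = Lnat \<delta> p n"
  by (simp add: Lfun_def)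

lemma Lfun_sqrt_bounds:
  "min (Lnat \<delta> p (isqrt n)) (Lnat \<delta> p (Suc (isqrt n))) \<le> Lfun \<delta> p (sqrt (real n))"
  "Lfun \<delta> p (sqrt (real n)) \<le> max (Lnat \<delta> p (isqrt n)) (Lnat \<delta> p (Suc (isqrt n)))"
proof -
  define t where "t = sqrt (real n) - real (isqrt n)"
  have t: "0 \<le> t" "t \<le> 1" using isqrt_bounds[of n] by (auto simp: t_def)
  define a b where "a = Lnat \<delta> p (isqrt n)" and "b = Lnat \<delta> p (Suc (isqrt n))"
  have L: "Lfun \<delta> p (sqrt (real n)) = (1 - t) * a + t * b"
    by (simp add: Lfun_def Let_def isqrt_def[symmetric] t_def a_def b_def algebra_simps)
  have "(1 - t) * min a b + t * min a b \<le> (1 - t) * a + t * b"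
    using t by (intro add_mono mult_left_mono) auto
  moreover have "(1 - t) * a + t * b \<le> (1 - t) * max a b + t * max a b"
    using t by (intro add_mono mult_left_mono) auto
  ultimately show "min (Lnat \<delta> p (isqrt n)) (Lnat \<delta> p (Suc (isqrt n))) \<le> Lfun \<delta> p (sqrt (real n))"
    "Lfun \<delta> p (sqrt (real n)) \<le> max (Lnat \<delta> p (isqrt n)) (Lnat \<delta> p (Suc (isqrt n)))"
    unfolding L a_def[symmetric] b_def[symmetric] by (simp_all add: algebra_simps)
qed

context bessel_walk
begin

lemma Lnat_ratio_tendsto: "(\<lambda>n. Lnat \<delta> p (Suc n) / Lnat \<delta> p n) \<longlonglongrightarrow> 1"
proof -
  have "(\<lambda>x. real x * Rterm \<delta> p x * (1 / real x)) \<longlonglongrightarrow> 0 * 0"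
    by (intro tendsto_mult R_small) real_asymp
  moreover have "eventually (\<lambda>x. real x * Rterm \<delta> p x * (1 / real x) = Rterm \<delta> p x) sequentially"
    using eventually_gt_at_top[of 0] by eventually_elim simp
  ultimately have "Rterm \<delta> p \<longlonglongrightarrow> 0" by (auto intro: Lim_transform_eventually)
  then have "(\<lambda>n. exp (Rterm \<delta> p (Suc n))) \<longlonglongrightarrow> exp 0" by (intro tendsto_exp LIMSEQ_Suc)
  then show ?thesis by (simp add: Lnat_def exp_add)
qed

lemma Lfun_sqrt_tendsto: "(\<lambda>n. Lfun \<delta> p (sqrt (real n)) / Lnat \<delta> p (isqrt n)) \<longlonglongrightarrow> 1"
proof (rule real_tendsto_sandwich)
  define r where "r n = Lnat \<delta> p (Suc (isqrt n)) / Lnat \<delta> p (isqrt n)" for n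
  have r: "r \<longlonglongrightarrow> 1" unfolding r_def by (rule filterlim_compose[OF Lnat_ratio_tendsto isqrt_at_top])
  show "(\<lambda>n. min 1 (r n)) \<longlonglongrightarrow> 1" using tendsto_min[OF tendsto_const r, of 1] by simp
  show "(\<lambda>n. max 1 (r n)) \<longlonglongrightarrow> 1" using tendsto_max[OF tendsto_const r, of 1] by simp
  have "min 1 (r n) \<le> Lfun \<delta> p (sqrt (real n)) / Lnat \<delta> p (isqrt n) \<and>
     Lfun \<delta> p (sqrt (real n)) / Lnat \<delta> p (isqrt n) \<le> max 1 (r n)" for n
    using Lfun_sqrt_bounds[of \<delta> p n] Lnat_pos[of \<delta> p "isqrt n"]
    by (auto simp: r_def min_def max_def divide_simps split: if_splits)
  then show "eventually (\<lambda>n. min 1 (r n) \<le> Lfun \<delta> p (sqrt (real n)) / Lnat \<delta> p (isqrt n)) sequentially"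
    "eventually (\<lambda>n. Lfun \<delta> p (sqrt (real n)) / Lnat \<delta> p (isqrt n) \<le> max 1 (r n)) sequentially"
    by auto
qed

end

section \<open>The critical case \<kappa> = 0\<close>

context recurrent_bessel_walk
begin

text \<open>Markov's inequality for \<open>1 - exp (- s * Y_n^2 / n)\<close>, which is at least
  \<open>1 - exp (- s * B^2)\<close> once Y exceeds \<open>B * sqrt n\<close>. It bounds from below
  the mass that Y puts below that level.\<close>

lemma laplace_large:
  assumes s: "s > 0" and B: "B > 0" and n: "n > 0"
  shows "1 - (1 - laplace n (s / real n)) / (1 - exp (- (s * B\<^sup>2)))
    \<le> killed_mean n (\<lambda>y. M y * (if real y \<le> B * sqrt (real n) then 1 else 0))"
proof -
  define c where "c = 1 - exp (- (s * B\<^sup>2))"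
  have c: "c > 0" using s B by (simp add: c_def)
  have "killed_mean n (\<lambda>y. M y - 1 / c * (M y - M y * exp (- (s / real n) * (real y)\<^sup>2)))
      \<le> killed_mean n (\<lambda>y. M y * (if real y \<le> B * sqrt (real n) then 1 else 0))"
  proof (intro killed_mean_mono)
    fix y :: nat assume y: "y \<ge> 1" "y \<le> Suc n"
    have M: "M y > 0" using scaleM_pos y by simp
    define e where "e = exp (- (s / real n) * (real y)\<^sup>2)"
    have e: "e \<le> 1" using s by (simp add: e_def)
    have "1 - 1 / c * (1 - e) \<le> (if real y \<le> B * sqrt (real n) then 1 else 0)"
    proof (cases "real y \<le> B * sqrt (real n)")
      case True then show ?thesis using e c by simp
    next
      case False
      have "(B * sqrt (real n))\<^sup>2 \<le> (real y)\<^sup>2" using False B by (intro power_mono) auto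
      then have "B\<^sup>2 \<le> (real y)\<^sup>2 / real n" using n by (simp add: power_mult_distrib le_divide_eq)
      then have "s * B\<^sup>2 \<le> s * ((real y)\<^sup>2 / real n)" using s by (intro mult_left_mono) auto
      then have "e \<le> exp (- (s * B\<^sup>2))" by (simp add: e_def)
      then have "c \<le> 1 - e" by (simp add: c_def)
      then show ?thesis using False c by (simp add: field_simps)
    qed
    then have "M y * (1 - 1 / c * (1 - e)) \<le> M y * (if real y \<le> B * sqrt (real n) then 1 else 0)"
      using M by (intro mult_left_mono) auto
    then show "M y - 1 / c * (M y - M y * exp (- (s / real n) * (real y)\<^sup>2))
      \<le> M y * (if real y \<le> B * sqrt (real n) then 1 else 0)"
      unfolding e_def by (simp add: algebra_simps)
  qed
  then show ?thesis
    unfolding killed_mean_diff killed_mean_cmult killed_mean_scaleM laplace_def[symmetric]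
    by (simp add: c_def)
qed

text \<open>For \<delta> = -1 the partial sums of \<open>conduct\<close> are asymptotic to
  \<open>n / lam p n\<close>, so \<open>lam p y\<close> times the sum up to y is
  \<open>O(y)\<close>. This is Stolz-Cesaro: the increments of \<open>n / lam p n\<close> divided by
  \<open>conduct (Suc n)\<close> equal
  \<open>p (Suc n) * (1 - n * (lam p (Suc n) / lam p n - 1))\<close>, which tends to 1/2 * 2. The
  sums diverge because \<open>lam\<close> is eventually decreasing, which bounds
  \<open>conduct\<close> away from 0.\<close>

lemma exit_time_bound:
  assumes \<delta>: "\<delta> = -1"
  obtains C where "C > 0" "\<And>H. exit_time H 1 \<le> C * (real H)\<^sup>2 / M H"
proof -
  define a where "a n = real n / lam p n" for n
  define d where "d n = (a (Suc n) - a n) / conduct (Suc n)" for n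
  have lamr: "(\<lambda>n. real n * (lam p (Suc n) / lam p n - 1)) \<longlonglongrightarrow> -1"
    using lam_ratio_index \<delta> by (simp add: ratio_index_def)
  have "(\<lambda>n. p (Suc n) * (1 - real n * (lam p (Suc n) / lam p n - 1))) \<longlonglongrightarrow> 1 / 2 * (1 - (-1))"
    by (intro tendsto_mult tendsto_diff tendsto_const LIMSEQ_Suc[OF p_tendsto] lamr)
  moreover have "p (Suc n) * (1 - real n * (lam p (Suc n) / lam p n - 1)) = d n" for n
    using p_pos[of "Suc n"] lam_pos[of n] lam_pos[of "Suc n"]
    by (simp add: d_def a_def conduct_def field_simps)
  ultimately have d: "d \<longlonglongrightarrow> 1" by simp
  have "eventually (\<lambda>n. real n * (lam p (Suc n) / lam p n - 1) < 0) sequentially"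
    by (rule order_tendstoD(2)[OF lamr]) simp
  then obtain N where N: "\<And>n. n \<ge> N \<Longrightarrow> real n * (lam p (Suc n) / lam p n - 1) < 0"
    by (auto simp: eventually_sequentially)
  have lam_le: "lam p n \<le> lam p N" if "n \<ge> N" for n
    using that
  proof (induction n rule: dec_induct)
    case (step n)
    have "lam p (Suc n) / lam p n < 1" using N[OF step(1)] by (simp add: mult_less_0_iff)
    then show ?case using step lam_pos[of n] by simp
  qed auto
  have cond_ge: "conduct (Suc n) \<ge> 1 / lam p N" if "n \<ge> N" for n
  proof -
    have "p (Suc n) * lam p (Suc n) \<le> 1 * lam p N"
      using p_less_1[of "Suc n"] lam_le[of "Suc n"] that lam_pos[of "Suc n"] 
      by (intro mult_mono) auto
    then show ?thesis unfolding conduct_def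
      using p_pos[of "Suc n"] lam_pos[of "Suc n"] lam_pos[of N] by (intro divide_left_mono mult_pos_pos) auto
  qed
  have div: "filterlim (\<lambda>n. \<Sum>k<n. conduct (Suc k)) at_top sequentially"
  proof (rule filterlim_at_top_mono)
    show "filterlim (\<lambda>n. 1 / lam p N * (real n - real N)) at_top sequentially"
    proof -
      have "filterlim (\<lambda>n. real n - real N) at_top sequentially" by real_asymp
      then show ?thesis using lam_pos[of N] by (intro filterlim_tendsto_pos_mult_at_top[OF tendsto_const]) auto
    qed
    have "1 / lam p N * (real n - real N) \<le> (\<Sum>k<n. conduct (Suc k))" if "n \<ge> N" for n
      using that
    proof (induction n rule: dec_induct)
      case base
      have "(\<Sum>k<N. conduct (Suc k)) \<ge> 0"
        using conduct_pos by (intro sum_nonneg) (simp add: less_imp_le)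
      then show ?case by simp
    next
      case (step n)
      have "1 / lam p N * (real (Suc n) - real N) = 1 / lam p N * (real n - real N) + 1 / lam p N"
        by (simp add: diff_divide_distrib add_divide_distrib)
      also have "\<dots> \<le> (\<Sum>k<n. conduct (Suc k)) + conduct (Suc n)"
        using step cond_ge[of n] by (intro add_mono) auto
      finally show ?case by simp
    qed
    then show "eventually (\<lambda>n. 1 / lam p N * (real n - real N) \<le> (\<Sum>k<n. conduct (Suc k))) sequentially"
      by (auto simp: eventually_sequentially)
  qed
  have "(\<lambda>n. (\<Sum>k<n. d k * conduct (Suc k)) / (\<Sum>k<n. conduct (Suc k))) \<longlonglongrightarrow> 1"
    by (rule weighted_mean_tendsto[OF _ div d]) (use conduct_pos in \<open>auto intro: less_imp_le\<close>)
  moreover have "(\<Sum>k<n. d k * conduct (Suc k)) = a n" for n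
  proof -
    have "(\<Sum>k<n. d k * conduct (Suc k)) = (\<Sum>k<n. a (Suc k) - a k)"
      using conduct_pos by (intro sum.cong) (auto simp: d_def less_imp_neq[symmetric])
    also have "\<dots> = a n - a 0" by (rule sum_lessThan_telescope)
    finally show ?thesis by (simp add: a_def)
  qed
  ultimately have "(\<lambda>n. a n / (\<Sum>k<n. conduct (Suc k))) \<longlonglongrightarrow> 1" by simp
  then have "(\<lambda>n. inverse (a n / (\<Sum>k<n. conduct (Suc k)))) \<longlonglongrightarrow> inverse 1" by (rule tendsto_inverse) simp
  then have "Bseq (\<lambda>n. inverse (a n / (\<Sum>k<n. conduct (Suc k))))"
    by (intro convergent_imp_Bseq) (auto simp: convergent_def)
  then obtain C where C: "C > 0" "\<And>n. \<bar>inverse (a n / (\<Sum>k<n. conduct (Suc k)))\<bar> \<le> C"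
    by (auto simp: Bseq_def)
  have b: "lam p y * (\<Sum>z=1..y. conduct z) \<le> C * real y" if y: "y \<ge> 1" for y
  proof -
    have e: "(\<Sum>z=1..y. conduct z) = (\<Sum>k<y. conduct (Suc k))"
      using sum.shift_bounds_Suc_ivl[of conduct 0 y] by (simp add: atLeastLessThanSuc_atLeastAtMost lessThan_atLeast0)
    have "lam p y * (\<Sum>z=1..y. conduct z) = inverse (a y / (\<Sum>k<y. conduct (Suc k))) * real y"
      unfolding e using y by (simp add: a_def)
    also have "\<dots> \<le> C * real y" using order_trans[OF abs_ge_self C(2)] by (intro mult_right_mono) auto
    finally show ?thesis .
  qed
  have "exit_time H 1 \<le> C * (real H)\<^sup>2 / M H" for H
  proof -
    have "(\<Sum>y\<in>{1..<H}. lam p y * (\<Sum>z=1..y. conduct z)) \<le> (\<Sum>y\<in>{1..<H}. C * real H)"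
      using C(1) by (intro sum_mono order_trans[OF b]) auto
    also have "\<dots> \<le> real H * (C * real H)" using C(1) by (simp add: mult_right_mono)
    finally have "(\<Sum>y\<in>{1..<H}. lam p y * (\<Sum>z=1..y. conduct z)) \<le> C * (real H)\<^sup>2"
      by (simp add: power2_eq_square mult.left_commute)
    then show ?thesis unfolding exit_time_1 using scaleM_mono[of 0 H] by (intro divide_right_mono) auto
  qed
  with C(1) that show ?thesis by blast
qed

text \<open>\<open>M\<close> is slowly varying, so changing n by a constant factor does not affect
  \<open>M (isqrt n)\<close> in the limit. From below: Y_n is mostly under
  \<open>N * sqrt n\<close>, where \<open>M\<close> is at most about \<open>M (isqrt n)\<close>.
  From above: \<open>survival_le_exit\<close> with H about \<open>sqrt (n / N)\<close> has exit term
  at most \<open>C / N\<close> relative to \<open>1 / M H\<close>.\<close>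

lemma survival_asymp_zero:
  assumes \<delta>: "\<delta> = -1"
  shows "(\<lambda>n. survival n * M (isqrt n)) \<longlonglongrightarrow> 1"
proof (rule order_tendstoI)
  have \<kappa>: "\<kappa> = 0" using \<delta> by (simp add: kappa_def)
  have ratio: "(\<lambda>n. M (isqrt n) / M (isqrt (j n))) \<longlonglongrightarrow> 1"
    if "filterlim j at_top sequentially" "(\<lambda>n. real n / real (j n)) \<longlonglongrightarrow> a" "a > 0" for j a
    using scaleM_isqrt_ratio[OF filterlim_ident that] that(3) by (simp add: \<kappa>)
  fix z :: real
  { assume z: "z < 1"
    \<comment> \<open>\<open>laplace_large\<close> with \<open>s = 1 / N\<close> and
      \<open>B = N\<close>: the Laplace limit \<open>1 / (1 + 2s)\<close> is close to 1 while
      \<open>exp (- s * B^2) = exp (- N)\<close> is close to 0.\<close>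
    have "(\<lambda>N. 1 - (1 - 1 / (1 + 2 / real N)) / (1 - exp (- (1 / real N * (real N)\<^sup>2)))) \<longlonglongrightarrow> 1"
      by real_asymp
    then obtain N where N: "N \<ge> 1" "z < 1 - (1 - 1 / (1 + 2 / real N)) / (1 - exp (- (1 / real N * (real N)\<^sup>2)))"
      using z by (rule tendsto_obtain_greater)
    define j where "j n = N\<^sup>2 * n" for n
    define r where "r n = M (isqrt n) / M (isqrt (j n))" for n
    have j1: "j n \<ge> n" for n using N(1) by (simp add: j_def)
    have r: "r \<longlonglongrightarrow> 1" unfolding r_def
    proof (rule ratio)
      show "filterlim j at_top sequentially"
        by (rule filterlim_at_top_mono[OF filterlim_ident]) (simp add: j1)
      have "eventually (\<lambda>n. 1 / (real N)\<^sup>2 = real n / real (j n)) sequentially"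
        using eventually_gt_at_top[of 0] by eventually_elim (simp add: j_def)
      then show "(\<lambda>n. real n / real (j n)) \<longlonglongrightarrow> 1 / (real N)\<^sup>2"
        by (rule Lim_transform_eventually[OF tendsto_const])
    qed (use N in simp)
    define c where "c = 1 - exp (- (1 / real N * (real N)\<^sup>2))"
    have c: "c \<noteq> 0" using N(1) by (simp add: c_def)
    have "(\<lambda>n. r n * (1 - (1 - laplace n (1 / real N / real n)) / c)) \<longlonglongrightarrow> 1 * (1 - (1 - (1 + 2 * (1 / real N)) powr (- (\<kappa> + 1))) / c)"
      by (intro tendsto_intros r laplace_tendsto c) simp
    moreover have "(1 + 2 * (1 / real N)) powr (- (\<kappa> + 1)) = 1 / (1 + 2 / real N)"
      by (simp add: \<kappa> powr_minus_divide add_nonneg_nonneg)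
    ultimately have "(\<lambda>n. r n * (1 - (1 - laplace n (1 / real N / real n)) / c)) \<longlonglongrightarrow> 1 - (1 - 1 / (1 + 2 / real N)) / c"
      by simp
    from order_tendstoD(1)[OF this N(2)[folded c_def]]
    show "eventually (\<lambda>n. z < survival n * M (isqrt n)) sequentially"
      using eventually_gt_at_top[of 0]
    proof eventually_elim
      case (elim n)
      define Y where "Y = isqrt (j n)"
      have M0: "M (isqrt n) \<ge> 0" using scaleM_mono[of 0] by simp
      have "isqrt 1 \<le> Y" unfolding Y_def using j1[of n] elim(2) by (intro isqrt_mono) simp
      then have Y1: "Y \<ge> 1" by (simp add: isqrt_def)
      have MY: "M Y > 0" by (rule scaleM_pos[OF Y1])
      have sj: "sqrt (real (j n)) = real N * sqrt (real n)" by (simp add: j_def real_sqrt_mult)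
      have "1 - (1 - laplace n (1 / real N / real n)) / c
          \<le> killed_mean n (\<lambda>y. M y * (if real y \<le> real N * sqrt (real n) then 1 else 0))"
        unfolding c_def using N(1) elim(2) by (intro laplace_large) auto
      also have "\<dots> \<le> killed_mean n (\<lambda>y. M Y * 1)"
      proof (intro killed_mean_mono)
        fix y
        show "M y * (if real y \<le> real N * sqrt (real n) then 1 else 0) \<le> M Y * 1"
        proof (cases "real y \<le> real N * sqrt (real n)")
          case True
          then have "real y < real Y + 1" using isqrt_bounds(2)[of "j n"] unfolding Y_def sj by linarith
          then have "y \<le> Y" by simp
          then show ?thesis using scaleM_mono True by simp
        qed (use MY in simp)
      qed
      also have "\<dots> = M Y * survival n" unfolding killed_mean_cmult survival_eq ..
      finally have "r n * (1 - (1 - laplace n (1 / real N / real n)) / c) \<le> r n * (M Y * survival n)"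
        using M0 MY by (intro mult_left_mono) (auto simp: r_def Y_def)
      also have "\<dots> = survival n * M (isqrt n)" using MY by (simp add: r_def Y_def)
      finally show ?case using elim(1) by linarith
    qed
  }
  { assume z: "z > 1"
    obtain C where C: "C > 0" "\<And>H. exit_time H 1 \<le> C * (real H)\<^sup>2 / M H"
      using exit_time_bound[OF \<delta>] by blast
    have "(\<lambda>N. 1 + C / real N) \<longlonglongrightarrow> 1" by real_asymp
    then obtain N where N: "N \<ge> 1" "1 + C / real N < z"
      using z by (rule tendsto_obtain_less)
    define j where "j n = n div N" for n
    define r where "r n = M (isqrt n) / M (isqrt (j n))" for n
    have j: "filterlim j at_top sequentially"
      unfolding j_def using N(1) by (intro filterlim_at_top_div_const_nat) simp
    have r: "r \<longlonglongrightarrow> 1" unfolding r_def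
    proof (rule ratio[OF j])
      have "(\<lambda>m. inverse (real (m div N) / real m)) \<longlonglongrightarrow> inverse (1 / real N)"
        using N(1) by (intro tendsto_inverse div_quotient_tendsto) auto
      then show "(\<lambda>n. real n / real (j n)) \<longlonglongrightarrow> real N" by (simp add: j_def)
    qed (use N in simp)
    have "(\<lambda>n. r n * (1 + C / real N)) \<longlonglongrightarrow> 1 * (1 + C / real N)"
      by (intro tendsto_mult r tendsto_const)
    then have "eventually (\<lambda>n. r n * (1 + C / real N) < z) sequentially"
      by (rule order_tendstoD(2)) (use N in simp)
    moreover have "eventually (\<lambda>n. j n \<ge> 1) sequentially"
      using j unfolding filterlim_at_top by blast
    ultimately show "eventually (\<lambda>n. survival n * M (isqrt n) < z) sequentially"
      using eventually_gt_at_top[of 0]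
    proof eventually_elim
      case (elim n)
      define H where "H = isqrt (j n)"
      have "isqrt 1 \<le> H" unfolding H_def using elim(2) by (intro isqrt_mono)
      then have H1: "H \<ge> 1" by (simp add: isqrt_def)
      have MH: "M H > 0" by (rule scaleM_pos[OF H1])
      have M0: "M (isqrt n) \<ge> 0" using scaleM_mono[of 0] by simp
      have "(real H)\<^sup>2 \<le> (sqrt (real (j n)))\<^sup>2" unfolding H_def using isqrt_bounds(1) by (intro power_mono) auto
      also have "\<dots> \<le> real n / real N"
      proof -
        have "n div N * N \<le> n" by (rule div_times_less_eq_dividend)
        then have "real (n div N) * real N \<le> real n" by (metis of_nat_le_iff of_nat_mult)
        then show ?thesis using N(1) by (simp add: j_def pos_le_divide_eq)
      qed
      finally have H2: "(real H)\<^sup>2 \<le> real n / real N" .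
      have "survival n \<le> 1 / M H + exit_time H 1 / real n"
        using survival_le_exit[OF H1] elim(3) by simp
      also have "exit_time H 1 / real n \<le> (C * (real n / real N) / M H) / real n"
        using C H2 MH by (intro divide_right_mono order_trans[OF C(2)] mult_left_mono) auto
      also have "\<dots> = C / real N / M H" using elim(3) by simp
      finally have "survival n \<le> (1 + C / real N) / M H" by (simp add: add_divide_distrib)
      then have "survival n * M (isqrt n) \<le> (1 + C / real N) / M H * M (isqrt n)"
        using M0 by (intro mult_right_mono)
      also have "\<dots> = r n * (1 + C / real N)" by (simp add: r_def H_def)
      finally show ?case using elim(1) by linarith
    qed
  }
qed

end

section \<open>Return time asymptotics\<close>

context recurrent_bessel_walk
begin

lemma survival_asymp: "(\<lambda>n. survival n * M (isqrt n)) \<longlonglongrightarrow> tail_const"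
proof (cases "\<kappa> = 0")
  case True
  then have "\<delta> = -1" by (simp add: kappa_def)
  moreover have "tail_const = 1" by (simp add: tail_const_def True)
  ultimately show ?thesis using survival_asymp_zero by simp
next
  case False
  then show ?thesis using survival_asymp_pos \<kappa>_nonneg by simp
qed

text \<open>By monotonicity a zero would persist, contradicting the positive limit in
  \<open>survival_asymp\<close>.\<close>

lemma survival_pos: "survival n > 0"
proof (rule ccontr)
  assume "\<not> survival n > 0"
  then have "survival n = 0" using survival_nonneg[of n] by simp
  then have "survival k = 0" if "k \<ge> n" for k
    using antimonoD[OF survival_antimono that] survival_nonneg[of k] by simp
  then have "eventually (\<lambda>k. survival k * M (isqrt k) = 0) sequentially"
    by (auto simp: eventually_sequentially)
  then have "(\<lambda>k. survival k * M (isqrt k)) \<longlonglongrightarrow> 0" by (rule tendsto_eventually)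
  from LIMSEQ_unique[OF this survival_asymp] show False using tail_const_pos by simp
qed

lemma scaleM_isqrt_pos: "n \<ge> 1 \<Longrightarrow> M (isqrt n) > 0"
proof -
  assume "n \<ge> 1"
  then have "isqrt 1 \<le> isqrt n" by (rule isqrt_mono)
  then show ?thesis by (intro scaleM_pos) (simp add: isqrt_def)
qed

lemma return_tail_asymp: "(\<lambda>n. return_tail_prob p n * M (isqrt n)) \<longlonglongrightarrow> tail_const"
proof (rule LIMSEQ_offset[where k = 2])
  have "(\<lambda>n. M (isqrt (n + 2)) / M (isqrt n)) \<longlonglongrightarrow> 1 powr \<kappa>"
  proof (rule scaleM_isqrt_ratio)
    show "filterlim (\<lambda>n::nat. n + 2) at_top sequentially" by (rule filterlim_add_const_nat_at_top)
    show "(\<lambda>n. real (n + 2) / real n) \<longlonglongrightarrow> 1" by real_asymp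
  qed (auto intro: filterlim_ident)
  from tendsto_mult[OF survival_asymp this]
  have "(\<lambda>n. survival n * M (isqrt n) * (M (isqrt (n + 2)) / M (isqrt n))) \<longlonglongrightarrow> tail_const"
    by simp
  moreover have "eventually (\<lambda>n. survival n * M (isqrt n) * (M (isqrt (n + 2)) / M (isqrt n))
      = return_tail_prob p (n + 2) * M (isqrt (n + 2))) sequentially"
    using eventually_ge_at_top[of 1]
  proof eventually_elim
    case (elim n)
    then show ?case using scaleM_isqrt_pos[OF elim] by (simp only: return_tail_prob_eq) simp
  qed
  ultimately show "(\<lambda>n. return_tail_prob p (n + 2) * M (isqrt (n + 2))) \<longlonglongrightarrow> tail_const"
    by (rule Lim_transform_eventually)
qed

lemma survival_even_ratio:
  assumes i: "filterlim i at_top sequentially" and a: "a > 0"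
    and ia: "(\<lambda>m. real (i m) / real m) \<longlonglongrightarrow> a"
  shows "(\<lambda>m. survival (2 * i m) / survival (2 * m)) \<longlonglongrightarrow> a powr (- \<kappa>)"
proof -
  define t where "t n = survival n * M (isqrt n)" for n
  have t: "t \<longlonglongrightarrow> tail_const" unfolding t_def by (rule survival_asymp)
  have two: "filterlim (\<lambda>m::nat. 2 * m) at_top sequentially"
    by (rule filterlim_at_top_mono[OF filterlim_ident]) simp
  have two_i: "filterlim (\<lambda>m. 2 * i m) at_top sequentially"
    by (rule filterlim_compose[OF two i])
  have "(\<lambda>m. inverse (real (i m) / real m)) \<longlonglongrightarrow> inverse a"
    using a by (intro tendsto_inverse ia) auto
  then have "(\<lambda>m. real (2 * m) / real (2 * i m)) \<longlonglongrightarrow> inverse a" by simp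
  then have "(\<lambda>m. M (isqrt (2 * m)) / M (isqrt (2 * i m))) \<longlonglongrightarrow> inverse a powr \<kappa>"
    using a by (intro scaleM_isqrt_ratio two two_i) auto
  then have "(\<lambda>m. t (2 * i m) / t (2 * m) * (M (isqrt (2 * m)) / M (isqrt (2 * i m))))
     \<longlonglongrightarrow> tail_const / tail_const * inverse a powr \<kappa>"
    using tail_const_pos
    by (intro tendsto_mult tendsto_divide filterlim_compose[OF t two] filterlim_compose[OF t two_i]) auto
  moreover have "tail_const / tail_const * inverse a powr \<kappa> = a powr (- \<kappa>)"
    using tail_const_pos a by (simp add: powr_minus inverse_powr)
  moreover have "eventually (\<lambda>m. t (2 * i m) / t (2 * m) * (M (isqrt (2 * m)) / M (isqrt (2 * i m)))
      = survival (2 * i m) / survival (2 * m)) sequentially"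
  proof -
    have "eventually (\<lambda>m. i m \<ge> 1) sequentially" using i unfolding filterlim_at_top by blast
    then show ?thesis using eventually_ge_at_top[of 1]
    proof eventually_elim
      case (elim m)
      have "M (isqrt (2 * i m)) > 0" "M (isqrt (2 * m)) > 0"
        using elim by (auto intro: scaleM_isqrt_pos)
      then show ?case by (simp add: t_def)
    qed
  qed
  ultimately show ?thesis by (simp add: Lim_transform_eventually)
qed

lemma first_return_asymp:
  "(\<lambda>m. real m * first_return_prob p (2 * m) / return_tail_prob p (2 * m)) \<longlonglongrightarrow> \<kappa>"
proof (rule LIMSEQ_offset[where k = 1])
  have "(\<lambda>m. real m * first_return_prob p (2 * m + 2) / survival (2 * m)) \<longlonglongrightarrow> \<kappa>"
  proof (rule monotone_density)
    show "survival (2 * m) > 0" for m by (rule survival_pos)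
    show "survival (2 * m) - survival (2 * Suc m) = first_return_prob p (2 * m + 2)" for m
      \<comment> \<open>Two steps of time contribute two return probabilities, of which the one at
        the odd time vanishes by parity.\<close>
      using survival_diff[of "2 * m"] survival_diff[of "2 * m + 1"] first_return_prob_odd[of "2 * m + 1"] by simp
    show "first_return_prob p (2 * Suc m + 2) \<le> first_return_prob p (2 * m + 2)" for m
      using first_return_prob_decreasing[of m] by (simp add: numeral_eq_Suc)
    show "(\<lambda>m. survival (2 * i m) / survival (2 * m)) \<longlonglongrightarrow> a powr (- \<kappa>)"
      if "filterlim i at_top sequentially" "a > 0" "(\<lambda>m. real (i m) / real m) \<longlonglongrightarrow> a" for i a
      using that by (rule survival_even_ratio)
  qed
  moreover have "(\<lambda>m. real (m + 1) / real m) \<longlonglongrightarrow> 1" by real_asymp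
  ultimately have "(\<lambda>m. real (m + 1) / real m * (real m * first_return_prob p (2 * m + 2) / survival (2 * m))) \<longlonglongrightarrow> 1 * \<kappa>"
    by (intro tendsto_mult)
  moreover have "eventually (\<lambda>m. real (m + 1) / real m * (real m * first_return_prob p (2 * m + 2) / survival (2 * m))
     = real (m + 1) * first_return_prob p (2 * (m + 1)) / return_tail_prob p (2 * (m + 1))) sequentially"
    using eventually_gt_at_top[of 0]
  proof eventually_elim
    case (elim m)
    have "2 * (m + 1) = 2 * m + 2" by simp
    then show ?case using elim by (simp only: return_tail_prob_eq) simp
  qed
  ultimately show "(\<lambda>m. real (m + 1) * first_return_prob p (2 * (m + 1)) / return_tail_prob p (2 * (m + 1))) \<longlonglongrightarrow> \<kappa>"
    by (simp add: Lim_transform_eventually)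
qed

end

locale normalized_bessel_walk = recurrent_bessel_walk +
  fixes K0 :: real
  assumes K0_pos: "K0 > 0"
    and lam_asymp: "(\<lambda>x. lam p x) \<sim>[at_top] (\<lambda>x. K0 * real x powr (2 * kappa \<delta> - 1) / Lfun \<delta> p (real x))"
begin

section \<open>From the scale function to \<open>K0\<close> and \<open>L\<close>\<close>

lemma lam_tendsto: "(\<lambda>x. lam p x * Lnat \<delta> p x / real x powr (2 * \<kappa> - 1)) \<longlonglongrightarrow> K0"
proof -
  have "(\<lambda>x. lam p x / (K0 * real x powr (2 * \<kappa> - 1) / Lfun \<delta> p (real x))) \<longlonglongrightarrow> 1"
    using lam_pos by (intro asymp_equivD_strong[OF lam_asymp]) (auto simp: less_imp_neq[symmetric])
  then have "(\<lambda>x. K0 * (lam p x / (K0 * real x powr (2 * \<kappa> - 1) / Lfun \<delta> p (real x)))) \<longlonglongrightarrow> K0 * 1"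
    by (intro tendsto_mult tendsto_const)
  then show ?thesis using K0_pos by (simp add: Lfun_of_nat)
qed

definition tail_rate :: "nat \<Rightarrow> real" where
  "tail_rate n = real n powr (- \<kappa>) * Lfun \<delta> p (sqrt (real n))"

text \<open>By \<open>scale_quotient\<close>, \<open>M x\<close> is asymptotic to
  \<open>x * lam p x / (2\<kappa>)\<close>, hence to
  \<open>K0 / (2\<kappa>) * x powr (2\<kappa>) / L(x)\<close>; this is evaluated at the integer part
  of sqrt n.\<close>

lemma scaleM_tail_rate:
  assumes \<kappa>: "\<kappa> > 0"
  shows "(\<lambda>n. M (isqrt n) * tail_rate n) \<longlonglongrightarrow> K0 / (2 * \<kappa>)"
proof -
  define f where "f m = (lam p m * Lnat \<delta> p m / real m powr (2 * \<kappa> - 1)) / (real m * lam p m / M m)" for m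
  have "f \<longlonglongrightarrow> K0 / (2 * \<kappa>)"
    unfolding f_def using \<kappa> by (intro tendsto_divide lam_tendsto scale_quotient) auto
  then have f: "(\<lambda>n. f (isqrt n)) \<longlonglongrightarrow> K0 / (2 * \<kappa>)"
    by (rule filterlim_compose[OF _ isqrt_at_top])
  have "(\<lambda>n. (real (isqrt n) / sqrt (real n)) powr (2 * \<kappa>)) \<longlonglongrightarrow> 1 powr (2 * \<kappa>)"
    by (intro tendsto_powr isqrt_quotient tendsto_const) simp
  from tendsto_mult[OF tendsto_mult[OF f this] Lfun_sqrt_tendsto]
  have "(\<lambda>n. f (isqrt n) * (real (isqrt n) / sqrt (real n)) powr (2 * \<kappa>) * (Lfun \<delta> p (sqrt (real n)) / Lnat \<delta> p (isqrt n)))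
      \<longlonglongrightarrow> K0 / (2 * \<kappa>)" by simp
  moreover have "eventually (\<lambda>n. f (isqrt n) * (real (isqrt n) / sqrt (real n)) powr (2 * \<kappa>) * (Lfun \<delta> p (sqrt (real n)) / Lnat \<delta> p (isqrt n))
      = M (isqrt n) * tail_rate n) sequentially"
    using eventually_ge_at_top[of 1]
  proof eventually_elim
    case (elim n)
    define m where "m = isqrt n"
    have m: "m \<ge> 1" unfolding m_def using isqrt_mono[OF elim] by (simp add: isqrt_def)
    have pm: "lam p m > 0" "Lnat \<delta> p m > 0" "real m > 0" "real n > 0" using lam_pos Lnat_pos m elim by auto
    have "real m powr (2 * \<kappa>) = real m powr (2 * \<kappa> - 1) * real m"
      using pm powr_add[of "real m" "2 * \<kappa> - 1" 1] by simp
    then have fm: "f m = M m * Lnat \<delta> p m / real m powr (2 * \<kappa>)"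
      using pm by (simp add: f_def)
    have "sqrt (real n) powr (2 * \<kappa>) = real n powr \<kappa>"
      using pm by (simp add: powr_half_sqrt[symmetric] powr_powr)
    then have q: "(real m / sqrt (real n)) powr (2 * \<kappa>) = real m powr (2 * \<kappa>) * real n powr (- \<kappa>)"
      by (simp add: powr_divide powr_minus_divide)
    show ?case unfolding m_def[symmetric] fm q tail_rate_def using pm by simp
  qed
  ultimately show ?thesis by (rule Lim_transform_eventually)
qed

definition rate_const :: real where
  "rate_const = 2 powr (1 - \<kappa>) / (K0 * Gamma \<kappa>)"

lemma return_tail_rate:
  assumes \<kappa>: "\<kappa> > 0"
  shows "(\<lambda>n. return_tail_prob p n / (rate_const * tail_rate n)) \<longlonglongrightarrow> 1"
proof -
  have G: "Gamma \<kappa> > 0" using \<kappa> by (rule Gamma_real_pos)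
  have Gp: "Gamma (\<kappa> + 1) = \<kappa> * Gamma \<kappa>"
    using \<kappa> by (intro Gamma_plus1) (auto simp: nonpos_Ints_def)
  have rc: "rate_const > 0" using G K0_pos by (simp add: rate_const_def)
  \<comment> \<open>The factor \<kappa> from \<open>Gamma (\<kappa> + 1)\<close> and the factor 2 in
    \<open>2 powr (1 - \<kappa>)\<close> cancel against the 2\<kappa> of
    \<open>scaleM_tail_rate\<close>.\<close>
  have lim: "rate_const * (K0 / (2 * \<kappa>)) = tail_const"
    unfolding rate_const_def tail_const_def Gp
    using G K0_pos \<kappa> by (simp add: powr_diff powr_minus_divide field_simps)
  have "(\<lambda>n. (return_tail_prob p n * M (isqrt n)) / (rate_const * (M (isqrt n) * tail_rate n)))
      \<longlonglongrightarrow> tail_const / (rate_const * (K0 / (2 * \<kappa>)))"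
    using rc K0_pos \<kappa>
    by (intro tendsto_divide tendsto_mult tendsto_const return_tail_asymp scaleM_tail_rate) auto
  also have "tail_const / (rate_const * (K0 / (2 * \<kappa>))) = 1"
    unfolding lim using tail_const_pos by simp
  finally have "(\<lambda>n. (return_tail_prob p n * M (isqrt n)) / (rate_const * (M (isqrt n) * tail_rate n))) \<longlonglongrightarrow> 1" .
  moreover have "eventually (\<lambda>n. (return_tail_prob p n * M (isqrt n)) / (rate_const * (M (isqrt n) * tail_rate n))
      = return_tail_prob p n / (rate_const * tail_rate n)) sequentially"
    using eventually_ge_at_top[of 1]
  proof eventually_elim
    case (elim n)
    then show ?case using scaleM_isqrt_pos[OF elim] by simp
  qed
  ultimately show ?thesis by (rule Lim_transform_eventually)
qed

lemma first_return_rate: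
  assumes \<kappa>: "\<kappa> > 0"
  shows "(\<lambda>m. first_return_prob p (2 * m) / (2 * \<kappa> * rate_const * tail_rate (2 * m) / real (2 * m))) \<longlonglongrightarrow> 1"
proof -
  have two: "filterlim (\<lambda>m::nat. 2 * m) at_top sequentially"
    by (rule filterlim_at_top_mono[OF filterlim_ident]) simp
  have "(\<lambda>m. (real m * first_return_prob p (2 * m) / return_tail_prob p (2 * m))
      * (return_tail_prob p (2 * m) / (rate_const * tail_rate (2 * m))) / \<kappa>) \<longlonglongrightarrow> \<kappa> * 1 / \<kappa>"
    using \<kappa> by (intro tendsto_divide tendsto_mult first_return_asymp tendsto_const
        filterlim_compose[OF return_tail_rate[OF \<kappa>] two]) auto
  moreover have "eventually (\<lambda>m. (real m * first_return_prob p (2 * m) / return_tail_prob p (2 * m))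
      * (return_tail_prob p (2 * m) / (rate_const * tail_rate (2 * m))) / \<kappa>
      = first_return_prob p (2 * m) / (2 * \<kappa> * rate_const * tail_rate (2 * m) / real (2 * m))) sequentially"
    using eventually_ge_at_top[of 1]
  proof eventually_elim
    case (elim m)
    obtain k where k: "m = Suc k" using elim by (cases m) auto
    have "return_tail_prob p (2 * k + 2) > 0" unfolding return_tail_prob_eq by (rule survival_pos)
    then have "return_tail_prob p (2 * m) > 0" by (simp add: k)
    then show ?case using elim \<kappa> by (simp add: mult_ac)
  qed
  ultimately show ?thesis using \<kappa> by (simp add: Lim_transform_eventually)
qed

text \<open>The sum \<open>nu\<close> is cut into blocks between consecutive squares. Block k has
  about k even indices l, each with l near k^2 and \<open>L(sqrt l)\<close> near
  \<open>L(k)\<close>, so it contributes about \<open>1 / (k * L(k))\<close>, which is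
  \<open>lam p k / K0\<close> up to a factor tending to 1. Toeplitz averaging then compares the sum
  of the blocks with \<open>M\<close>.\<close>

lemma nu_asymp:
  assumes \<delta>: "\<delta> = -1"
  shows "(\<lambda>n. nu \<delta> p n / M (isqrt n)) \<longlonglongrightarrow> 1 / K0"
proof -
  define F where "F l = 1 / (real l * Lfun \<delta> p (sqrt (real l)))" for l :: nat
  define B where "B k = {l \<in> {k\<^sup>2..<k\<^sup>2 + (2 * k + 1)}. even l}" for k :: nat
  define d where "d k = (\<Sum>l\<in>B k. F l)" for k
  define r where "r k = Lnat \<delta> p (Suc k) / Lnat \<delta> p k" for k
  have r: "r \<longlonglongrightarrow> 1" unfolding r_def by (rule Lnat_ratio_tendsto)
  have lamt: "(\<lambda>k. real k * lam p k * Lnat \<delta> p k) \<longlonglongrightarrow> K0"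
  proof -
    have "eventually (\<lambda>x. lam p x * Lnat \<delta> p x / real x powr (2 * \<kappa> - 1) = real x * lam p x * Lnat \<delta> p x) sequentially"
      using eventually_gt_at_top[of 0]
      by eventually_elim (simp add: kappa_def \<delta> powr_minus_divide)
    with lam_tendsto show ?thesis by (rule Lim_transform_eventually)
  qed
  have F0: "F l \<ge> 0" for l
  proof -
    have "Lfun \<delta> p (sqrt (real l)) \<ge> min (Lnat \<delta> p (isqrt l)) (Lnat \<delta> p (Suc (isqrt l)))"
      by (rule Lfun_sqrt_bounds)
    moreover have "min (Lnat \<delta> p (isqrt l)) (Lnat \<delta> p (Suc (isqrt l))) > 0" using Lnat_pos by simp
    ultimately show ?thesis unfolding F_def by (intro divide_nonneg_nonneg mult_nonneg_nonneg) auto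
  qed
  have Bk: "isqrt l = k" if "l \<in> B k" for l k
  proof -
    have "real (k\<^sup>2) \<le> real l" "real l < real ((k + 1)\<^sup>2)"
      using that by (auto simp: B_def power2_eq_square simp del: of_nat_power of_nat_mult)
    then have "real k \<le> sqrt (real l)" "sqrt (real l) < real k + 1"
      by (auto intro!: real_le_rsqrt real_less_lsqrt simp: add.commute)
    then have "\<lfloor>sqrt (real l)\<rfloor> = int k" by (simp add: floor_eq_iff)
    then show ?thesis by (simp add: isqrt_def)
  qed
  have dl: "(\<lambda>k. d k / lam p k) \<longlonglongrightarrow> 1 / K0"
  proof -
    \<comment> \<open>Upper bound for \<open>d k / lam p k\<close>: at most k + 1 terms, each with l
      at least k^2 and \<open>L\<close> at least the smaller interpolation endpoint. The lower bound
      \<open>l\<close> uses k terms, (k + 1)^2 and the larger endpoint.\<close>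
    define u where "u k = (real (k + 1) / real k) / (real k * lam p k * Lnat \<delta> p k * min 1 (r k))" for k
    define l where "l k = ((real k / real (k + 1))\<^sup>2) / (real k * lam p k * Lnat \<delta> p k * max 1 (r k))" for k
    have k1: "(\<lambda>k. real (k + 1) / real k) \<longlonglongrightarrow> 1" "(\<lambda>k. real k / real (k + 1)) \<longlonglongrightarrow> 1" by real_asymp+
    have "u \<longlonglongrightarrow> 1 / (K0 * min 1 1)" unfolding u_def
      using K0_pos by (intro tendsto_divide k1 tendsto_mult lamt tendsto_min tendsto_const r) auto
    then have u: "u \<longlonglongrightarrow> 1 / K0" by simp
    have "l \<longlonglongrightarrow> 1\<^sup>2 / (K0 * max 1 1)" unfolding l_def
      using K0_pos by (intro tendsto_divide tendsto_power k1 tendsto_mult lamt tendsto_max tendsto_const r) auto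
    then have l: "l \<longlonglongrightarrow> 1 / K0" by simp
    have both: "l k \<le> d k / lam p k \<and> d k / lam p k \<le> u k" if k: "k \<ge> 1" for k
    proof -
      define L where "L = Lnat \<delta> p k"
      have L: "L > 0" unfolding L_def by (rule Lnat_pos)
      have la: "lam p k > 0" by (rule lam_pos)
      have rk: "r k > 0" unfolding r_def using Lnat_pos by simp
      have kp: "real k > 0" using k by simp
      have Fb: "1 / ((real (k + 1))\<^sup>2 * (L * max 1 (r k))) \<le> F x \<and> F x \<le> 1 / ((real k)\<^sup>2 * (L * min 1 (r k)))"
        if x: "x \<in> B k" for x
      proof -
        have xk: "(real k)\<^sup>2 \<le> real x" "real x \<le> (real (k + 1))\<^sup>2"
        proof -
          have "k\<^sup>2 \<le> x" "x \<le> (k + 1)\<^sup>2" using x by (auto simp: B_def power2_eq_square)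
          then show "(real k)\<^sup>2 \<le> real x" "real x \<le> (real (k + 1))\<^sup>2"
            by (metis of_nat_le_iff of_nat_power)+
        qed
        have m: "min L (Lnat \<delta> p (Suc k)) = L * min 1 (r k)" "max L (Lnat \<delta> p (Suc k)) = L * max 1 (r k)"
          using L by (auto simp: r_def L_def[symmetric] min_mult_distrib_left max_mult_distrib_left)
        have Lx: "L * min 1 (r k) \<le> Lfun \<delta> p (sqrt (real x))" "Lfun \<delta> p (sqrt (real x)) \<le> L * max 1 (r k)"
          by (rule Lfun_sqrt_bounds[of \<delta> p x, unfolded Bk[OF x], folded L_def, unfolded m])+
        have p1: "L * min 1 (r k) > 0" "(real k)\<^sup>2 > 0" using L rk kp by (auto simp: min_def)
        have "(real k)\<^sup>2 * (L * min 1 (r k)) \<le> real x * Lfun \<delta> p (sqrt (real x))"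
          using xk Lx p1 by (intro mult_mono) auto
        moreover have "real x * Lfun \<delta> p (sqrt (real x)) \<le> (real (k + 1))\<^sup>2 * (L * max 1 (r k))"
          using xk Lx p1 by (intro mult_mono) auto
        moreover have "(real k)\<^sup>2 * (L * min 1 (r k)) > 0" using p1 by simp
        ultimately show ?thesis unfolding F_def by (intro conjI frac_le; linarith)
      qed
      have card: "real k \<le> real (card (B k))" "real (card (B k)) \<le> real (k + 1)"
        using card_even_interval[where a = "k\<^sup>2" and k = k] unfolding B_def by (simp_all only: of_nat_le_iff)
      have "real k * (1 / ((real (k + 1))\<^sup>2 * (L * max 1 (r k)))) \<le> real (card (B k)) * (1 / ((real (k + 1))\<^sup>2 * (L * max 1 (r k))))"
        using card L by (intro mult_right_mono) (auto simp: max_def)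
      also have "\<dots> \<le> d k" unfolding d_def using Fb by (intro sum_bounded_below) auto
      finally have lo: "real k * (1 / ((real (k + 1))\<^sup>2 * (L * max 1 (r k)))) / lam p k \<le> d k / lam p k"
        using la by (intro divide_right_mono) auto
      have "d k \<le> real (card (B k)) * (1 / ((real k)\<^sup>2 * (L * min 1 (r k))))"
        unfolding d_def using Fb by (intro sum_bounded_above) auto
      also have "\<dots> \<le> real (k + 1) * (1 / ((real k)\<^sup>2 * (L * min 1 (r k))))"
        using card L rk by (intro mult_right_mono) (auto simp: min_def)
      finally have hi: "d k / lam p k \<le> real (k + 1) * (1 / ((real k)\<^sup>2 * (L * min 1 (r k)))) / lam p k"
        using la by (intro divide_right_mono) auto
      have "real k * (1 / ((real (k + 1))\<^sup>2 * (L * max 1 (r k)))) / lam p k = l k"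
        using kp by (simp add: l_def L_def power2_eq_square)
      moreover have "real (k + 1) * (1 / ((real k)\<^sup>2 * (L * min 1 (r k)))) / lam p k = u k"
        by (simp add: u_def L_def power2_eq_square)
      ultimately show ?thesis using lo hi by simp
    qed
    have "eventually (\<lambda>k. l k \<le> d k / lam p k) sequentially" "eventually (\<lambda>k. d k / lam p k \<le> u k) sequentially"
      using both by (auto simp: eventually_sequentially intro!: exI[of _ 1])
    then show ?thesis by (rule real_tendsto_sandwich[OF _ _ l u])
  qed
  define S where "S K = (\<Sum>k<K. d k)" for K
  have S: "(\<lambda>K. S K / M K) \<longlonglongrightarrow> 1 / K0"
  proof -
    have "(\<lambda>K. (\<Sum>k<K. d k / lam p k * lam p k) / (\<Sum>k<K. lam p k)) \<longlonglongrightarrow> 1 / K0"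
      by (rule weighted_mean_tendsto[OF _ _ dl])
         (use lam_pos diverges in \<open>auto intro: less_imp_le simp: scaleM_def[abs_def]\<close>)
    moreover have "(\<Sum>k<K. d k / lam p k * lam p k) = S K" for K
      unfolding S_def using lam_pos by (intro sum.cong) (auto simp: less_imp_neq[symmetric])
    ultimately show ?thesis by (simp add: scaleM_def)
  qed
  have SE: "S K = (\<Sum>l\<in>{l \<in> {..<K\<^sup>2}. even l}. F l)" for K
  proof (induction K)
    case (Suc K)
    have "(Suc K)\<^sup>2 = K\<^sup>2 + (2 * K + 1)" by (simp add: power2_eq_square)
    then have split: "{l \<in> {..<(Suc K)\<^sup>2}. even l} = {l \<in> {..<K\<^sup>2}. even l} \<union> B K"
      by (auto simp: B_def)
    have "(\<Sum>l\<in>{l \<in> {..<(Suc K)\<^sup>2}. even l}. F l) = (\<Sum>l\<in>{l \<in> {..<K\<^sup>2}. even l}. F l) + (\<Sum>l\<in>B K. F l)"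
      unfolding split by (rule sum.union_disjoint) (auto simp: B_def)
    then show ?case using Suc by (simp add: S_def d_def)
  qed (simp add: S_def)
  have nu: "nu \<delta> p n = (\<Sum>l\<in>{l \<in> {..n}. even l}. F l)" for n
    unfolding nu_def F_def
  proof (rule sum.mono_neutral_left)
    show "\<forall>i\<in>{l \<in> {..n}. even l} - {l. 2 \<le> l \<and> l \<le> n \<and> even l}. 1 / (real i * Lfun \<delta> p (sqrt (real i))) = 0"
    proof
      fix i assume "i \<in> {l \<in> {..n}. even l} - {l. 2 \<le> l \<and> l \<le> n \<and> even l}"
      then have "even i" "i < 2" by auto
      then have "i = 0" by (auto simp: less_2_cases_iff)
      then show "1 / (real i * Lfun \<delta> p (sqrt (real i))) = 0" by simp
    qed
  qed auto
  have sq: "(isqrt n)\<^sup>2 \<le> n" "n < (Suc (isqrt n))\<^sup>2" for n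
  proof -
    have "(real (isqrt n))\<^sup>2 \<le> (sqrt (real n))\<^sup>2" using isqrt_bounds(1) by (intro power_mono) auto
    then have "real ((isqrt n)\<^sup>2) \<le> real n" by simp
    then show "(isqrt n)\<^sup>2 \<le> n" by (simp only: of_nat_le_iff)
    have "(sqrt (real n))\<^sup>2 < (real (isqrt n) + 1)\<^sup>2" using isqrt_bounds(2) by (intro power_strict_mono) auto
    then have "real n < real ((Suc (isqrt n))\<^sup>2)" by (simp add: add.commute)
    then show "n < (Suc (isqrt n))\<^sup>2" by (simp only: of_nat_less_iff)
  qed
  show ?thesis
  proof (rule real_tendsto_sandwich)
    show "(\<lambda>n. S (isqrt n) / M (isqrt n)) \<longlonglongrightarrow> 1 / K0"
      by (rule filterlim_compose[OF S isqrt_at_top])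
    \<comment> \<open>\<open>nu\<close> at n lies between the block sums up to
      \<open>isqrt n\<close> and \<open>Suc (isqrt n)\<close>; the incomplete last block is
      negligible because consecutive values of \<open>M\<close> have ratio tending to 1.\<close>
    have "(\<lambda>K. M (Suc K) / M K) \<longlonglongrightarrow> 1 powr (2 * \<kappa>)"
    proof (rule ratio_index_tendsto[OF scaleM_ratio_index])
      show "(\<lambda>K. real (Suc K) / real K) \<longlonglongrightarrow> 1" by real_asymp
    qed (auto intro: filterlim_Suc filterlim_ident)
    then have "(\<lambda>K. S (Suc K) / M (Suc K) * (M (Suc K) / M K)) \<longlonglongrightarrow> 1 / K0 * 1 powr (2 * \<kappa>)"
      by (intro tendsto_mult LIMSEQ_Suc[OF S])
    moreover have "S (Suc K) / M (Suc K) * (M (Suc K) / M K) = S (Suc K) / M K" for K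
      using scaleM_pos[of "Suc K"] by simp
    ultimately have "(\<lambda>K. S (Suc K) / M K) \<longlonglongrightarrow> 1 / K0 * 1 powr (2 * \<kappa>)" by (simp only:)
    then have "(\<lambda>K. S (Suc K) / M K) \<longlonglongrightarrow> 1 / K0" by simp
    then show "(\<lambda>n. S (Suc (isqrt n)) / M (isqrt n)) \<longlonglongrightarrow> 1 / K0"
      by (rule filterlim_compose[OF _ isqrt_at_top])
    have "S (isqrt n) \<le> nu \<delta> p n" "nu \<delta> p n \<le> S (Suc (isqrt n))" for n
      unfolding SE nu using sq[of n] by (intro sum_mono2; auto simp: F0)+
    then show "eventually (\<lambda>n. S (isqrt n) / M (isqrt n) \<le> nu \<delta> p n / M (isqrt n)) sequentially"
      "eventually (\<lambda>n. nu \<delta> p n / M (isqrt n) \<le> S (Suc (isqrt n)) / M (isqrt n)) sequentially"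
      using scaleM_mono[of 0] by (auto intro!: divide_right_mono always_eventually)
  qed
qed

lemma return_tail_nu:
  assumes \<delta>: "\<delta> = -1"
  shows "(\<lambda>n. return_tail_prob p n / (1 / (K0 * nu \<delta> p n))) \<longlonglongrightarrow> 1"
proof -
  have "\<kappa> = 0" using \<delta> by (simp add: kappa_def)
  then have "tail_const = 1" by (simp add: tail_const_def)
  then have "(\<lambda>n. (return_tail_prob p n * M (isqrt n)) * (K0 * (nu \<delta> p n / M (isqrt n)))) \<longlonglongrightarrow> 1 * (K0 * (1 / K0))"
    using return_tail_asymp by (intro tendsto_mult tendsto_const nu_asymp \<delta>) simp
  moreover have "eventually (\<lambda>n. (return_tail_prob p n * M (isqrt n)) * (K0 * (nu \<delta> p n / M (isqrt n)))
      = return_tail_prob p n / (1 / (K0 * nu \<delta> p n))) sequentially"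
    using eventually_ge_at_top[of 1]
  proof eventually_elim
    case (elim n)
    then show ?case using scaleM_isqrt_pos[OF elim] by simp
  qed
  ultimately show ?thesis using K0_pos by (simp add: Lim_transform_eventually)
qed

end

theorem theorem2p1:
  fixes p :: "nat \<Rightarrow> real" and \<delta> K0 :: real
  assumes delta: "\<delta> \<ge> -1"
    and ellip: "\<exists>\<epsilon>>0. \<forall>x\<ge>1. \<epsilon> \<le> p x \<and> p x \<le> 1 - \<epsilon> \<and> \<epsilon> \<le> 1 - p x \<and> 1 - p x \<le> 1 - \<epsilon>"
    and R_small: "(\<lambda>x. real x * Rterm \<delta> p x) \<longlonglongrightarrow> 0"
    and K0_pos: "K0 > 0"
    and K0: "(\<lambda>x. lam p x) \<sim>[at_top]
               (\<lambda>x. K0 * real x powr (2 * kappa \<delta> - 1) / Lfun \<delta> p (real x))"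
  shows "(\<delta> > -1 \<longrightarrow>
            (\<lambda>n. return_tail_prob p n) \<sim>[at_top]
              (\<lambda>n. 2 powr (1 - kappa \<delta>) / (K0 * Gamma (kappa \<delta>))
                    * real n powr (- kappa \<delta>) * Lfun \<delta> p (sqrt (real n)))
          \<and> (\<lambda>m. first_return_prob p (2 * m)) \<sim>[at_top]
              (\<lambda>m. 2 powr (2 - kappa \<delta>) * kappa \<delta> / (K0 * Gamma (kappa \<delta>))
                    * real (2 * m) powr (- (kappa \<delta> + 1)) * Lfun \<delta> p (sqrt (real (2 * m)))))
       \<and> (\<delta> = -1 \<and> filterlim (scaleM p) at_top at_top \<longrightarrow>
            (\<lambda>n. return_tail_prob p n) \<sim>[at_top] (\<lambda>n. 1 / (K0 * nu \<delta> p n)))"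
proof -
  obtain \<epsilon> where \<epsilon>: "\<epsilon> > 0" "\<And>x. x \<ge> 1 \<Longrightarrow> \<epsilon> \<le> p x \<and> p x \<le> 1 - \<epsilon>"
    using ellip by auto
  interpret bessel_walk p \<delta>
  proof
    fix x :: nat assume "x \<ge> 1"
    from \<epsilon>(2)[OF this] \<epsilon>(1) show "p x > 0" "p x < 1" by linarith+
  qed (rule R_small)
  show ?thesis
  proof (intro conjI impI)
    assume \<delta>: "\<delta> > -1"
    interpret normalized_bessel_walk p \<delta> K0
      by unfold_locales (use delta scaleM_diverges[OF \<delta>] K0_pos K0 in auto)
    have \<kappa>: "kappa \<delta> > 0" using \<delta> by (simp add: kappa_def)
    have "(\<lambda>n. rate_const * tail_rate n) = (\<lambda>n. 2 powr (1 - kappa \<delta>) / (K0 * Gamma (kappa \<delta>))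
                    * real n powr (- kappa \<delta>) * Lfun \<delta> p (sqrt (real n)))"
      by (simp add: rate_const_def tail_rate_def fun_eq_iff)
    then show "(\<lambda>n. return_tail_prob p n) \<sim>[at_top] (\<lambda>n. 2 powr (1 - kappa \<delta>) / (K0 * Gamma (kappa \<delta>))
                    * real n powr (- kappa \<delta>) * Lfun \<delta> p (sqrt (real n)))"
      using asymp_equivI'[OF return_tail_rate[OF \<kappa>]] by simp
    have "(\<lambda>m. 2 * kappa \<delta> * rate_const * tail_rate (2 * m) / real (2 * m)) = (\<lambda>m. 2 powr (2 - kappa \<delta>) * kappa \<delta> / (K0 * Gamma (kappa \<delta>))
                    * real (2 * m) powr (- (kappa \<delta> + 1)) * Lfun \<delta> p (sqrt (real (2 * m))))"
    proof
      fix m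
      have "2 powr (2 - kappa \<delta>) = 2 * 2 powr (1 - kappa \<delta>)"
        using powr_add[of 2 1 "1 - kappa \<delta>"] by simp
      moreover have "real (2 * m) powr (- (kappa \<delta> + 1)) = real (2 * m) powr (- kappa \<delta>) / real (2 * m)"
        using powr_diff[of "real (2 * m)" "- kappa \<delta>" 1] by simp
      ultimately show "2 * kappa \<delta> * rate_const * tail_rate (2 * m) / real (2 * m) = 2 powr (2 - kappa \<delta>) * kappa \<delta> / (K0 * Gamma (kappa \<delta>))
                    * real (2 * m) powr (- (kappa \<delta> + 1)) * Lfun \<delta> p (sqrt (real (2 * m)))"
        by (simp only: rate_const_def tail_rate_def) simp
    qed
    then show "(\<lambda>m. first_return_prob p (2 * m)) \<sim>[at_top] (\<lambda>m. 2 powr (2 - kappa \<delta>) * kappa \<delta> / (K0 * Gamma (kappa \<delta>))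
                    * real (2 * m) powr (- (kappa \<delta> + 1)) * Lfun \<delta> p (sqrt (real (2 * m))))"
      using asymp_equivI'[OF first_return_rate[OF \<kappa>]] by simp
  next
    assume *: "\<delta> = -1 \<and> filterlim (scaleM p) at_top at_top"
    then have \<delta>: "\<delta> = -1" by simp
    interpret normalized_bessel_walk p \<delta> K0
      by unfold_locales (use delta * K0_pos K0 in auto)
    show "(\<lambda>n. return_tail_prob p n) \<sim>[at_top] (\<lambda>n. 1 / (K0 * nu \<delta> p n))"
      by (rule asymp_equivI'[OF return_tail_nu[OF \<delta>]])
  qed
qed

end
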